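(* Let $n \ge 2$ and $\Gamma = \mathrm{Sp}_n(\mathcal{O})$. If $t \in \Delta_n$ is a special vertex, then the number of vertices in $\Delta_n$ close to $t$ is the number of left cosets of $\Gamma$ in $$\Gamma\, \mathrm{diag}(1, \underbrace{\pi, \ldots, \pi}_{n-1}, \pi^2, \underbrace{\pi, \ldots, \pi}_{n-1})\, \Gamma .$$
   Context: $K$ is a (nonarchimedean) local field with discrete valuation $\mathrm{ord}$, valuation ring $\mathcal{O}$, uniformizer $\pi$ and residue field $k \cong \mathbb{F}_q$. $\mathrm{Sp}_n$ denotes the symplectic group of $2n\times 2n$ matrices: with $J_n = \begin{pmatrix} 0 & I_n \\ -I_n & 0\end{pmatrix}$, $\mathrm{Sp}_n(\mathcal{O})$ is the group of $g \in \mathrm{GL}_{2n}(\mathcal{O})$ with $g^{t} J_n g = J_n$. A left coset of $\Gamma$ in the double coset is a subset $g\Gamma$. Let $V$ be a $2n$-dimensional $K$-vector space with a non-degenerate alternating bilinear form $\langle\cdot,\cdot\rangle$. A lattice in $V$ is a free $\mathcal{O}$-submodule of rank $2n$; $[L]$ is the homothety class $\{\alpha L : \alpha\in K^\times\}$. A lattice $L$ is primitive if $\langle L,L\rangle\subseteq\mathcal{O}$ and $\langle\cdot,\cdot\rangle$ induces a non-degenerate alternating $k$-bilinear form on $L/\pi L$. The affine building $\Delta_n$ of $\mathrm{Sp}_n(K)$ is the following $n$-dimensional simplicial complex. A vertex is a homothety class of lattices in $V$ having a representative $L$ for which there is a primitive lattice $L_0$ with $\langle L,L\rangle\subseteq\pi\mathcal{O}$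 and $\pi L_0\subseteq L\subseteq L_0$. Vertices $t,t'$ are incident if there are $L\in t$, $L'\in t'$ and a primitive lattice $L_0$ with $\langle L,L\rangle\subseteq\pi\mathcal{O}$, $\langle L',L'\rangle\subseteq\pi\mathcal{O}$, and either $\pi L_0\subseteq L\subseteq L'\subseteq L_0$ or $\pi L_0\subseteq L'\subseteq L\subseteq L_0$. Simplices are the finite sets of pairwise incident vertices. A chamber (maximal simplex) has $n+1$ vertices $t_0,\dots,t_n$ with representatives $L_i\in t_i$ such that $L_0$ is primitive, $\langle L_i,L_i\rangle\subseteq\pi\mathcal{O}$ for $1\le i\le n$, and $\pi L_0\subsetneq L_1\subsetneq\cdots\subsetneq L_n\subsetneq L_0$. Two chambers are adjacent if they share a codimension-one face. Two vertices $t,t'$ of $\Delta_n$ are close if there are adjacent chambers $C,C'$ in $\Delta_n$ with $t\in C$, $t'\in C'$, but $t,t'\notin C\cap C'$. A basis $\{u_1,\dots,u_n,w_1,\dots,w_n\}$ of $V$ is symplectic if $\langle u_i,w_j\rangle=\delta_{ij}$ and $\langle u_i,u_j\rangle=0=\langle w_i,w_j\rangle$ for all $i,j$. A vertex $t$ of $\Delta_n$ is special (in the usual sense for affine buildings) if and only if there are a symplectic basis of $V$ and integers $a_1,\dots,a_n,\mu$ with $t=[\sum_i \mathcal{O}\pi^{a_i}u_i+\sum_i\mathcal{O}\pi^{\mu-a_i}w_i]$; this may be taken as the definition. *)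

theory Defs
  imports Complex_Main "HOL-Algebra.Coset" "Jordan_Normal_Form.Matrix"
begin

section \<open>Nonarchimedean local fields\<close>

text \<open>
  The valuation is normalized by \<^prop>\<open>ord \<pi> = (1::int)\<close>. Its value at 0 (which should be
  infinite) is left unconstrained, and every use of \<^term>\<open>ord\<close> treats 0 separately.
\<close>

locale discrete_valuation =
  fixes ord :: "'k::field \<Rightarrow> int" and \<pi> :: 'k
  assumes ord_mult: "x \<noteq> 0 \<Longrightarrow> y \<noteq> 0 \<Longrightarrow> ord (x * y) = ord x + ord y"
    and ord_add: "x \<noteq> 0 \<Longrightarrow> y \<noteq> 0 \<Longrightarrow> x + y \<noteq> 0 \<Longrightarrow> min (ord x) (ord y) \<le> ord (x + y)"
    and uniformizer_nonzero: "\<pi> \<noteq> 0"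
    and ord_uniformizer: "ord \<pi> = 1"
begin

definition val_ring :: "'k set" ("\<O>") where
  "\<O> = {x. x = 0 \<or> 0 \<le> ord x}"

definition max_ideal :: "'k set" ("\<pi>\<O>") where
  "\<pi>\<O> = (\<lambda>x. \<pi> * x) ` \<O>"

definition residue_field :: "'k set set" where
  "residue_field = \<O> // {(x, y). x \<in> \<O> \<and> y \<in> \<O> \<and> x - y \<in> \<pi>\<O>}"

definition val_near :: "int \<Rightarrow> 'k \<Rightarrow> 'k \<Rightarrow> bool" where
  "val_near N x y \<longleftrightarrow> x = y \<or> N \<le> ord (x - y)"

definition val_Cauchy :: "(nat \<Rightarrow> 'k) \<Rightarrow> bool" where
  "val_Cauchy X \<longleftrightarrow> (\<forall>N. \<exists>M. \<forall>i\<ge>M. \<forall>j\<ge>M. val_near N (X i) (X j))"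

definition val_converges :: "(nat \<Rightarrow> 'k) \<Rightarrow> 'k \<Rightarrow> bool" where
  "val_converges X x \<longleftrightarrow> (\<forall>N. \<exists>M. \<forall>i\<ge>M. val_near N (X i) x)"

end

locale local_field = discrete_valuation ord \<pi>
  for ord :: "'k::field \<Rightarrow> int" and \<pi> :: 'k +
  assumes complete: "val_Cauchy X \<Longrightarrow> \<exists>x. val_converges X x"
    and finite_residue_field: "finite residue_field"


section \<open>The symplectic group and its double coset\<close>

definition J_mat :: "nat \<Rightarrow> 'k::field mat" where
  "J_mat n = four_block_mat (0\<^sub>m n n) (1\<^sub>m n) (- 1\<^sub>m n) (0\<^sub>m n n)"

context discrete_valuation
begin

definition mats_over_O :: "nat \<Rightarrow> 'k mat set" where
  "mats_over_O m = {A \<in> carrier_mat m m. elements_mat A \<subseteq> \<O>}"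

definition GL_O :: "nat \<Rightarrow> 'k mat set" where
  "GL_O m = {g \<in> mats_over_O m. \<exists>h \<in> mats_over_O m. g * h = 1\<^sub>m m \<and> h * g = 1\<^sub>m m}"

definition Sp_O :: "nat \<Rightarrow> 'k mat set" where
  "Sp_O n = {g \<in> GL_O (2 * n). transpose_mat g * J_mat n * g = J_mat n}"

definition diag_elt :: "nat \<Rightarrow> 'k mat" where
  "diag_elt n = mat_diag (2 * n)
     (\<lambda>i. ([1] @ replicate (n - 1) \<pi> @ [\<pi>\<^sup>2] @ replicate (n - 1) \<pi>) ! i)"

text \<open>The multiplicative structure of \<^term>\<open>ring_mat\<close> is used only to express products of sets.\<close>

abbreviation mat_monoid :: "nat \<Rightarrow> 'k mat ring" where
  "mat_monoid n \<equiv> ring_mat TYPE('k) (2 * n) ()"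

definition double_coset :: "nat \<Rightarrow> 'k mat set" where
  "double_coset n = Sp_O n <#>\<^bsub>mat_monoid n\<^esub> (diag_elt n <#\<^bsub>mat_monoid n\<^esub> Sp_O n)"

definition left_cosets :: "nat \<Rightarrow> 'k mat set set" where
  "left_cosets n = (\<lambda>g. g <#\<^bsub>mat_monoid n\<^esub> Sp_O n) ` double_coset n"

end


section \<open>The affine building of the symplectic group\<close>

text \<open>
  The condition on \<^term>\<open>dim\<close> forces finite dimension when \<open>n > 0\<close>, because the
  dimension of an infinite-dimensional space is 0 by convention.
\<close>

locale symplectic_space = local_field ord \<pi> + vector_space scale
  for ord :: "'k::field \<Rightarrow> int" and \<pi> :: 'k
    and scale :: "'k \<Rightarrow> 'v::ab_group_add \<Rightarrow> 'v" (infixr "*s" 75) +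
  fixes form :: "'v \<Rightarrow> 'v \<Rightarrow> 'k" and n :: nat
  assumes dim_space: "dim (UNIV :: 'v set) = 2 * n"
    and form_linear_left: "Vector_Spaces.linear scale (*) (\<lambda>x. form x y)"
    and form_linear_right: "Vector_Spaces.linear scale (*) (\<lambda>y. form x y)"
    and form_alternating: "form x x = 0"
    and form_nondegenerate: "(\<And>y. form x y = 0) \<Longrightarrow> x = 0"
begin

definition is_lattice :: "'v set \<Rightarrow> bool" where
  "is_lattice L \<longleftrightarrow> (\<exists>S. finite S \<and> card S = 2 * n
     \<and> (\<forall>c. (\<forall>v\<in>S. c v \<in> \<O>) \<and> (\<Sum>v\<in>S. c v *s v) = 0 \<longrightarrow> (\<forall>v\<in>S. c v = 0))
     \<and> L = {\<Sum>v\<in>S. c v *s v |c. \<forall>v\<in>S. c v \<in> \<O>})"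

definition dilate :: "'k \<Rightarrow> 'v set \<Rightarrow> 'v set" where
  "dilate a L = (\<lambda>v. a *s v) ` L"

definition homothety_class :: "'v set \<Rightarrow> 'v set set" where
  "homothety_class L = {dilate a L |a. a \<noteq> 0}"

definition form_image :: "'v set \<Rightarrow> 'k set" where
  "form_image L = {form x y |x y. x \<in> L \<and> y \<in> L}"

text \<open>
  For a lattice on which the form takes integral values, the induced form on \<open>L/\<pi>L\<close> is
  automatically well defined, bilinear and alternating over the residue field. The last conjunct
  says that its radical is trivial: a class \<open>x + \<pi>L\<close> pairing to 0 in the residue field with all
  classes is the zero class.
\<close>

definition primitive_lattice :: "'v set \<Rightarrow> bool" where
  "primitive_lattice L \<longleftrightarrow> is_lattice L \<and> form_image L \<subseteq> \<O>
     \<and> (\<forall>x\<in>L. (\<forall>y\<in>L. form x y \<in> \<pi>\<O>) \<longrightarrow> x \<in> dilate \<pi> L)"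

definition is_vertex :: "'v set set \<Rightarrow> bool" where
  "is_vertex t \<longleftrightarrow> (\<exists>L L0. is_lattice L \<and> t = homothety_class L \<and> primitive_lattice L0
     \<and> form_image L \<subseteq> \<pi>\<O> \<and> dilate \<pi> L0 \<subseteq> L \<and> L \<subseteq> L0)"

definition incident :: "'v set set \<Rightarrow> 'v set set \<Rightarrow> bool" where
  "incident t t' \<longleftrightarrow> (\<exists>L\<in>t. \<exists>L'\<in>t'. \<exists>L0. primitive_lattice L0
     \<and> form_image L \<subseteq> \<pi>\<O> \<and> form_image L' \<subseteq> \<pi>\<O>
     \<and> (dilate \<pi> L0 \<subseteq> L \<and> L \<subseteq> L' \<and> L' \<subseteq> L0 \<or> dilate \<pi> L0 \<subseteq> L' \<and> L' \<subseteq> L \<and> L \<subseteq> L0))"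

definition simplex :: "'v set set set \<Rightarrow> bool" where
  "simplex C \<longleftrightarrow> finite C \<and> (\<forall>t\<in>C. is_vertex t) \<and> (\<forall>t\<in>C. \<forall>t'\<in>C. incident t t')"

definition chamber :: "'v set set set \<Rightarrow> bool" where
  "chamber C \<longleftrightarrow> simplex C \<and> (\<forall>D. simplex D \<and> C \<subseteq> D \<longrightarrow> D = C)"

text \<open>
  Adjacency as defined here is reflexive; this does not affect \<open>close_vertices\<close> below, whose
  conditions force the two chambers to be distinct.
\<close>

definition adjacent :: "'v set set set \<Rightarrow> 'v set set set \<Rightarrow> bool" where
  "adjacent C C' \<longleftrightarrow> chamber C \<and> chamber C'
     \<and> (\<exists>F. F \<subseteq> C \<and> F \<subseteq> C' \<and> card C = card F + 1 \<and> card C' = card F + 1)"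

definition close_vertices :: "'v set set \<Rightarrow> 'v set set \<Rightarrow> bool" where
  "close_vertices t t' \<longleftrightarrow> is_vertex t \<and> is_vertex t'
     \<and> (\<exists>C C'. adjacent C C' \<and> t \<in> C \<and> t' \<in> C' \<and> t \<notin> C \<inter> C' \<and> t' \<notin> C \<inter> C')"

definition symplectic_basis :: "(nat \<Rightarrow> 'v) \<Rightarrow> (nat \<Rightarrow> 'v) \<Rightarrow> bool" where
  "symplectic_basis u w \<longleftrightarrow>
     independent (u ` {1..n} \<union> w ` {1..n}) \<and> span (u ` {1..n} \<union> w ` {1..n}) = UNIV
     \<and> (\<forall>i\<in>{1..n}. \<forall>j\<in>{1..n}. form (u i) (w j) = (if i = j then 1 else 0)
          \<and> form (u i) (u j) = 0 \<and> form (w i) (w j) = 0)"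

definition special_vertex :: "'v set set \<Rightarrow> bool" where
  "special_vertex t \<longleftrightarrow> is_vertex t \<and> (\<exists>u w (a :: nat \<Rightarrow> int) (\<mu> :: int). symplectic_basis u w
     \<and> t = homothety_class
         {(\<Sum>i=1..n. (c i * \<pi> powi a i) *s u i) + (\<Sum>i=1..n. (d i * \<pi> powi (\<mu> - a i)) *s w i)
          |c d. \<forall>i\<in>{1..n}. c i \<in> \<O> \<and> d i \<in> \<O>})"

end

end

theory Submission
  imports Defs
begin

text \<open>
  A special vertex is the class of a lattice \<open>L\<close> that is its own dual either for the form or for the
  form divided by \<open>\<pi>\<close>. Rescaling the form turns one case into the other as far as the lattice \<open>L\<close>
  itself is concerned, although not for the building, whose definition prefers one of the two. Call a
  self-dual lattice \<open>L'\<close> a neighbour of \<open>L\<close> if \<open>(L + L')/L\<close> has length one. Both numbers in the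
  theorem count the neighbours of \<open>L\<close>.

  Cosets. Fix a symplectic basis of \<open>L\<close> and let a matrix \<open>g\<close> of the double coset recombine it;
  \<open>\<pi>\<^sup>-\<^sup>1gL\<close> is then a neighbour, because the diagonal matrix divided by \<open>\<pi>\<close> only replaces \<open>b\<^sub>0\<close> by
  \<open>\<pi>\<^sup>-\<^sup>1b\<^sub>0\<close> and \<open>b\<^sub>n\<close> by \<open>\<pi>b\<^sub>n\<close>. All elements of the double coset multiply the form by \<open>\<pi>\<^sup>2\<close>, hence two
  of them give the same lattice exactly if they differ by an integral symplectic matrix on the right:
  the fibres are the left cosets (\<open>coset_lattice_eq_iff\<close>). The map is onto
  (\<open>coset_lattice_image\<close>): a neighbour is determined by one vector \<open>x\<close> of \<open>L' - L\<close>, being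
  \<open>\<O>x + {y \<in> L. form x y \<in> \<O>}\<close>, and two transvections move \<open>b\<^sub>0\<close> to the vector \<open>\<pi>x\<close>
  (\<open>similitude_extend\<close>).

  Closeness. Every vertex has exactly one representative satisfying the conditions on \<open>L\<close> in the
  definition of a vertex, and in terms of these representatives the simplices are finite chains
  \<open>\<pi>L\<^sub>0 \<subseteq> \<dots> \<subseteq> L\<^sub>0\<close> of lattices that are isotropic modulo \<open>\<pi>\<close>. A maximal chain starts with some \<open>\<pi>L\<^sub>0\<close>,
  \<open>L\<^sub>0\<close> primitive, and ends with a Lagrangian lattice, one self-dual for the form divided by \<open>\<pi>\<close>, and
  it contains no second lattice of either kind. Two maximal chains that differ in an end \<open>N\<close> only thus
  differ by another lattice \<open>N'\<close> of the same kind, and maximality forces the length to be one: a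
  longer step would leave room for one more lattice. Conversely, if \<open>L\<close> and \<open>L'\<close> are neighbours, then
  all other members of a chain through \<open>L\<close> and through \<open>\<pi>(L + L')\<close> (respectively \<open>L \<inter> L'\<close> for
  Lagrangian lattices) fit \<open>L'\<close> as well, so that \<open>L\<close> and \<open>L'\<close> can be exchanged in a maximal chain
  (\<open>flag_neighbours_primitive\<close>, \<open>flag_neighbours_lagrangian\<close>).
\<close>

section \<open>Integers of a discretely valued field\<close>

context discrete_valuation
begin

lemma ord_one: "ord 1 = 0"
  using ord_mult[of 1 1] by simp

lemma ord_minus: "ord (- x) = ord x" if "x \<noteq> 0"
proof -
  have "ord (- 1) = 0"
    using ord_mult[of "- 1" "- 1"] ord_one by simp
  then show ?thesis
    using ord_mult[of "- 1" x] that by simp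
qed

lemma ord_inverse: "ord (inverse x) = - ord x" if "x \<noteq> 0"
  using ord_mult[of x "inverse x"] that ord_one by simp

lemma ord_divide: "ord (x / y) = ord x - ord y" if "x \<noteq> 0" "y \<noteq> 0"
  using that by (simp add: divide_inverse ord_mult ord_inverse)

lemma ord_uniformizer_power: "ord (\<pi> ^ k) = int k"
  by (induction k) (simp_all add: ord_one ord_mult uniformizer_nonzero ord_uniformizer)

lemma val_ring_0: "0 \<in> \<O>"
  by (simp add: val_ring_def)

lemma val_ring_1: "1 \<in> \<O>"
  by (simp add: val_ring_def ord_one)

lemma val_ring_add: "x + y \<in> \<O>" if "x \<in> \<O>" "y \<in> \<O>"
  using that ord_add[of x y] by (cases "x = 0"; cases "y = 0"; cases "x + y = 0") (auto simp: val_ring_def)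

lemma val_ring_mult: "x * y \<in> \<O>" if "x \<in> \<O>" "y \<in> \<O>"
  using that ord_mult[of x y] by (cases "x = 0"; cases "y = 0") (auto simp: val_ring_def)

lemma val_ring_minus: "- x \<in> \<O>" if "x \<in> \<O>"
  using that ord_minus[of x] by (cases "x = 0") (auto simp: val_ring_def)

lemma val_ring_sum: "(\<And>i. i \<in> I \<Longrightarrow> f i \<in> \<O>) \<Longrightarrow> (\<Sum>i\<in>I. f i) \<in> \<O>"
  by (induction I rule: infinite_finite_induct) (auto simp: val_ring_0 val_ring_add)

lemma val_ring_uniformizer: "\<pi> \<in> \<O>"
  by (simp add: val_ring_def ord_uniformizer)

lemma val_ring_uniformizer_power: "\<pi> ^ k \<in> \<O>"
  by (simp add: val_ring_def ord_uniformizer_power)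

lemma max_ideal_iff_divide: "x \<in> \<pi>\<O> \<longleftrightarrow> x / \<pi> \<in> \<O>"
  by (force simp: max_ideal_def image_iff uniformizer_nonzero field_simps)

lemma max_ideal_iff: "x \<in> \<pi>\<O> \<longleftrightarrow> x = 0 \<or> 1 \<le> ord x"
  by (cases "x = 0")
    (auto simp: max_ideal_iff_divide val_ring_def ord_divide uniformizer_nonzero ord_uniformizer)

lemma uniformizer_mult_max_ideal_iff: "\<pi> * x \<in> \<pi>\<O> \<longleftrightarrow> x \<in> \<O>"
  by (simp add: max_ideal_iff_divide uniformizer_nonzero)

lemma max_ideal_0: "0 \<in> \<pi>\<O>"
  by (simp add: max_ideal_iff)

lemma max_ideal_add: "x + y \<in> \<pi>\<O>" if "x \<in> \<pi>\<O>" "y \<in> \<pi>\<O>"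
  using that val_ring_add by (simp add: max_ideal_iff_divide add_divide_distrib)

lemma max_ideal_mult: "c * x \<in> \<pi>\<O>" if "c \<in> \<O>" "x \<in> \<pi>\<O>"
  using that val_ring_mult[of c "x / \<pi>"] by (simp add: max_ideal_iff_divide)

lemma max_ideal_minus: "- x \<in> \<pi>\<O>" if "x \<in> \<pi>\<O>"
  using that val_ring_minus[of "x / \<pi>"] by (simp add: max_ideal_iff_divide)

lemma one_notin_max_ideal: "1 \<notin> \<pi>\<O>"
  by (simp add: max_ideal_iff ord_one)

lemma unit_iff: "x \<in> \<O> \<and> x \<notin> \<pi>\<O> \<longleftrightarrow> x \<noteq> 0 \<and> ord x = 0"
  by (auto simp: max_ideal_iff val_ring_def)

lemma inverse_unit: "inverse x \<in> \<O>" if "x \<in> \<O>" "x \<notin> \<pi>\<O>"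
  using that ord_inverse[of x] by (auto simp: max_ideal_iff val_ring_def)

lemma inverse_nonintegral: "x \<noteq> 0" "inverse x \<in> \<O>" if "x \<notin> \<O>"
  using that ord_inverse[of x] by (auto simp: val_ring_def)

lemma common_denominator:
  assumes "finite I"
  shows "\<exists>k. \<forall>i\<in>I. \<pi> ^ k * c i \<in> \<O>"
  using assms
proof (induction I)
  case (insert i I)
  then obtain k where k: "\<forall>i\<in>I. \<pi> ^ k * c i \<in> \<O>" by blast
  define l where "l = nat (- ord (c i))"
  have i: "\<pi> ^ l * c i \<in> \<O>"
    by (cases "c i = 0")
      (auto simp: val_ring_def l_def ord_mult uniformizer_nonzero ord_uniformizer_power)
  have "\<pi> ^ (k + l) * c j \<in> \<O>" if "j \<in> insert i I" for j
    using that k i val_ring_mult[OF val_ring_uniformizer_power[of l], of "\<pi> ^ k * c j"]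
      val_ring_mult[OF val_ring_uniformizer_power[of k], of "\<pi> ^ l * c j"]
    by (auto simp: power_add mult_ac)
  then show ?case by blast
qed simp

end

lemma (in local_field) finite_residue_representatives:
  "\<exists>R. finite R \<and> R \<subseteq> \<O> \<and> (\<forall>x\<in>\<O>. \<exists>r\<in>R. x - r \<in> \<pi>\<O>)"
proof (intro exI conjI ballI)
  define rel where "rel = {(x, y). x \<in> \<O> \<and> y \<in> \<O> \<and> x - y \<in> \<pi>\<O>}"
  define R where "R = (\<lambda>X. SOME x. x \<in> X) ` residue_field"
  have rel: "residue_field = (\<lambda>a. rel `` {a}) ` \<O>"
    unfolding residue_field_def rel_def quotient_def UNION_singleton_eq_range ..
  have some: "(SOME x. x \<in> rel `` {a}) \<in> rel `` {a}" if "a \<in> \<O>" for a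
    by (rule someI[where x = a]) (use that in \<open>simp add: rel_def max_ideal_0\<close>)
  show "finite R"
    by (simp add: R_def finite_residue_field)
  show "R \<subseteq> \<O>"
  proof
    fix r assume "r \<in> R"
    then obtain a where a: "a \<in> \<O>" "r = (SOME x. x \<in> rel `` {a})"
      unfolding R_def rel by blast
    then have "(a, r) \<in> rel"
      using some[OF a(1)] by simp
    then show "r \<in> \<O>"
      by (simp add: rel_def)
  qed
  show "\<exists>r\<in>R. x - r \<in> \<pi>\<O>" if "x \<in> \<O>" for x
  proof
    have "(x, SOME y. y \<in> rel `` {x}) \<in> rel"
      using some[OF that] by simp
    moreover have "x - y \<in> \<pi>\<O>" if "(x, y) \<in> rel" for y
      using that by (simp add: rel_def)
    ultimately show "x - (SOME y. y \<in> rel `` {x}) \<in> \<pi>\<O>"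
      by blast
    show "(SOME y. y \<in> rel `` {x}) \<in> R"
      unfolding R_def rel using that by blast
  qed
qed


section \<open>Lattices\<close>

text \<open>
  In positive rank the dimension condition on the space says that it is finite-dimensional.
\<close>

locale pos_symplectic_space = symplectic_space ord \<pi> scale form n
  for ord :: "'k::field \<Rightarrow> int" and \<pi> :: 'k
    and scale :: "'k \<Rightarrow> 'v::ab_group_add \<Rightarrow> 'v" (infixr "*s" 75)
    and form :: "'v \<Rightarrow> 'v \<Rightarrow> 'k" and n :: nat +
  assumes rank_pos: "0 < n"
begin

definition submod :: "'v set \<Rightarrow> bool" where
  "submod N \<longleftrightarrow> 0 \<in> N \<and> (\<forall>x\<in>N. \<forall>y\<in>N. x + y \<in> N) \<and> (\<forall>c\<in>\<O>. \<forall>x\<in>N. c *s x \<in> N)"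

definition ospan :: "(nat \<Rightarrow> 'v) \<Rightarrow> 'v set" where
  "ospan b = {\<Sum>i<2*n. c i *s b i |c. \<forall>i<2*n. c i \<in> \<O>}"

definition indep_family :: "(nat \<Rightarrow> 'v) \<Rightarrow> bool" where
  "indep_family b \<longleftrightarrow> (\<forall>c. (\<Sum>i<2*n. c i *s b i) = 0 \<longrightarrow> (\<forall>i<2*n. c i = 0))"

definition adjoin :: "'v set \<Rightarrow> 'v \<Rightarrow> 'v set" where
  "adjoin M x = {m + c *s x |m c. m \<in> M \<and> c \<in> \<O>}"

lemma submod_0: "submod N \<Longrightarrow> 0 \<in> N"
  and submod_add: "submod N \<Longrightarrow> x \<in> N \<Longrightarrow> y \<in> N \<Longrightarrow> x + y \<in> N"
  and submod_scale: "submod N \<Longrightarrow> c \<in> \<O> \<Longrightarrow> x \<in> N \<Longrightarrow> c *s x \<in> N"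
  by (auto simp: submod_def)

lemma submod_minus: "submod N \<Longrightarrow> x \<in> N \<Longrightarrow> - x \<in> N"
  using submod_scale[of N "- 1" x] val_ring_minus[OF val_ring_1] by simp

lemma submod_diff: "submod N \<Longrightarrow> x \<in> N \<Longrightarrow> y \<in> N \<Longrightarrow> x - y \<in> N"
  using submod_add[of N x "- y"] submod_minus by simp

lemma submod_sum: "submod N \<Longrightarrow> (\<And>i. i \<in> I \<Longrightarrow> f i \<in> N) \<Longrightarrow> (\<Sum>i\<in>I. f i) \<in> N"
  by (induction I rule: infinite_finite_induct) (auto simp: submod_0 submod_add)

lemma submod_inter: "submod M \<Longrightarrow> submod N \<Longrightarrow> submod (M \<inter> N)"
  by (auto simp: submod_def)

lemma mem_dilate_iff: "v \<in> dilate a L \<longleftrightarrow> inverse a *s v \<in> L" if "a \<noteq> 0"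
proof
  assume "inverse a *s v \<in> L"
  then have "a *s inverse a *s v \<in> dilate a L"
    unfolding dilate_def by (rule imageI)
  then show "v \<in> dilate a L"
    using that by simp
qed (use that in \<open>auto simp: dilate_def\<close>)

lemma dilate_dilate: "dilate a (dilate b L) = dilate (a * b) L"
  by (auto simp: dilate_def image_image)

lemma dilate_1: "dilate 1 L = L"
  by (simp add: dilate_def)

lemma dilate_mono_iff: "dilate a L \<subseteq> dilate a M \<longleftrightarrow> L \<subseteq> M" if "a \<noteq> 0"
  using that by (auto simp: dilate_def inj_on_def)

lemma dilate_subset_iff: "dilate a L \<subseteq> M \<longleftrightarrow> L \<subseteq> dilate (inverse a) M" if "a \<noteq> 0"
  using that dilate_mono_iff[of a L "dilate (inverse a) M"]
  by (simp add: dilate_dilate dilate_1)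

lemma submod_dilate: "submod L \<Longrightarrow> submod (dilate a L)"
proof -
  assume L: "submod L"
  have "a *s x + a *s y \<in> dilate a L" if "x \<in> L" "y \<in> L" for x y
    using submod_add[OF L that] by (auto simp: dilate_def scale_right_distrib[symmetric])
  moreover have "c *s a *s x \<in> dilate a L" if "x \<in> L" "c \<in> \<O>" for c x
    using submod_scale[OF L that(2,1)]
    by (metis dilate_def image_eqI scale_left_commute)
  moreover have "0 \<in> dilate a L"
    using submod_0[OF L] by (force simp: dilate_def)
  ultimately show ?thesis
    by (auto simp: submod_def dilate_def)
qed

lemma dilate_subset: "dilate a L \<subseteq> L" if "submod L" "a \<in> \<O>"
  using that by (auto simp: dilate_def submod_scale)

lemma adjoin_superset: "M \<subseteq> adjoin M x"
  using val_ring_0 by (force simp: adjoin_def)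

lemma adjoin_self: "submod M \<Longrightarrow> x \<in> adjoin M x"
  using val_ring_1 submod_0 unfolding adjoin_def by force

lemma submod_adjoin: "submod (adjoin M x)" if M: "submod M"
proof -
  have "\<exists>m' d. m1 + c1 *s x + (m2 + c2 *s x) = m' + d *s x \<and> m' \<in> M \<and> d \<in> \<O>"
    if "m1 \<in> M" "m2 \<in> M" "c1 \<in> \<O>" "c2 \<in> \<O>" for m1 m2 c1 c2
    using that submod_add[OF M] val_ring_add
    by (intro exI[of _ "m1 + m2"] exI[of _ "c1 + c2"]) (simp add: algebra_simps)
  moreover have "\<exists>m' d. c *s (m1 + c1 *s x) = m' + d *s x \<and> m' \<in> M \<and> d \<in> \<O>"
    if "m1 \<in> M" "c \<in> \<O>" "c1 \<in> \<O>" for m1 c c1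
    using that submod_scale[OF M] val_ring_mult
    by (intro exI[of _ "c *s m1"] exI[of _ "c * c1"]) (simp add: algebra_simps)
  moreover have "0 \<in> adjoin M x"
    using adjoin_superset submod_0[OF M] by blast
  ultimately show ?thesis
    unfolding submod_def by (fastforce simp: adjoin_def)
qed

lemma adjoin_subset: "adjoin M x \<subseteq> N" if "submod N" "M \<subseteq> N" "x \<in> N"
  using that by (auto simp: adjoin_def submod_add submod_scale subsetD)

lemma ospanI: "(\<And>i. i < 2 * n \<Longrightarrow> c i \<in> \<O>) \<Longrightarrow> (\<Sum>i<2*n. c i *s b i) \<in> ospan b"
  unfolding ospan_def by blast

lemma submod_ospan: "submod (ospan b)"
proof -
  have "\<exists>c. (\<Sum>i<2*n. c1 i *s b i) + (\<Sum>i<2*n. c2 i *s b i) = (\<Sum>i<2*n. c i *s b i)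
      \<and> (\<forall>i<2*n. c i \<in> \<O>)"
    if "\<forall>i<2*n. c1 i \<in> \<O>" "\<forall>i<2*n. c2 i \<in> \<O>" for c1 c2
    using that by (intro exI[of _ "\<lambda>i. c1 i + c2 i"])
      (simp add: sum.distrib[symmetric] scale_left_distrib val_ring_add)
  moreover have "\<exists>c. d *s (\<Sum>i<2*n. c1 i *s b i) = (\<Sum>i<2*n. c i *s b i) \<and> (\<forall>i<2*n. c i \<in> \<O>)"
    if "\<forall>i<2*n. c1 i \<in> \<O>" "d \<in> \<O>" for c1 d
    using that by (intro exI[of _ "\<lambda>i. d * c1 i"]) (simp add: scale_sum_right val_ring_mult)
  moreover have "0 \<in> ospan b"
    unfolding ospan_def using val_ring_0 by (auto intro!: exI[of _ "\<lambda>_. 0"])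
  ultimately show ?thesis
    by (fastforce simp: submod_def ospan_def)
qed

lemma ospan_generator: "b i \<in> ospan b" if "i < 2 * n"
proof -
  have "(\<Sum>j<2*n. (if j = i then 1 else 0) *s b j) = (\<Sum>j<2*n. if j = i then b j else 0)"
    by (intro sum.cong) auto
  also have "\<dots> = b i"
    using that by simp
  finally show ?thesis
    unfolding ospan_def using val_ring_0 val_ring_1
    by (auto intro!: exI[of _ "\<lambda>j. if j = i then 1 else 0"])
qed

lemma ospan_subset: "ospan b \<subseteq> N" if "submod N" "\<And>i. i < 2 * n \<Longrightarrow> b i \<in> N"
  using that by (auto simp: ospan_def intro!: submod_sum submod_scale)

lemma indep_familyD: "indep_family b \<Longrightarrow> (\<Sum>i<2*n. c i *s b i) = 0 \<Longrightarrow> i < 2 * n \<Longrightarrow> c i = 0"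
  unfolding indep_family_def by blast

lemma indep_family_inj:
  assumes b: "indep_family b"
  shows "inj_on b {..<2*n}"
proof (rule inj_onI, rule ccontr)
  fix i j assume ij: "i \<in> {..<2*n}" "j \<in> {..<2*n}" "b i = b j" "i \<noteq> j"
  have "(\<Sum>k<2*n. ((if k = i then 1 else 0) - (if k = j then 1 else 0)) *s b k)
     = (\<Sum>k<2*n. (if k = i then b k else 0) - (if k = j then b k else 0))"
    by (intro sum.cong) (auto simp: scale_left_diff_distrib)
  also have "\<dots> = 0"
    using ij by (simp add: sum_subtractf)
  finally have "\<forall>k<2*n. (if k = i then 1 else 0) - (if k = j then 1 else 0) = (0 :: 'k)"
    using b[unfolded indep_family_def, THEN spec,
        of "\<lambda>k. (if k = i then 1 else 0) - (if k = j then 1 else 0)"] by blast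
  then have "(if i = i then 1 else 0) - (if i = j then 1 else 0) = (0 :: 'k)"
    using ij(1) by blast
  then show False
    using ij by simp
qed

lemma indep_family_spans:
  assumes b: "indep_family b"
  shows "\<exists>c. v = (\<Sum>i<2*n. c i *s b i)"
proof -
  have inj: "inj_on b {..<2*n}"
    by (rule indep_family_inj[OF b])
  have indep: "independent (b ` {..<2*n})"
  proof (subst independent_explicit_finite_subsets, intro allI impI ballI)
    fix A u v assume A: "A \<subseteq> b ` {..<2*n}" "finite A" "(\<Sum>v\<in>A. u v *s v) = 0" "v \<in> A"
    define c where "c i = (if b i \<in> A then u (b i) else 0)" for i
    have "(\<Sum>i<2*n. c i *s b i) = (\<Sum>v\<in>b ` {..<2*n}. (if v \<in> A then u v else 0) *s v)"
      using inj by (simp add: sum.reindex c_def)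
    also have "\<dots> = (\<Sum>v\<in>A. u v *s v)"
      using A by (intro sum.mono_neutral_cong_right) auto
    finally have "\<forall>i<2*n. c i = 0"
      using b A(3) by (simp add: indep_family_def)
    then show "u v = 0"
      using A by (force simp: c_def)
  qed
  have "dim (UNIV :: 'v set) \<noteq> 0"
    using dim_space rank_pos by simp
  then obtain B where B: "independent B" "span B = UNIV"
    unfolding dim_def by (metis span_UNIV)
  have "card B = 2 * n"
    using dim_eq_card[of B UNIV] B dim_space by simp
  then have "finite B"
    using rank_pos card.infinite by fastforce
  then interpret fd: finite_dimensional_vector_space scale B
    using B by unfold_locales
  have "UNIV \<subseteq> span (b ` {..<2*n})"
    by (rule fd.card_ge_dim_independent) (use indep inj dim_space in \<open>auto simp: card_image\<close>)
  then obtain u where "v = (\<Sum>w\<in>b ` {..<2*n}. u w *s w)"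
    by (auto simp: span_finite)
  then show ?thesis
    using inj by (auto simp: sum.reindex)
qed

lemma is_lattice_iff: "is_lattice L \<longleftrightarrow> (\<exists>b. indep_family b \<and> L = ospan b)"
proof
  assume "is_lattice L"
  then obtain S where S: "finite S" "card S = 2 * n"
    "\<And>c. \<forall>v\<in>S. c v \<in> \<O> \<Longrightarrow> (\<Sum>v\<in>S. c v *s v) = 0 \<Longrightarrow> \<forall>v\<in>S. c v = 0"
    and L: "L = {\<Sum>v\<in>S. c v *s v |c. \<forall>v\<in>S. c v \<in> \<O>}"
    unfolding is_lattice_def by blast
  obtain b where b: "bij_betw b {..<2*n} S"
    using ex_bij_betw_nat_finite[OF S(1)] S(2) by (auto simp: atLeast0LessThan)
  define b' where "b' = inv_into {..<2*n} b"
  have b'b: "b' (b i) = i" if "i < 2 * n" for i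
    using b that by (simp add: b'_def bij_betw_def)
  have bb': "b (b' v) = v" "b' v < 2 * n" if "v \<in> S" for v
    using b that f_inv_into_f[of v b "{..<2*n}"] inv_into_into[of v b "{..<2*n}"]
    by (auto simp: b'_def bij_betw_def)
  have sum: "(\<Sum>v\<in>S. c v *s v) = (\<Sum>i<2*n. c (b i) *s b i)" for c
    by (rule sum.reindex_bij_betw[OF b, symmetric])
  have sum': "(\<Sum>i<2*n. c i *s b i) = (\<Sum>v\<in>S. c (b' v) *s v)" for c
    unfolding sum by (intro sum.cong) (auto simp: b'b)
  have "indep_family b"
    unfolding indep_family_def
  proof (intro allI impI)
    fix c i assume c: "(\<Sum>i<2*n. c i *s b i) = 0" and i: "i < 2 * n"
    obtain k where k: "\<forall>i\<in>{..<2*n}. \<pi> ^ k * c i \<in> \<O>"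
      using common_denominator by blast
    have "(\<Sum>v\<in>S. (\<pi> ^ k * c (b' v)) *s v) = \<pi> ^ k *s (\<Sum>v\<in>S. c (b' v) *s v)"
      by (simp add: scale_sum_right)
    also have "\<dots> = 0"
      using c sum' by simp
    finally have "(\<Sum>v\<in>S. (\<pi> ^ k * c (b' v)) *s v) = 0" .
    moreover have "\<forall>v\<in>S. \<pi> ^ k * c (b' v) \<in> \<O>"
      using k bb'(2) by blast
    ultimately have "\<forall>v\<in>S. \<pi> ^ k * c (b' v) = 0"
      by (intro S(3))
    moreover have "b i \<in> S"
      using i b by (auto simp: bij_betw_def)
    ultimately have "\<pi> ^ k * c (b' (b i)) = 0"
      by blast
    then show "c i = 0"
      using b'b[OF i] uniformizer_nonzero by simp
  qed
  moreover have "L = ospan b"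
  proof -
    have "\<exists>c'. (\<Sum>v\<in>S. c v *s v) = (\<Sum>i<2*n. c' i *s b i) \<and> (\<forall>i<2*n. c' i \<in> \<O>)"
      if "\<forall>v\<in>S. c v \<in> \<O>" for c
      using that b by (intro exI[of _ "\<lambda>i. c (b i)"]) (auto simp: sum bij_betw_def)
    moreover have "\<exists>c'. (\<Sum>i<2*n. c i *s b i) = (\<Sum>v\<in>S. c' v *s v) \<and> (\<forall>v\<in>S. c' v \<in> \<O>)"
      if "\<forall>i<2*n. c i \<in> \<O>" for c
      using that bb' by (intro exI[of _ "\<lambda>v. c (b' v)"]) (auto simp: sum')
    ultimately show ?thesis
      unfolding L ospan_def by blast
  qed
  ultimately show "\<exists>b. indep_family b \<and> L = ospan b"
    by blast
next
  assume "\<exists>b. indep_family b \<and> L = ospan b"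
  then obtain b where b: "indep_family b" and L: "L = ospan b" by blast
  have inj: "inj_on b {..<2*n}"
    by (rule indep_family_inj[OF b])
  show "is_lattice L"
    unfolding is_lattice_def
  proof (intro exI conjI)
    show "card (b ` {..<2*n}) = 2 * n"
      using inj by (simp add: card_image)
    show "\<forall>c. (\<forall>v\<in>b ` {..<2*n}. c v \<in> \<O>) \<and> (\<Sum>v\<in>b ` {..<2*n}. c v *s v) = 0
        \<longrightarrow> (\<forall>v\<in>b ` {..<2*n}. c v = 0)"
    proof (intro allI impI)
      fix c assume "(\<forall>v\<in>b ` {..<2*n}. c v \<in> \<O>) \<and> (\<Sum>v\<in>b ` {..<2*n}. c v *s v) = 0"
      then have "(\<Sum>i<2*n. c (b i) *s b i) = 0"
        using inj by (simp add: sum.reindex)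
      then show "\<forall>v\<in>b ` {..<2*n}. c v = 0"
        using b[unfolded indep_family_def, THEN spec, of "\<lambda>i. c (b i)"] by blast
    qed
    define b' where "b' = inv_into {..<2*n} b"
    have "\<exists>c'. (\<Sum>i<2*n. c i *s b i) = (\<Sum>v\<in>b ` {..<2*n}. c' v *s v)
        \<and> (\<forall>v\<in>b ` {..<2*n}. c' v \<in> \<O>)" if "\<forall>i<2*n. c i \<in> \<O>" for c
      using that inj by (intro exI[of _ "\<lambda>v. c (b' v)"]) (auto simp: b'_def sum.reindex)
    moreover have "\<exists>c'. (\<Sum>v\<in>b ` {..<2*n}. c v *s v) = (\<Sum>i<2*n. c' i *s b i)
        \<and> (\<forall>i<2*n. c' i \<in> \<O>)" if "\<forall>v\<in>b ` {..<2*n}. c v \<in> \<O>" for c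
      using that inj by (intro exI[of _ "\<lambda>i. c (b i)"]) (auto simp: sum.reindex)
    ultimately show "L = {\<Sum>v\<in>b ` {..<2*n}. c v *s v |c. \<forall>v\<in>b ` {..<2*n}. c v \<in> \<O>}"
      unfolding L ospan_def by blast
  qed simp
qed

lemma submod_lattice: "is_lattice L \<Longrightarrow> submod L"
  by (auto simp: is_lattice_iff submod_ospan)

lemma lattice_absorbs:
  assumes "is_lattice L"
  shows "\<exists>k. \<pi> ^ k *s v \<in> L"
proof -
  obtain b where b: "indep_family b" and L: "L = ospan b"
    using assms is_lattice_iff by blast
  obtain c where v: "v = (\<Sum>i<2*n. c i *s b i)"
    using indep_family_spans[OF b] by blast
  obtain k where k: "\<forall>i\<in>{..<2*n}. \<pi> ^ k * c i \<in> \<O>"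
    using common_denominator by blast
  have "\<pi> ^ k *s v = (\<Sum>i<2*n. (\<pi> ^ k * c i) *s b i)"
    by (simp add: v scale_sum_right)
  then have "\<pi> ^ k *s v \<in> L"
    using k ospanI[of "\<lambda>i. \<pi> ^ k * c i" b] by (simp add: L)
  then show ?thesis ..
qed

lemma ospan_dilate: "dilate a (ospan b) = ospan (\<lambda>i. a *s b i)"
proof -
  have "a *s (\<Sum>i<2*n. c i *s b i) = (\<Sum>i<2*n. c i *s a *s b i)" for c
    by (simp add: scale_sum_right mult.commute)
  then show ?thesis
    unfolding dilate_def ospan_def setcompr_eq_image image_image by simp
qed

lemma is_lattice_dilate:
  assumes "is_lattice L" "a \<noteq> 0"
  shows "is_lattice (dilate a L)"
proof -
  obtain b where b: "indep_family b" and L: "L = ospan b"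
    using assms is_lattice_iff by blast
  have "indep_family (\<lambda>i. a *s b i)"
    unfolding indep_family_def
  proof (intro allI impI)
    fix c i assume c: "(\<Sum>i<2*n. c i *s a *s b i) = 0" and i: "i < 2 * n"
    have "c i * a = 0"
      using indep_familyD[OF b _ i, of "\<lambda>i. c i * a"] c by simp
    then show "c i = 0"
      using assms(2) by simp
  qed
  then show ?thesis
    using L ospan_dilate is_lattice_iff by blast
qed

lemma lattice_not_in_dilate:
  assumes "is_lattice L"
  shows "\<exists>x\<in>L. x \<notin> dilate \<pi> L"
proof -
  obtain b where b: "indep_family b" and L: "L = ospan b"
    using assms is_lattice_iff by blast
  have "b 0 \<notin> dilate \<pi> L"
  proof
    assume "b 0 \<in> dilate \<pi> L"
    then obtain c where c: "\<forall>i<2*n. c i \<in> \<O>" "b 0 = (\<Sum>i<2*n. c i *s \<pi> *s b i)"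
      unfolding L ospan_dilate by (auto simp: ospan_def)
    have "(\<Sum>i<2*n. (c i * \<pi> - (if i = 0 then 1 else 0)) *s b i)
      = (\<Sum>i<2*n. c i *s \<pi> *s b i - (if i = 0 then b i else 0))"
      by (intro sum.cong) (auto simp: scale_left_diff_distrib)
    also have "\<dots> = (\<Sum>i<2*n. c i *s \<pi> *s b i) - b 0"
      using rank_pos by (simp add: sum_subtractf)
    finally have "(\<Sum>i<2*n. (c i * \<pi> - (if i = 0 then 1 else 0)) *s b i) = 0"
      using c(2) by simp
    from indep_familyD[OF b this, of 0] have "c 0 * \<pi> = 1"
      using rank_pos by simp
    moreover have "c 0 * \<pi> \<in> \<pi>\<O>"
      using c(1) rank_pos uniformizer_mult_max_ideal_iff[of "c 0"] by (simp add: mult.commute)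
    ultimately show False
      using one_notin_max_ideal by simp
  qed
  then show ?thesis
    using ospan_generator[of 0 b] rank_pos L by auto
qed

text \<open>
  This is where freeness over \<open>\<O>\<close> comes from: if \<open>x\<close> is not in the lattice, its coordinate of
  least order has an integral inverse and divides all others, so \<open>x\<close> can replace the corresponding
  basis vector.
\<close>

lemma is_lattice_adjoin:
  assumes "is_lattice M"
  shows "is_lattice (adjoin M x)"
proof -
  obtain b where b: "indep_family b" and M: "M = ospan b"
    using assms is_lattice_iff by blast
  obtain a where x: "x = (\<Sum>i<2*n. a i *s b i)"
    using indep_family_spans[OF b] by blast
  show ?thesis
  proof (cases "\<forall>i<2*n. a i \<in> \<O>")
    case True
    then have "x \<in> M"
      unfolding M ospan_def x by blast
    then have "adjoin M x = M"
      using adjoin_subset[of M M x] adjoin_superset[of M x] submod_lattice[OF assms] by blast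
    then show ?thesis
      using assms by simp
  next
    case False
    define I where "I = {i. i < 2 * n \<and> a i \<noteq> 0}"
    have fin: "finite I" and ne: "I \<noteq> {}"
      using False val_ring_0 by (auto simp: I_def)
    obtain i where i: "i \<in> I" and min: "\<And>j. j \<in> I \<Longrightarrow> ord (a i) \<le> ord (a j)"
      using ex_min_if_finite[of "(\<lambda>i. ord (a i)) ` I"] fin ne by (fastforce simp: not_less)
    have i': "i < 2 * n" "a i \<noteq> 0"
      using i by (auto simp: I_def)
    have quot: "a j / a i \<in> \<O>" if "j < 2 * n" for j
      using min[of j] i' that by (cases "a j = 0") (auto simp: I_def val_ring_def ord_divide)
    have "a i \<notin> \<O>"
    proof
      assume "a i \<in> \<O>"
      then have "a j \<in> \<O>" if "j < 2 * n" for j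
        using val_ring_mult[OF quot[OF that], of "a i"] i' by simp
      then show False
        using False by blast
    qed
    then have inv: "1 / a i \<in> \<O>"
      using inverse_nonintegral by (simp add: divide_inverse)
    define b' where "b' = b(i := x)"
    have split: "(\<Sum>j<2*n. f j) = f i + (\<Sum>j\<in>{..<2*n} - {i}. f j)" for f :: "nat \<Rightarrow> 'v"
      using i' by (simp add: sum.remove)
    have sum_b': "(\<Sum>j<2*n. c j *s b' j)
        = (\<Sum>j<2*n. (if j = i then c i * a i else c j + c i * a j) *s b j)" for c
    proof -
      have "(\<Sum>j<2*n. c j *s b' j) = c i *s x + (\<Sum>j\<in>{..<2*n} - {i}. c j *s b j)"
        by (simp add: split b'_def)
      also have "c i *s x = (c i * a i) *s b i + (\<Sum>j\<in>{..<2*n} - {i}. (c i * a j) *s b j)"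
        unfolding x by (simp add: split scale_sum_right scale_right_distrib)
      finally have "(\<Sum>j<2*n. c j *s b' j) = (c i * a i) *s b i
          + (\<Sum>j\<in>{..<2*n} - {i}. (c j + c i * a j) *s b j)"
        by (simp add: sum.distrib scale_left_distrib algebra_simps)
      also have "(\<Sum>j\<in>{..<2*n} - {i}. (c j + c i * a j) *s b j)
          = (\<Sum>j\<in>{..<2*n} - {i}. (if j = i then c i * a i else c j + c i * a j) *s b j)"
        by (intro sum.cong) auto
      finally show ?thesis
        by (simp add: split)
    qed
    have "indep_family b'"
      unfolding indep_family_def
    proof (intro allI impI)
      fix c j assume "(\<Sum>j<2*n. c j *s b' j) = 0" and j: "j < 2 * n"
      then have *: "(if j = i then c i * a i else c j + c i * a j) = 0" if "j < 2 * n" for j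
        using indep_familyD[OF b _ that, of "\<lambda>j. if j = i then c i * a i else c j + c i * a j"]
        by (simp add: sum_b')
      then have "c i = 0"
        using i' by fastforce
      then show "c j = 0"
        using *[OF j] by (cases "j = i") auto
    qed
    moreover have "ospan b' = adjoin M x"
    proof
      have sub: "submod (adjoin M x)"
        using submod_adjoin submod_lattice assms by blast
      show "ospan b' \<subseteq> adjoin M x"
        using ospan_generator[of _ b] adjoin_superset[of M x] adjoin_self[of M x]
          submod_lattice[OF assms]
        by (intro ospan_subset[OF sub]) (auto simp: b'_def M)
      have gen: "b j \<in> ospan b'" if "j < 2 * n" for j
      proof (cases "j = i")
        case False
        then show ?thesis
          using ospan_generator[OF that, of b'] by (simp add: b'_def)
      next
        case True
        define c where "c j = (if j = i then 1 / a i else - (a j / a i))" for j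
        have "(\<Sum>j<2*n. c j *s b' j) = (\<Sum>j<2*n. if j = i then b j else 0)"
          unfolding sum_b' using i' by (intro sum.cong) (auto simp: c_def)
        also have "\<dots> = b j"
          using i' True by simp
        finally have "b j = (\<Sum>j<2*n. c j *s b' j)" ..
        moreover have "\<forall>j<2*n. c j \<in> \<O>"
          using quot inv val_ring_minus by (simp add: c_def)
        ultimately show ?thesis
          unfolding ospan_def by blast
      qed
      have "x \<in> ospan b'"
        using ospan_generator[OF i'(1), of b'] by (simp add: b'_def)
      then show "adjoin M x \<subseteq> ospan b'"
        unfolding M using gen by (intro adjoin_subset ospan_subset submod_ospan) auto
    qed
    ultimately show ?thesis
      using is_lattice_iff by blast
  qed
qed

lemma finite_lattice_representatives:
  assumes "is_lattice L"
  shows "\<exists>X. finite X \<and> X \<subseteq> L \<and> (\<forall>y\<in>L. \<exists>x\<in>X. y - x \<in> dilate (\<pi> ^ k) L)"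
proof (induction k)
  case 0
  then show ?case
    using submod_0[OF submod_lattice[OF assms]]
    by (intro exI[of _ "{0}"]) (auto simp: dilate_1)
next
  case (Suc k)
  then obtain X where X: "finite X" "X \<subseteq> L" "\<forall>y\<in>L. \<exists>x\<in>X. y - x \<in> dilate (\<pi> ^ k) L"
    by blast
  obtain b where b: "indep_family b" and L: "L = ospan b"
    using assms is_lattice_iff by blast
  obtain R where R: "finite R" "R \<subseteq> \<O>" "\<forall>x\<in>\<O>. \<exists>r\<in>R. x - r \<in> \<pi>\<O>"
    using finite_residue_representatives by blast
  define Y where "Y = (\<lambda>c. \<Sum>i<2*n. c i *s b i) ` PiE {..<2*n} (\<lambda>_. R)"
  have Y: "finite Y" "Y \<subseteq> L"
    unfolding Y_def using R by (auto intro!: finite_PiE) (force simp: L ospan_def)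
  have Y': "\<exists>x\<in>Y. y - x \<in> dilate \<pi> L" if y: "y \<in> L" for y
  proof -
    obtain c where c: "\<forall>i<2*n. c i \<in> \<O>" "y = (\<Sum>i<2*n. c i *s b i)"
      using y unfolding L ospan_def by blast
    obtain r where r: "\<forall>x\<in>\<O>. r x \<in> R \<and> x - r x \<in> \<pi>\<O>"
      using R(3) by metis
    define s where "s = restrict (\<lambda>i. r (c i)) {..<2*n}"
    have "s \<in> PiE {..<2*n} (\<lambda>_. R)"
      using r c by (auto simp: s_def)
    moreover have "y - (\<Sum>i<2*n. s i *s b i) \<in> dilate \<pi> L"
    proof -
      have "y - (\<Sum>i<2*n. s i *s b i) = (\<Sum>i<2*n. ((c i - r (c i)) / \<pi>) *s \<pi> *s b i)"
        by (auto simp: c(2) s_def sum_subtractf[symmetric] scale_left_diff_distrib uniformizer_nonzero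
            intro!: sum.cong)
      moreover have "\<forall>i<2*n. (c i - r (c i)) / \<pi> \<in> \<O>"
        using c(1) r by (simp add: max_ideal_iff_divide)
      ultimately show ?thesis
        using ospanI[of "\<lambda>i. (c i - r (c i)) / \<pi>" "\<lambda>i. \<pi> *s b i"] by (simp add: L ospan_dilate)
    qed
    ultimately show ?thesis
      unfolding Y_def by blast
  qed
  define Z where "Z = (\<lambda>(y, x). y + \<pi> *s x) ` (Y \<times> X)"
  have finZ: "finite Z"
    using X Y by (simp add: Z_def)
  have subZ: "Z \<subseteq> L"
    using X Y submod_lattice[OF assms] val_ring_uniformizer
    by (auto simp: Z_def intro!: submod_add submod_scale)
  have "\<exists>x\<in>Z. y - x \<in> dilate (\<pi> ^ Suc k) L" if y: "y \<in> L" for y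
  proof -
    obtain x z where x: "x \<in> Y" "z \<in> L" "y - x = \<pi> *s z"
      using Y'[OF y] by (auto simp: dilate_def)
    obtain x' z' where x': "x' \<in> X" "z' \<in> L" "z - x' = \<pi> ^ k *s z'"
      using X(3) x(2) by (auto simp: dilate_def)
    have "y - (x + \<pi> *s x') = \<pi> *s (z - x')"
      using x(3) by (simp add: algebra_simps)
    also have "\<dots> = \<pi> ^ Suc k *s z'"
      using x'(3) by simp
    finally show ?thesis
      using x x' by (auto simp: Z_def dilate_def intro!: bexI[of _ "(x, x')"])
  qed
  then show ?case
    by (intro exI[of _ Z] conjI ballI finZ subZ)
qed

text \<open>
  Since \<open>L/\<pi>L\<close> is finite, \<open>N\<close> arises from the lattice \<open>\<pi>L\<close> by adjoining finitely many vectors.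
\<close>

lemma is_lattice_between:
  assumes L: "is_lattice L" and N: "submod N" "dilate \<pi> L \<subseteq> N" "N \<subseteq> L"
  shows "is_lattice N"
proof -
  obtain X where X: "finite X" "\<forall>y\<in>L. \<exists>x\<in>X. y - x \<in> dilate \<pi> L"
    using finite_lattice_representatives[OF L, of 1] by auto
  have "\<exists>M. is_lattice M \<and> dilate \<pi> L \<subseteq> M \<and> M \<subseteq> N \<and> Y \<subseteq> M" if "finite Y" "Y \<subseteq> N" for Y
    using that
  proof (induction Y)
    case empty
    then show ?case
      using is_lattice_dilate[OF L uniformizer_nonzero] N by blast
  next
    case (insert x Y)
    then obtain M where M: "is_lattice M" "dilate \<pi> L \<subseteq> M" "M \<subseteq> N" "Y \<subseteq> M"
      by auto
    then show ?case
      using is_lattice_adjoin[OF M(1), of x] adjoin_superset[of M x]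
        adjoin_self[OF submod_lattice[OF M(1)], of x] adjoin_subset[OF N(1) M(3)] insert.prems
      by (intro exI[of _ "adjoin M x"]) auto
  qed
  from this[of "X \<inter> N"] obtain M
    where M: "is_lattice M" "dilate \<pi> L \<subseteq> M" "M \<subseteq> N" "X \<inter> N \<subseteq> M"
    using X by auto
  have "y \<in> M" if y: "y \<in> N" for y
  proof -
    obtain x where x: "x \<in> X" "y - x \<in> dilate \<pi> L"
      using X(2) y N(3) by blast
    have "x \<in> N"
      using submod_diff[OF N(1) y, of "y - x"] x N by auto
    then show ?thesis
      using submod_add[OF submod_lattice[OF M(1)], of x "y - x"] x M by auto
  qed
  then have "M = N"
    using M(3) by blast
  then show ?thesis
    using M(1) by simp
qed

text \<open>
  A submodule containing \<open>\<pi>\<^sup>kL\<close> is a union of some of the finitely many cosets of \<open>\<pi>\<^sup>kL\<close> in \<open>L\<close>.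
\<close>

lemma finite_submods_between:
  assumes L: "is_lattice L"
  shows "finite {N. submod N \<and> dilate (\<pi> ^ k) L \<subseteq> N \<and> N \<subseteq> L}" (is "finite ?S")
proof -
  obtain X where X: "finite X" "\<forall>y\<in>L. \<exists>x\<in>X. y - x \<in> dilate (\<pi> ^ k) L"
    using finite_lattice_representatives[OF L] by blast
  have "M \<subseteq> N" if MN: "M \<in> ?S" "N \<in> ?S" "M \<inter> X = N \<inter> X" for M N
  proof
    fix y assume y: "y \<in> M"
    then obtain x where x: "x \<in> X" "y - x \<in> dilate (\<pi> ^ k) L"
      using X(2) MN(1) by blast
    have "x \<in> M"
      using submod_diff[of M y "y - x"] x MN(1) y by auto
    then show "y \<in> N"
      using submod_add[of N x "y - x"] x MN by auto
  qed
  then have "inj_on (\<lambda>N. N \<inter> X) ?S"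
    by (intro inj_onI subset_antisym) auto
  moreover have "(\<lambda>N. N \<inter> X) ` ?S \<subseteq> Pow X"
    by blast
  ultimately show ?thesis
    using inj_on_finite[of _ ?S "Pow X"] X(1) by blast
qed

end


section \<open>Self-dual lattices and their neighbours\<close>

context pos_symplectic_space
begin

lemma form_add_left: "form (x + y) z = form x z + form y z"
  and form_scale_left: "form (c *s x) z = c * form x z"
  using form_linear_left[of z] unfolding Vector_Spaces.linear_iff by auto

lemma form_add_right: "form z (x + y) = form z x + form z y"
  and form_scale_right: "form z (c *s x) = c * form z x"
  using form_linear_right[of z] unfolding Vector_Spaces.linear_iff by auto

lemma form_minus_left: "form (- x) z = - form x z"
  using form_scale_left[of "- 1" x z] by simp

lemma form_minus_right: "form z (- x) = - form z x"
  using form_scale_right[of z "- 1" x] by simp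

lemma form_diff_left: "form (x - y) z = form x z - form y z"
  using form_add_left[of x "- y" z] by (simp add: form_minus_left)

lemma form_diff_right: "form z (x - y) = form z x - form z y"
  using form_add_right[of z x "- y"] by (simp add: form_minus_right)

lemma form_0_left: "form 0 z = 0"
  using form_scale_left[of 0 0 z] by simp

lemma form_0_right: "form z 0 = 0"
  using form_scale_right[of z 0 0] by simp

lemma form_sum_left: "form (\<Sum>i\<in>I. f i) z = (\<Sum>i\<in>I. form (f i) z)"
  by (induction I rule: infinite_finite_induct) (auto simp: form_0_left form_add_left)

lemma form_sum_right: "form z (\<Sum>i\<in>I. f i) = (\<Sum>i\<in>I. form z (f i))"
  by (induction I rule: infinite_finite_induct) (auto simp: form_0_right form_add_right)

lemma form_swap: "form y x = - form x y"
proof -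
  have "form x y + form y x = form (x + y) (x + y)"
    unfolding form_add_left form_add_right by (simp add: form_alternating)
  then have "form y x + form x y = 0"
    by (simp add: form_alternating add.commute)
  then show ?thesis
    by (rule eq_neg_iff_add_eq_0[THEN iffD2])
qed

lemmas form_linear = form_add_left form_add_right form_scale_left form_scale_right
  form_diff_left form_diff_right

lemma form_swap_val_ring: "form x y \<in> \<O> \<Longrightarrow> form y x \<in> \<O>"
  using form_swap[of y x] val_ring_minus by simp

lemma form_swap_max_ideal: "form x y \<in> \<pi>\<O> \<Longrightarrow> form y x \<in> \<pi>\<O>"
  using form_swap[of y x] max_ideal_minus by simp

lemma form_image_subset_iff: "form_image L \<subseteq> A \<longleftrightarrow> (\<forall>x\<in>L. \<forall>y\<in>L. form x y \<in> A)"
  by (auto simp: form_image_def)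

lemma primitive_is_lattice: "primitive_lattice L \<Longrightarrow> is_lattice L"
  by (simp add: primitive_lattice_def)

lemma primitive_submod: "primitive_lattice L \<Longrightarrow> submod L"
  by (simp add: primitive_is_lattice submod_lattice)

lemma primitive_form: "primitive_lattice L \<Longrightarrow> x \<in> L \<Longrightarrow> y \<in> L \<Longrightarrow> form x y \<in> \<O>"
  by (auto simp: primitive_lattice_def form_image_subset_iff)

lemma primitive_pairing:
  "primitive_lattice L \<Longrightarrow> x \<in> L \<Longrightarrow> x \<notin> dilate \<pi> L \<Longrightarrow> \<exists>y\<in>L. form x y \<notin> \<pi>\<O>"
  by (auto simp: primitive_lattice_def)

lemma primitive_unit_value: "primitive_lattice L \<Longrightarrow> \<exists>x\<in>L. \<exists>y\<in>L. form x y \<notin> \<pi>\<O>"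
  using lattice_not_in_dilate primitive_pairing primitive_is_lattice by blast

lemma mem_dilate_uniformizer: "v \<in> dilate \<pi> L \<longleftrightarrow> (\<exists>x\<in>L. v = \<pi> *s x)"
  by (auto simp: dilate_def)

lemma uniformizer_scale_mem_dilate: "\<pi> *s x \<in> dilate \<pi> L \<longleftrightarrow> x \<in> L"
  by (auto simp: mem_dilate_uniformizer uniformizer_nonzero)

lemma dilate_uniformizer_subset: "submod L \<Longrightarrow> dilate \<pi> L \<subseteq> L"
  by (intro dilate_subset val_ring_uniformizer)

text \<open>
  A primitive lattice is its own dual: multiply \<open>v\<close> by the least power of \<open>\<pi>\<close> that brings it into
  the lattice; if that power were positive, the multiple would be in the radical modulo \<open>\<pi>\<close>.
\<close>

lemma primitive_self_dual:
  assumes L: "primitive_lattice L" and v: "\<And>y. y \<in> L \<Longrightarrow> form v y \<in> \<O>"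
  shows "v \<in> L"
proof -
  define k where "k = (LEAST k. \<pi> ^ k *s v \<in> L)"
  have k: "\<pi> ^ k *s v \<in> L"
    unfolding k_def using lattice_absorbs[OF primitive_is_lattice[OF L]] by (rule LeastI_ex)
  have "k = 0"
  proof (cases k)
    case (Suc l)
    have "form (\<pi> ^ k *s v) y \<in> \<pi>\<O>" if "y \<in> L" for y
      using val_ring_mult[OF val_ring_uniformizer_power[of l] v[OF that]]
      by (simp add: Suc form_scale_left mult.assoc uniformizer_mult_max_ideal_iff)
    then have "\<pi> ^ k *s v \<in> dilate \<pi> L"
      using primitive_pairing[OF L k] by blast
    then have "\<pi> ^ l *s v \<in> L"
      using uniformizer_scale_mem_dilate[of "\<pi> ^ l *s v" L] by (simp add: Suc)
    then have "k \<le> l"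
      unfolding k_def by (rule Least_le)
    then show ?thesis
      using Suc by simp
  qed
  then show ?thesis
    using k by simp
qed

lemma primitive_subset_eq:
  assumes "primitive_lattice L" "primitive_lattice L'" "L \<subseteq> L'"
  shows "L = L'"
  using assms primitive_self_dual[of L] primitive_form[of L'] by blast

lemma primitive_dilate_eq:
  assumes L: "primitive_lattice L" and a: "a \<noteq> 0" and aL: "primitive_lattice (dilate a L)"
  shows "dilate a L = L"
proof -
  obtain x y where xy: "x \<in> L" "y \<in> L" "form x y \<notin> \<pi>\<O>"
    using primitive_unit_value[OF L] by blast
  then have u: "form x y \<noteq> 0" "ord (form x y) = 0"
    using primitive_form[OF L] unit_iff[of "form x y"] by auto
  have "form (a *s x) (a *s y) \<in> \<O>"
    using xy by (intro primitive_form[OF aL]) (auto simp: dilate_def)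
  then have "a \<in> \<O>"
    using a u by (simp add: form_linear val_ring_def ord_mult)
  then show ?thesis
    using primitive_subset_eq[OF aL L] dilate_subset[OF primitive_submod[OF L]] by blast
qed

text \<open>
  Given \<open>\<pi>x \<in> L\<close>, the inclusion in \<open>L + \<O>x\<close> says that \<open>(L + L')/L\<close> has length one.
\<close>

definition neighbour :: "'v set \<Rightarrow> 'v set \<Rightarrow> bool" where
  "neighbour L L' \<longleftrightarrow> primitive_lattice L'
     \<and> (\<exists>x\<in>L'. x \<notin> L \<and> \<pi> *s x \<in> L \<and> L' \<subseteq> adjoin L x)"

lemma neighbour_primitive: "neighbour L L' \<Longrightarrow> primitive_lattice L'"
  by (simp add: neighbour_def)

lemma neighbour_dilate_subset:
  assumes L: "submod L" and nb: "neighbour L L'"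
  shows "dilate \<pi> L' \<subseteq> L"
proof -
  obtain x where x: "\<pi> *s x \<in> L" "L' \<subseteq> adjoin L x"
    using nb by (auto simp: neighbour_def)
  have "\<pi> *s z \<in> L" if z: "z \<in> L'" for z
  proof -
    obtain m c where "m \<in> L" "c \<in> \<O>" "z = m + c *s x"
      using x z by (auto simp: adjoin_def)
    moreover have "\<pi> *s (m + c *s x) = \<pi> *s m + c *s \<pi> *s x"
      by (simp add: scale_right_distrib mult.commute)
    ultimately show ?thesis
      using x(1) L by (simp add: submod_add submod_scale val_ring_uniformizer del: scale_scale)
  qed
  then show ?thesis
    by (auto simp: mem_dilate_uniformizer)
qed

lemma adjoin_exchange:
  assumes L: "submod L" and x: "\<pi> *s x \<in> L" and z: "z \<in> adjoin L x" "z \<notin> L"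
  shows "adjoin L x \<subseteq> adjoin L z"
proof -
  obtain m c where mc: "m \<in> L" "c \<in> \<O>" "z = m + c *s x"
    using z by (auto simp: adjoin_def)
  have "c \<notin> \<pi>\<O>"
  proof
    assume "c \<in> \<pi>\<O>"
    then have "(c / \<pi>) *s \<pi> *s x \<in> L"
      using x L submod_scale by (simp add: max_ideal_iff_divide del: scale_scale)
    then show False
      using z(2) mc submod_add[OF L] by (simp add: uniformizer_nonzero)
  qed
  then have c: "inverse c \<in> \<O>" "c \<noteq> 0"
    using inverse_unit mc(2) max_ideal_0 by auto
  have "x = inverse c *s (z - m)"
    using c(2) by (simp add: mc(3))
  moreover have "z - m \<in> adjoin L z"
    using adjoin_self[OF L] adjoin_superset[of L z] mc(1) submod_diff[OF submod_adjoin[OF L]]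
    by blast
  ultimately have "x \<in> adjoin L z"
    using submod_scale[OF submod_adjoin[OF L] c(1)] by simp
  then show ?thesis
    using adjoin_subset[OF submod_adjoin[OF L] adjoin_superset] by blast
qed

lemma neighbour_subset_adjoin:
  assumes L: "submod L" and nb: "neighbour L L'" and z: "z \<in> L'" "z \<notin> L"
  shows "L' \<subseteq> adjoin L z"
proof -
  obtain x where "\<pi> *s x \<in> L" "L' \<subseteq> adjoin L x"
    using nb by (auto simp: neighbour_def)
  then show ?thesis
    using adjoin_exchange[OF L _ _ z(2), of x] z(1) by blast
qed

text \<open>
  As \<open>L' \<subseteq> L + \<O>x\<close>, a vector of \<open>L\<close> that pairs integrally with \<open>x\<close> does so with all of \<open>L'\<close>, which is
  its own dual. Hence \<open>L'\<close> is determined by \<open>L\<close> and \<open>x\<close>.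
\<close>

lemma neighbour_mem:
  assumes L: "primitive_lattice L" and nb: "neighbour L L'"
    and x: "x \<in> L'" "x \<notin> L" and y: "y \<in> L" "form x y \<in> \<O>"
  shows "y \<in> L'"
proof (rule primitive_self_dual[OF neighbour_primitive[OF nb]])
  fix z assume "z \<in> L'"
  then obtain m c where "m \<in> L" "c \<in> \<O>" "z = m + c *s x"
    using neighbour_subset_adjoin[OF primitive_submod[OF L] nb x] by (auto simp: adjoin_def)
  then show "form y z \<in> \<O>"
    using primitive_form[OF L y(1)] form_swap_val_ring[OF y(2)]
    by (simp add: form_linear val_ring_add val_ring_mult)
qed

lemma neighbour_not_subset: "neighbour L L' \<Longrightarrow> \<not> L' \<subseteq> L"
  by (auto simp: neighbour_def)

text \<open>
  If \<open>x \<in> L'\<close> generates the extension over \<open>L\<close>, then a vector of \<open>L\<close> whose pairing with \<open>x\<close> has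
  order \<open>-1\<close> generates the extension over \<open>L'\<close>.
\<close>

lemma neighbour_sym:
  assumes L: "primitive_lattice L" and nb: "neighbour L L'"
  shows "neighbour L' L"
proof -
  obtain x where x: "x \<in> L'" "x \<notin> L" "\<pi> *s x \<in> L"
    using nb by (auto simp: neighbour_def)
  have "\<pi> *s x \<notin> dilate \<pi> L"
    using x(2) by (simp add: uniformizer_scale_mem_dilate)
  then obtain y where y: "y \<in> L" "form (\<pi> *s x) y \<notin> \<pi>\<O>"
    using primitive_pairing[OF L x(3)] by blast
  have y': "form x y \<notin> \<O>"
    using y(2) by (simp add: form_scale_left uniformizer_mult_max_ideal_iff)
  then have "form x y \<noteq> 0"
    using val_ring_0 by auto
  have inv: "inverse (form (\<pi> *s x) y) \<in> \<O>"
    using inverse_unit primitive_form[OF L x(3) y(1)] y(2) by blast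
  have "y \<notin> L'"
    using primitive_form[OF neighbour_primitive[OF nb] x(1)] y' by blast
  moreover have "\<pi> *s y \<in> L'"
    using primitive_form[OF L x(3) y(1)] y(1) submod_scale[OF primitive_submod[OF L]]
      val_ring_uniformizer
    by (intro neighbour_mem[OF L nb x(1,2)]) (auto simp: form_linear)
  moreover have "z \<in> adjoin L' y" if z: "z \<in> L" for z
  proof -
    define c where "c = form x z / form x y"
    have "c = form (\<pi> *s x) z * inverse (form (\<pi> *s x) y)"
      by (simp add: c_def form_scale_left divide_inverse uniformizer_nonzero)
    then have c: "c \<in> \<O>"
      using inv primitive_form[OF L x(3) z] val_ring_mult by simp
    have "z - c *s y \<in> L'"
    proof (rule neighbour_mem[OF L nb x(1,2)])
      show "z - c *s y \<in> L"
        using submod_diff submod_scale primitive_submod[OF L] c z y(1) by blast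
      have "form x (z - c *s y) = 0"
        using \<open>form x y \<noteq> 0\<close> by (simp add: form_linear c_def)
      then show "form x (z - c *s y) \<in> \<O>"
        using val_ring_0 by simp
    qed
    then show ?thesis
      using c unfolding adjoin_def by (intro CollectI exI[of _ "z - c *s y"] exI[of _ c]) simp
  qed
  ultimately show ?thesis
    using L y(1) by (auto simp: neighbour_def)
qed

lemma finite_neighbours:
  assumes L: "primitive_lattice L"
  shows "finite {L'. neighbour L L'}"
proof -
  have "submod L' \<and> dilate (\<pi> ^ 2) (dilate (inverse \<pi>) L) \<subseteq> L' \<and> L' \<subseteq> dilate (inverse \<pi>) L"
    if nb: "neighbour L L'" for L'
  proof -
    have "dilate \<pi> L \<subseteq> L'"
      using neighbour_dilate_subset[OF _ neighbour_sym[OF L nb]]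
        primitive_submod[OF neighbour_primitive[OF nb]] by blast
    moreover have "L' \<subseteq> dilate (inverse \<pi>) L"
      using neighbour_dilate_subset[OF primitive_submod[OF L] nb]
      by (simp add: dilate_subset_iff uniformizer_nonzero)
    ultimately show ?thesis
      using primitive_submod[OF neighbour_primitive[OF nb]]
      by (simp add: dilate_dilate power2_eq_square uniformizer_nonzero mult.assoc)
  qed
  then have "{L'. neighbour L L'} \<subseteq> {N. submod N \<and> dilate (\<pi> ^ 2) (dilate (inverse \<pi>) L) \<subseteq> N
      \<and> N \<subseteq> dilate (inverse \<pi>) L}"
    by blast
  moreover have "is_lattice (dilate (inverse \<pi>) L)"
    using is_lattice_dilate primitive_is_lattice L uniformizer_nonzero by simp
  ultimately show ?thesis
    using finite_submods_between finite_subset by blast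
qed


section \<open>Simplices as flags of lattices\<close>

text \<open>
  Exactly one lattice of a vertex is admissible (\<open>admissible_unique\<close>), so that vertices can be replaced
  by lattices. In the class of a primitive lattice \<open>L\<close> it is \<open>\<pi>L\<close>, not \<open>L\<close> itself.
\<close>

definition admissible :: "'v set \<Rightarrow> bool" where
  "admissible N \<longleftrightarrow> is_lattice N \<and> form_image N \<subseteq> \<pi>\<O>
     \<and> (\<exists>L0. primitive_lattice L0 \<and> dilate \<pi> L0 \<subseteq> N \<and> N \<subseteq> L0)"

definition compatible :: "'v set \<Rightarrow> 'v set \<Rightarrow> bool" where
  "compatible N N' \<longleftrightarrow> (\<exists>L0. primitive_lattice L0
     \<and> (dilate \<pi> L0 \<subseteq> N \<and> N \<subseteq> N' \<and> N' \<subseteq> L0 \<or> dilate \<pi> L0 \<subseteq> N' \<and> N' \<subseteq> N \<and> N \<subseteq> L0))"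

definition flag :: "'v set set \<Rightarrow> bool" where
  "flag A \<longleftrightarrow> finite A \<and> (\<forall>N\<in>A. admissible N) \<and> (\<forall>N\<in>A. \<forall>N'\<in>A. compatible N N')"

definition maximal_flag :: "'v set set \<Rightarrow> bool" where
  "maximal_flag A \<longleftrightarrow> flag A \<and> (\<forall>B. flag B \<and> A \<subseteq> B \<longrightarrow> B = A)"

text \<open>
  If \<open>aN\<close> contained \<open>\<pi>L\<close> with \<open>a\<close> divisible by \<open>\<pi>\<close>, then \<open>N\<close> would contain the primitive lattice \<open>L\<close>, on
  which the form has unit values.
\<close>

lemma admissible_not_dilate:
  assumes N: "admissible N" and aN: "admissible (dilate a N)" and a: "a \<noteq> 0"
  shows "\<not> 1 \<le> ord a"
proof
  assume "1 \<le> ord a"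
  then have "a / \<pi> \<in> \<O>"
    using a by (simp add: val_ring_def ord_divide uniformizer_nonzero ord_uniformizer)
  then have "dilate (a / \<pi>) N \<subseteq> N"
    using N submod_lattice by (intro dilate_subset) (auto simp: admissible_def)
  then have "dilate a N \<subseteq> dilate \<pi> N"
    using dilate_mono_iff[of \<pi> "dilate (a / \<pi>) N" N]
    by (simp add: dilate_dilate uniformizer_nonzero)
  moreover obtain L where L: "primitive_lattice L" "dilate \<pi> L \<subseteq> dilate a N"
    using aN by (auto simp: admissible_def)
  ultimately have "L \<subseteq> N"
    using dilate_mono_iff[of \<pi> L N] uniformizer_nonzero by blast
  then show False
    using primitive_unit_value[OF L(1)] N by (force simp: admissible_def form_image_subset_iff)
qed

lemma dilate_unit:
  assumes "submod N" "a \<noteq> 0" "ord a = 0"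
  shows "dilate a N = N"
proof
  show "dilate a N \<subseteq> N"
    using assms by (intro dilate_subset) (auto simp: val_ring_def)
  have "dilate (inverse a) N \<subseteq> N"
    using assms by (intro dilate_subset) (auto simp: val_ring_def ord_inverse)
  then show "N \<subseteq> dilate a N"
    using assms(2) dilate_subset_iff[of "inverse a" N N] by simp
qed

lemma admissible_unique:
  assumes N: "admissible N" and aN: "admissible (dilate a N)" and a: "a \<noteq> 0"
  shows "dilate a N = N"
proof -
  have "\<not> 1 \<le> ord (inverse a)"
    using admissible_not_dilate[OF aN, of "inverse a"] N a by (simp add: dilate_dilate dilate_1)
  then have "ord a = 0"
    using admissible_not_dilate[OF N aN a] a by (simp add: ord_inverse)
  then show ?thesis
    using dilate_unit a N submod_lattice by (simp add: admissible_def)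
qed

lemma mem_homothety_class: "M \<in> homothety_class L \<longleftrightarrow> (\<exists>a. a \<noteq> 0 \<and> M = dilate a L)"
  by (auto simp: homothety_class_def)

lemma homothety_class_dilate: "a \<noteq> 0 \<Longrightarrow> homothety_class (dilate a L) = homothety_class L"
  by (force simp: mem_homothety_class dilate_dilate
      intro: exI[of _ "_ * a"] exI[of _ "_ / a"])

lemma homothety_class_eqD: "homothety_class L = homothety_class L' \<Longrightarrow> \<exists>a. a \<noteq> 0 \<and> L' = dilate a L"
  using mem_homothety_class[of L' L] mem_homothety_class[of L' L']
  by (metis dilate_1 zero_neq_one)

lemma inj_on_homothety_class_admissible: "inj_on homothety_class {N. admissible N}"
  by (rule inj_onI) (metis admissible_unique homothety_class_eqD mem_Collect_eq)

lemma inj_on_homothety_class_primitive: "inj_on homothety_class {L. primitive_lattice L}"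
  by (rule inj_onI) (metis primitive_dilate_eq homothety_class_eqD mem_Collect_eq)

lemma is_vertex_iff: "is_vertex t \<longleftrightarrow> (\<exists>N. admissible N \<and> t = homothety_class N)"
  by (auto simp: is_vertex_def admissible_def)

lemma incident_iff:
  assumes N: "admissible N" and N': "admissible N'"
  shows "incident (homothety_class N) (homothety_class N') \<longleftrightarrow> compatible N N'"
proof
  assume "incident (homothety_class N) (homothety_class N')"
  then obtain L L' L0 where LL: "L \<in> homothety_class N" "L' \<in> homothety_class N'"
    and L0: "primitive_lattice L0" "form_image L \<subseteq> \<pi>\<O>" "form_image L' \<subseteq> \<pi>\<O>"
      "dilate \<pi> L0 \<subseteq> L \<and> L \<subseteq> L' \<and> L' \<subseteq> L0 \<or> dilate \<pi> L0 \<subseteq> L' \<and> L' \<subseteq> L \<and> L \<subseteq> L0"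
    unfolding incident_def by blast
  have eq: "M = P" if P: "admissible P" and M: "M \<in> homothety_class P" "form_image M \<subseteq> \<pi>\<O>"
    "dilate \<pi> L0 \<subseteq> M" "M \<subseteq> L0" for M P
  proof -
    obtain a where a: "a \<noteq> 0" "M = dilate a P"
      using M(1) mem_homothety_class by blast
    then have "admissible M"
      using P M L0(1) is_lattice_dilate by (auto simp: admissible_def)
    then show ?thesis
      using admissible_unique[OF P] a by simp
  qed
  have "L = N" "L' = N'"
    using eq[OF N LL(1) L0(2)] eq[OF N' LL(2) L0(3)] L0(4) by auto
  then show "compatible N N'"
    using L0 unfolding compatible_def by blast
next
  assume "compatible N N'"
  moreover have "L \<in> homothety_class L" for L
    using dilate_1 mem_homothety_class zero_neq_one by metis
  ultimately show "incident (homothety_class N) (homothety_class N')"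
    using N N' unfolding incident_def compatible_def admissible_def by blast
qed

lemma simplex_iff:
  "simplex C \<longleftrightarrow> (\<exists>A. flag A \<and> C = homothety_class ` A)"
proof
  assume C: "simplex C"
  define A where "A = {N. admissible N \<and> homothety_class N \<in> C}"
  have CA: "C = homothety_class ` A"
    using C by (auto simp: A_def simplex_def is_vertex_iff)
  moreover have "finite A"
  proof (rule finite_imageD)
    show "finite (homothety_class ` A)"
      using C CA by (simp add: simplex_def)
    show "inj_on homothety_class A"
      by (rule inj_on_subset[OF inj_on_homothety_class_admissible]) (auto simp: A_def)
  qed
  moreover have "compatible N N'" if "N \<in> A" "N' \<in> A" for N N'
    using that C incident_iff[of N N'] by (auto simp: A_def simplex_def)
  ultimately show "\<exists>A. flag A \<and> C = homothety_class ` A"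
    by (intro exI[of _ A]) (auto simp: flag_def A_def)
next
  assume "\<exists>A. flag A \<and> C = homothety_class ` A"
  then show "simplex C"
    by (auto simp: flag_def simplex_def is_vertex_iff incident_iff)
qed

lemma homothety_image_subset_iff:
  assumes "\<forall>N\<in>A. admissible N" "\<forall>N\<in>B. admissible N"
  shows "homothety_class ` A \<subseteq> homothety_class ` B \<longleftrightarrow> A \<subseteq> B"
proof
  assume sub: "homothety_class ` A \<subseteq> homothety_class ` B"
  show "A \<subseteq> B"
  proof
    fix N assume N: "N \<in> A"
    then obtain M where "M \<in> B" "homothety_class N = homothety_class M"
      using sub by blast
    then show "N \<in> B"
      using inj_onD[OF inj_on_homothety_class_admissible, of N M] N assms by auto
  qed
qed blast

lemma chamber_iff:
  "chamber C \<longleftrightarrow> (\<exists>A. maximal_flag A \<and> C = homothety_class ` A)"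
proof
  assume C: "chamber C"
  then obtain A where A: "flag A" "C = homothety_class ` A"
    by (auto simp: chamber_def simplex_iff)
  have "B = A" if B: "flag B" "A \<subseteq> B" for B
  proof -
    have "simplex (homothety_class ` B)" "homothety_class ` A \<subseteq> homothety_class ` B"
      using B by (auto simp: simplex_iff)
    then have "homothety_class ` B = homothety_class ` A"
      using C A(2) by (simp add: chamber_def)
    then show ?thesis
      using homothety_image_subset_iff[of B A] A B by (auto simp: flag_def)
  qed
  then have "maximal_flag A"
    using A(1) by (simp add: maximal_flag_def)
  then show "\<exists>A. maximal_flag A \<and> C = homothety_class ` A"
    using A(2) by blast
next
  assume "\<exists>A. maximal_flag A \<and> C = homothety_class ` A"
  then obtain A where A: "maximal_flag A" "C = homothety_class ` A" by blast
  have "D = C" if D: "simplex D" "C \<subseteq> D" for D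
  proof -
    obtain B where B: "flag B" "D = homothety_class ` B"
      using D(1) simplex_iff by blast
    then have "A \<subseteq> B"
      using D(2) A homothety_image_subset_iff[of A B] by (auto simp: flag_def maximal_flag_def)
    then show ?thesis
      using A B by (auto simp: maximal_flag_def)
  qed
  moreover have "simplex C"
    using A by (auto simp: simplex_iff maximal_flag_def)
  ultimately show "chamber C"
    by (simp add: chamber_def)
qed

definition flag_neighbours :: "'v set \<Rightarrow> 'v set \<Rightarrow> bool" where
  "flag_neighbours N N' \<longleftrightarrow> (\<exists>F. N \<notin> F \<and> N' \<notin> F \<and> N \<noteq> N'
     \<and> maximal_flag (insert N F) \<and> maximal_flag (insert N' F))"

text \<open>
  The chambers \<open>C\<close>, \<open>C'\<close> have one vertex more than their common face \<open>F\<close>, so the two vertices outside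
  the intersection are the ones missing from \<open>F\<close>.
\<close>

lemma close_vertices_iff:
  assumes N: "admissible N"
  shows "close_vertices (homothety_class N) t'
    \<longleftrightarrow> (\<exists>N'. t' = homothety_class N' \<and> flag_neighbours N N')"
proof
  assume "close_vertices (homothety_class N) t'"
  then obtain C C' F where C: "chamber C" "chamber C'" and F: "F \<subseteq> C" "F \<subseteq> C'"
      "card C = card F + 1" "card C' = card F + 1"
    and t: "homothety_class N \<in> C" "t' \<in> C'" "homothety_class N \<notin> C \<inter> C'" "t' \<notin> C \<inter> C'"
    unfolding close_vertices_def adjacent_def by blast
  have fin: "finite C" "finite C'"
    using C by (auto simp: chamber_def simplex_def)
  have "insert (homothety_class N) F = C"
    using F t fin by (intro card_subset_eq) (auto simp: card_insert_if finite_subset)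
  moreover have "insert t' F = C'"
    using F t fin by (intro card_subset_eq) (auto simp: card_insert_if finite_subset)
  moreover obtain A where A: "maximal_flag A" "C = homothety_class ` A"
    using C chamber_iff by blast
  moreover obtain A' where A': "maximal_flag A'" "C' = homothety_class ` A'"
    using C chamber_iff by blast
  moreover obtain N' where N': "N' \<in> A'" "t' = homothety_class N'"
    using t A' by blast
  moreover have adm: "\<forall>M\<in>A. admissible M" "\<forall>M\<in>A'. admissible M"
    using A A' by (auto simp: maximal_flag_def flag_def)
  ultimately have *: "insert (homothety_class N) F = homothety_class ` A"
    "insert (homothety_class N') F = homothety_class ` A'" by simp_all
  define G where "G = {M \<in> A. homothety_class M \<in> F}"
  have inj: "M = M'" if "homothety_class M = homothety_class M'" "admissible M" "admissible M'" for M M'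
    using that inj_on_homothety_class_admissible by (auto simp: inj_on_def)
  have NA: "N \<in> A"
    using t(1) A(2) inj[of N] N adm by auto
  have nF: "homothety_class N \<notin> F" "homothety_class N' \<notin> F" "homothety_class N \<noteq> homothety_class N'"
    using t F N' by auto
  have FG: "F = homothety_class ` G"
    using F(1) A(2) by (auto simp: G_def)
  have "A = insert N G"
  proof -
    have "M \<in> insert N G" if M: "M \<in> A" for M
    proof -
      have "homothety_class M \<in> insert (homothety_class N) F"
        using M *(1) by blast
      then show ?thesis
        using inj[of M N] M N adm(1) by (auto simp: G_def)
    qed
    then show ?thesis
      using NA by (auto simp: G_def)
  qed
  moreover have "A' = insert N' G"
  proof -
    have "homothety_class ` A' = homothety_class ` insert N' G"
      using * FG by simp
    moreover have "\<forall>M\<in>insert N' G. admissible M"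
      using adm N' by (auto simp: G_def)
    ultimately show ?thesis
      using homothety_image_subset_iff[of A' "insert N' G"]
        homothety_image_subset_iff[of "insert N' G" A'] adm by auto
  qed
  moreover have "N \<notin> G" "N' \<notin> G" "N \<noteq> N'"
    using nF by (auto simp: G_def)
  ultimately show "\<exists>N'. t' = homothety_class N' \<and> flag_neighbours N N'"
    unfolding flag_neighbours_def using A A' N' by blast
next
  assume "\<exists>N'. t' = homothety_class N' \<and> flag_neighbours N N'"
  then obtain N' F where t': "t' = homothety_class N'" and F: "N \<notin> F" "N' \<notin> F" "N \<noteq> N'"
      "maximal_flag (insert N F)" "maximal_flag (insert N' F)"
    by (auto simp: flag_neighbours_def)
  have adm: "\<forall>M\<in>insert N (insert N' F). admissible M" and fin: "finite F"
    using F by (auto simp: maximal_flag_def flag_def)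
  have inj: "inj_on homothety_class (insert N (insert N' F))"
    using adm by (intro inj_on_subset[OF inj_on_homothety_class_admissible]) auto
  have nin: "homothety_class N \<notin> homothety_class ` insert N' F"
    "homothety_class N' \<notin> homothety_class ` insert N F"
    using inj F(1-3) by (auto simp: inj_on_def)
  have "adjacent (homothety_class ` insert N F) (homothety_class ` insert N' F)"
    unfolding adjacent_def
  proof (intro conjI exI)
    show "chamber (homothety_class ` insert N F)" "chamber (homothety_class ` insert N' F)"
      using F chamber_iff by blast+
    show "card (homothety_class ` insert N F) = card (homothety_class ` F) + 1"
      "card (homothety_class ` insert N' F) = card (homothety_class ` F) + 1"
      using nin fin by auto
  qed auto
  then show "close_vertices (homothety_class N) t'"
    unfolding close_vertices_def is_vertex_iff t' using adm nin by blast
qed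

lemma flag_subset: "flag A \<Longrightarrow> B \<subseteq> A \<Longrightarrow> flag B"
  unfolding flag_def using finite_subset by blast

lemma compatible_sym: "compatible N N' \<Longrightarrow> compatible N' N"
  unfolding compatible_def by blast

lemma flag_chain: "flag A \<Longrightarrow> N \<in> A \<Longrightarrow> N' \<in> A \<Longrightarrow> N \<subseteq> N' \<or> N' \<subseteq> N"
  unfolding flag_def compatible_def by blast

lemma flag_least:
  assumes "flag A" "A \<noteq> {}"
  shows "\<exists>m\<in>A. \<forall>N\<in>A. m \<subseteq> N"
proof -
  obtain m where "m \<in> A" "\<forall>N\<in>A. N \<subseteq> m \<longrightarrow> m = N"
    using finite_has_minimal[of A] assms by (auto simp: flag_def)
  then show ?thesis
    using flag_chain[OF assms(1)] by blast
qed

lemma flag_greatest: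
  assumes "flag A" "A \<noteq> {}"
  shows "\<exists>m\<in>A. \<forall>N\<in>A. N \<subseteq> m"
proof -
  obtain m where "m \<in> A" "\<forall>N\<in>A. m \<subseteq> N \<longrightarrow> m = N"
    using finite_has_maximal[of A] assms by (auto simp: flag_def)
  then show ?thesis
    using flag_chain[OF assms(1)] by blast
qed

text \<open>
  One \<open>L\<^sub>0\<close> serves the whole flag, namely one for its least and its greatest member.
\<close>

lemma flag_bounds:
  assumes A: "flag A" "A \<noteq> {}"
  shows "\<exists>L0. primitive_lattice L0 \<and> (\<forall>N\<in>A. dilate \<pi> L0 \<subseteq> N \<and> N \<subseteq> L0)"
proof -
  obtain m where m: "m \<in> A" "\<forall>N\<in>A. m \<subseteq> N"
    using flag_least[OF A] by blast
  obtain M where M: "M \<in> A" "\<forall>N\<in>A. N \<subseteq> M"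
    using flag_greatest[OF A] by blast
  have "compatible m M"
    using A m M by (simp add: flag_def)
  then obtain L0 where "primitive_lattice L0" "dilate \<pi> L0 \<subseteq> m" "M \<subseteq> L0"
    using m M unfolding compatible_def by blast
  then show ?thesis
    using m M by blast
qed

lemma flag_insert:
  assumes A: "flag A" and L0: "primitive_lattice L0" and b: "\<And>M. M \<in> A \<Longrightarrow> dilate \<pi> L0 \<subseteq> M \<and> M \<subseteq> L0"
    and N: "submod N" "dilate \<pi> L0 \<subseteq> N" "N \<subseteq> L0" "form_image N \<subseteq> \<pi>\<O>"
    and c: "\<And>M. M \<in> A \<Longrightarrow> M \<subseteq> N \<or> N \<subseteq> M"
  shows "flag (insert N A)"
proof -
  have "is_lattice N"
    using is_lattice_between[OF primitive_is_lattice[OF L0]] N by blast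
  then have "admissible N"
    using L0 N by (auto simp: admissible_def)
  moreover have "compatible N N"
    using L0 N by (auto simp: compatible_def)
  moreover have "compatible N M" if "M \<in> A" for M
    unfolding compatible_def using L0 N b[OF that] c[OF that] by blast
  ultimately show ?thesis
    using A compatible_sym by (auto simp: flag_def)
qed

lemma maximal_flag_mem:
  assumes A: "maximal_flag A" and L0: "primitive_lattice L0"
    and b: "\<And>M. M \<in> A \<Longrightarrow> dilate \<pi> L0 \<subseteq> M \<and> M \<subseteq> L0"
    and N: "submod N" "dilate \<pi> L0 \<subseteq> N" "N \<subseteq> L0" "form_image N \<subseteq> \<pi>\<O>"
    and c: "\<And>M. M \<in> A \<Longrightarrow> M \<subseteq> N \<or> N \<subseteq> M"
  shows "N \<in> A"
proof -
  have "flag (insert N A)"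
    using A flag_insert[OF _ L0 b N c] by (simp add: maximal_flag_def)
  then have "insert N A = A"
    using A unfolding maximal_flag_def by blast
  then show ?thesis
    by blast
qed

lemma dilate_form_image:
  assumes "primitive_lattice L"
  shows "form_image (dilate \<pi> L) \<subseteq> \<pi>\<O>"
  using primitive_form[OF assms] val_ring_mult[OF val_ring_uniformizer]
  by (auto simp: form_image_subset_iff mem_dilate_uniformizer form_linear
      uniformizer_mult_max_ideal_iff)

lemma admissible_dilate: "primitive_lattice L \<Longrightarrow> admissible (dilate \<pi> L)"
  using is_lattice_dilate uniformizer_nonzero dilate_form_image dilate_uniformizer_subset
    primitive_submod primitive_is_lattice unfolding admissible_def by blast

lemma flag_primitive_bounds:
  assumes A: "flag A" and L: "primitive_lattice L" "dilate \<pi> L \<in> A" and N: "N \<in> A"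
  shows "dilate \<pi> L \<subseteq> N \<and> N \<subseteq> L"
proof -
  obtain L1 where L1: "primitive_lattice L1" "\<forall>N\<in>A. dilate \<pi> L1 \<subseteq> N \<and> N \<subseteq> L1"
    using flag_bounds[OF A] N by blast
  have "L1 \<subseteq> L"
    using L1(2) L(2) dilate_mono_iff[OF uniformizer_nonzero, of L1 L] by blast
  then have "L1 = L"
    using primitive_subset_eq[OF L1(1) L(1)] by blast
  then show ?thesis
    using L1 N by blast
qed

lemma flag_primitive_unique:
  assumes "flag A" "primitive_lattice L" "dilate \<pi> L \<in> A" "primitive_lattice L'" "dilate \<pi> L' \<in> A"
  shows "L = L'"
proof (rule primitive_subset_eq[OF assms(2,4)])
  show "L \<subseteq> L'"
    using flag_primitive_bounds[OF assms(1-3,5)] dilate_mono_iff[OF uniformizer_nonzero, of L L'] by blast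
qed

lemma maximal_flag_has_primitive:
  assumes A: "maximal_flag A" "A \<noteq> {}"
  shows "\<exists>L. primitive_lattice L \<and> dilate \<pi> L \<in> A"
proof -
  obtain L where L: "primitive_lattice L" "\<forall>N\<in>A. dilate \<pi> L \<subseteq> N \<and> N \<subseteq> L"
    using flag_bounds[of A] A unfolding maximal_flag_def by blast
  then have "dilate \<pi> L \<in> A"
    using dilate_form_image dilate_uniformizer_subset primitive_submod submod_dilate
    by (intro maximal_flag_mem[OF A(1) L(1)]) (use L in auto)
  then show ?thesis
    using L by blast
qed

lemma flag_extends:
  assumes A: "flag A" and L: "primitive_lattice L" "dilate \<pi> L \<in> A"
  shows "\<exists>B. A \<subseteq> B \<and> maximal_flag B"
proof -
  define S where "S = {N. submod N \<and> dilate \<pi> L \<subseteq> N \<and> N \<subseteq> L}"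
  have "finite S"
    using finite_submods_between[OF primitive_is_lattice[OF L(1)], of 1] by (simp add: S_def)
  moreover have "{B. flag B \<and> A \<subseteq> B} \<subseteq> Pow S"
  proof clarify
    fix B N assume B: "flag B" "A \<subseteq> B" "N \<in> B"
    then have "submod N"
      using submod_lattice by (simp add: flag_def admissible_def)
    then show "N \<in> S"
      using flag_primitive_bounds[OF B(1) L(1) _ B(3)] L(2) B(2) by (simp add: S_def subsetD)
  qed
  ultimately have fin: "finite {B. flag B \<and> A \<subseteq> B}"
    using finite_subset finite_Pow_iff by metis
  have "A \<in> {B. flag B \<and> A \<subseteq> B}"
    using A by simp
  from finite_has_maximal2[OF fin this] obtain B where B: "flag B" "A \<subseteq> B" and max: "\<And>D. D \<in> {B. flag B \<and> A \<subseteq> B} \<Longrightarrow> B \<subseteq> D \<Longrightarrow> B = D"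
    by (metis (no_types, lifting) mem_Collect_eq)
  have "D = B" if "flag D" "B \<subseteq> D" for D
    using max[of D] that B(2) by simp
  then have "maximal_flag B"
    using B(1) by (simp add: maximal_flag_def)
  then show ?thesis
    using B(2) by blast
qed

text \<open>
  Between \<open>\<pi>L\<^sub>0\<close> and a primitive \<open>L\<^sub>0\<close> these are the maximal isotropic subspaces of \<open>L\<^sub>0/\<pi>L\<^sub>0\<close>. The
  definition avoids \<open>L\<^sub>0\<close> because the same lattice is Lagrangian in many primitive ones.
\<close>

definition lagrangian :: "'v set \<Rightarrow> bool" where
  "lagrangian N \<longleftrightarrow> is_lattice N \<and> form_image N \<subseteq> \<pi>\<O> \<and> (\<forall>v. (\<forall>y\<in>N. form v y \<in> \<pi>\<O>) \<longrightarrow> v \<in> N)"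

lemma form_image_adjoin:
  assumes "\<And>x y. x \<in> N \<Longrightarrow> y \<in> N \<Longrightarrow> form x y \<in> \<pi>\<O>" and "\<And>y. y \<in> N \<Longrightarrow> form v y \<in> \<pi>\<O>"
  shows "form_image (adjoin N v) \<subseteq> \<pi>\<O>"
proof -
  have "form (x + c *s v) (y + d *s v) \<in> \<pi>\<O>"
    if "x \<in> N" "y \<in> N" "c \<in> \<O>" "d \<in> \<O>" for x y c d
  proof -
    have "form (x + c *s v) (y + d *s v) = form x y + (d * form x v + c * form v y)"
      by (simp add: form_linear form_alternating)
    moreover have "form x v \<in> \<pi>\<O>"
      using assms(2) that form_swap_max_ideal by blast
    ultimately show ?thesis
      using that assms by (simp add: max_ideal_add max_ideal_mult)
  qed
  then show ?thesis
    by (auto simp: form_image_subset_iff adjoin_def)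
qed

text \<open>
  A vector \<open>v\<close> orthogonal modulo \<open>\<pi>\<close> to the greatest member \<open>m\<close> lies in the self-dual \<open>L\<close> because \<open>m\<close>
  contains \<open>\<pi>L\<close>. Then \<open>m + \<O>v\<close> fits into the flag, so \<open>v \<in> m\<close>.
\<close>

lemma maximal_flag_has_lagrangian:
  assumes A: "maximal_flag A" "A \<noteq> {}"
  shows "\<exists>m\<in>A. lagrangian m \<and> (\<forall>N\<in>A. N \<subseteq> m)"
proof -
  have fl: "flag A"
    using A by (simp add: maximal_flag_def)
  obtain L where L: "primitive_lattice L" "dilate \<pi> L \<in> A"
    using maximal_flag_has_primitive[OF A] by blast
  have b: "dilate \<pi> L \<subseteq> N \<and> N \<subseteq> L" if "N \<in> A" for N
    using flag_primitive_bounds[OF fl L that] .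
  obtain m where m: "m \<in> A" "\<forall>N\<in>A. N \<subseteq> m"
    using flag_greatest[OF fl A(2)] by blast
  have m': "is_lattice m" "form_image m \<subseteq> \<pi>\<O>"
    using fl m by (auto simp: flag_def admissible_def)
  have "v \<in> m" if v: "\<forall>y\<in>m. form v y \<in> \<pi>\<O>" for v
  proof -
    have "v \<in> L"
    proof (rule primitive_self_dual[OF L(1)])
      fix y assume "y \<in> L"
      then have "\<pi> *s y \<in> m"
        using b[OF m(1)] uniformizer_scale_mem_dilate by blast
      then have "form v (\<pi> *s y) \<in> \<pi>\<O>"
        using v by blast
      then show "form v y \<in> \<O>"
        by (simp add: form_scale_right uniformizer_mult_max_ideal_iff)
    qed
    have "adjoin m v \<in> A"
    proof (rule maximal_flag_mem[OF A(1) L(1) b])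
      show "submod (adjoin m v)"
        using submod_adjoin submod_lattice m'(1) by blast
      show "dilate \<pi> L \<subseteq> adjoin m v"
        using adjoin_superset b[OF m(1)] by blast
      show "adjoin m v \<subseteq> L"
        using adjoin_subset[OF primitive_submod[OF L(1)]] b[OF m(1)] \<open>v \<in> L\<close> by blast
      show "form_image (adjoin m v) \<subseteq> \<pi>\<O>"
        using m'(2) v by (intro form_image_adjoin) (auto simp: form_image_subset_iff)
      show "M \<subseteq> adjoin m v \<or> adjoin m v \<subseteq> M" if "M \<in> A" for M
        using adjoin_superset m(2) that by blast
    qed
    then show ?thesis
      using m(2) adjoin_self[OF submod_lattice[OF m'(1)]] by blast
  qed
  then show ?thesis
    using m m' by (auto simp: lagrangian_def)
qed

end


section \<open>Closeness as the neighbour relation\<close>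

context pos_symplectic_space
begin

lemma dilate_mono: "L \<subseteq> M \<Longrightarrow> dilate a L \<subseteq> dilate a M"
  by (auto simp: dilate_def)

lemma dilate_uniformizer_monoD: "dilate \<pi> L \<subseteq> dilate \<pi> M \<Longrightarrow> L \<subseteq> M"
  using dilate_mono_iff[OF uniformizer_nonzero] by blast

text \<open>
  When the exchange works in both directions it preserves maximality: a flag strictly above the
  exchanged one could be exchanged back to a flag strictly above the original one.
\<close>

lemma flag_neighbours_exchange:
  assumes G: "flag (insert N G)" and L: "primitive_lattice L" "dilate \<pi> L \<in> insert N G"
    and nin: "N \<notin> G" "N' \<notin> G" and inc: "\<not> compatible N N'"
    and ex: "\<And>A. flag A \<Longrightarrow> insert N G \<subseteq> A \<Longrightarrow> flag (insert N' (A - {N}))"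
    and ex': "\<And>A. flag A \<Longrightarrow> insert N' G \<subseteq> A \<Longrightarrow> flag (insert N (A - {N'}))"
  shows "flag_neighbours N N'"
proof -
  obtain B where B: "insert N G \<subseteq> B" "maximal_flag B"
    using flag_extends[OF G L] by blast
  have fB: "flag B" and mB: "\<And>D. flag D \<Longrightarrow> B \<subseteq> D \<Longrightarrow> D = B"
    using B(2) by (auto simp: maximal_flag_def)
  have "N' \<notin> B"
    using fB B(1) inc by (auto simp: flag_def)
  define F where "F = B - {N}"
  have F: "insert N F = B" "N \<notin> F" "N' \<notin> F" "G \<subseteq> F"
    using B(1) nin \<open>N' \<notin> B\<close> by (auto simp: F_def)
  have "D = insert N' F" if D: "flag D" "insert N' F \<subseteq> D" for D
  proof -
    have "insert N (D - {N'}) = B"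
    proof (rule mB)
      show "flag (insert N (D - {N'}))"
        using ex' D F(4) by blast
      show "B \<subseteq> insert N (D - {N'})"
        using D(2) F by blast
    qed
    moreover have "N \<notin> D"
      using D inc compatible_sym by (auto simp: flag_def)
    ultimately have "D - {N'} \<subseteq> F"
      by (auto simp: F_def)
    then show ?thesis
      using D(2) by blast
  qed
  moreover have "flag (insert N' F)"
    unfolding F_def using ex fB B(1) by blast
  ultimately have "maximal_flag (insert N' F)"
    unfolding maximal_flag_def by blast
  moreover have "N \<noteq> N'"
    using \<open>N' \<notin> B\<close> B(1) by blast
  ultimately show ?thesis
    unfolding flag_neighbours_def using F(1-3) B(2) by (intro exI[of _ F] conjI) simp_all
qed

definition lattice_sum :: "'v set \<Rightarrow> 'v set \<Rightarrow> 'v set" where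
  "lattice_sum L L' = {x + y |x y. x \<in> L \<and> y \<in> L'}"

lemma lattice_sum_commute: "lattice_sum L L' = lattice_sum L' L"
  unfolding lattice_sum_def by (metis add.commute)

lemma lattice_sum_left: "submod L' \<Longrightarrow> L \<subseteq> lattice_sum L L'"
  unfolding lattice_sum_def using submod_0 by force

lemma lattice_sum_right: "submod L \<Longrightarrow> L' \<subseteq> lattice_sum L L'"
  using lattice_sum_left lattice_sum_commute by metis

lemma submod_lattice_sum:
  assumes "submod L" "submod L'"
  shows "submod (lattice_sum L L')"
proof -
  have "\<exists>x y. a + b + (c + d) = x + y \<and> x \<in> L \<and> y \<in> L'"
    if "a \<in> L" "b \<in> L'" "c \<in> L" "d \<in> L'" for a b c d
    using that assms submod_add by (intro exI[of _ "a + c"] exI[of _ "b + d"]) (simp add: algebra_simps)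
  moreover have "\<exists>x y. c *s (a + b) = x + y \<and> x \<in> L \<and> y \<in> L'"
    if "a \<in> L" "b \<in> L'" "c \<in> \<O>" for a b c
    using that assms submod_scale
    by (intro exI[of _ "c *s a"] exI[of _ "c *s b"]) (simp add: scale_right_distrib)
  moreover have "0 \<in> lattice_sum L L'"
    using lattice_sum_left[of L' L] assms submod_0 by blast
  ultimately show ?thesis
    unfolding submod_def by (auto simp: lattice_sum_def)
qed

lemma lattice_sum_neighbour:
  assumes L: "submod L" and nb: "neighbour L L'" and w: "w \<in> lattice_sum L L'" "w \<notin> L"
  shows "lattice_sum L L' \<subseteq> adjoin L w"
proof -
  obtain x where x: "\<pi> *s x \<in> L" "L' \<subseteq> adjoin L x"
    using nb by (auto simp: neighbour_def)
  have sub: "lattice_sum L L' \<subseteq> adjoin L x"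
    using x(2) adjoin_superset[of L x] submod_add[OF submod_adjoin[OF L]]
    by (force simp: lattice_sum_def)
  then show ?thesis
    using adjoin_exchange[OF L x(1) _ w(2)] w(1) by blast
qed

text \<open>
  As \<open>(L + L')/L\<close> has length one, every other member of a flag through \<open>\<pi>L\<close> and \<open>\<pi>(L + L')\<close>
  contains \<open>\<pi>(L + L')\<close>; being isotropic modulo \<open>\<pi>\<close> it is then contained in the dual \<open>L \<inter> L'\<close> of
  \<open>L + L'\<close>. Both bounds are symmetric in \<open>L\<close> and \<open>L'\<close>.
\<close>

lemma primitive_exchange:
  assumes L: "primitive_lattice L" and nb: "neighbour L L'"
    and A: "flag A" "dilate \<pi> L \<in> A" "dilate \<pi> (lattice_sum L L') \<in> A"
  shows "flag (insert (dilate \<pi> L') (A - {dilate \<pi> L}))"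
proof -
  define M where "M = dilate \<pi> (lattice_sum L L')"
  have L': "primitive_lattice L'"
    by (rule neighbour_primitive[OF nb])
  have sub: "submod L" "submod L'"
    using L L' primitive_submod by auto
  have b: "dilate \<pi> L' \<subseteq> N \<and> N \<subseteq> L'" if N: "N \<in> A - {dilate \<pi> L}" for N
  proof -
    have NL: "dilate \<pi> L \<subseteq> N"
      using flag_primitive_bounds[OF A(1) L A(2)] N by blast
    have adm: "submod N" "form_image N \<subseteq> \<pi>\<O>"
      using A(1) N submod_lattice by (auto simp: flag_def admissible_def)
    have "M \<subseteq> N"
    proof (cases "N \<subseteq> M")
      case True
      obtain z where z: "z \<in> N" "z \<notin> dilate \<pi> L"
        using NL N by blast
      then have "z \<in> dilate \<pi> (lattice_sum L L')"
        using True by (auto simp: M_def)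
      then obtain w where w: "w \<in> lattice_sum L L'" "z = \<pi> *s w"
        unfolding mem_dilate_uniformizer by blast
      have "w \<notin> L"
        using z(2) by (simp add: w uniformizer_scale_mem_dilate)
      show ?thesis
      proof
        fix v assume "v \<in> M"
        then obtain u where u: "u \<in> adjoin L w" "v = \<pi> *s u"
          using lattice_sum_neighbour[OF sub(1) nb w(1) \<open>w \<notin> L\<close>]
          by (auto simp: M_def mem_dilate_uniformizer)
        then obtain l c where l: "l \<in> L" "c \<in> \<O>" "u = l + c *s w"
          by (auto simp: adjoin_def)
        then have "v = \<pi> *s l + c *s z"
          by (simp add: u w scale_right_distrib mult.commute)
        moreover have "\<pi> *s l \<in> N"
          using NL l(1) uniformizer_scale_mem_dilate by blast
        ultimately show "v \<in> N"
          using submod_add submod_scale adm(1) z(1) l(2) by simp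
      qed
    next
      case False
      then show ?thesis
        using flag_chain[OF A(1), of N M] N A(3) by (auto simp: M_def)
    qed
    moreover have L'_sub: "dilate \<pi> L' \<subseteq> M"
      unfolding M_def by (intro dilate_mono lattice_sum_right sub(1))
    ultimately have L'N: "dilate \<pi> L' \<subseteq> N"
      by blast
    have "z \<in> L'" if z: "z \<in> N" for z
    proof (rule primitive_self_dual[OF L'])
      fix y assume "y \<in> L'"
      then have "\<pi> *s y \<in> N"
        using L'N uniformizer_scale_mem_dilate by blast
      then have "form z (\<pi> *s y) \<in> \<pi>\<O>"
        using adm(2) z by (simp add: form_image_subset_iff)
      then show "form z y \<in> \<O>"
        by (simp add: form_scale_right uniformizer_mult_max_ideal_iff)
    qed
    then show ?thesis
      using L'N by blast
  qed
  show ?thesis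
  proof (rule flag_insert[OF _ L'])
    show "flag (A - {dilate \<pi> L})"
      using flag_subset[OF A(1)] by blast
    show "submod (dilate \<pi> L')" "dilate \<pi> L' \<subseteq> L'" "form_image (dilate \<pi> L') \<subseteq> \<pi>\<O>"
      using sub submod_dilate dilate_uniformizer_subset dilate_form_image L' by auto
  qed (use b in auto)
qed

lemma flag_singleton_primitive:
  assumes L: "primitive_lattice L"
  shows "flag {dilate \<pi> L}"
  using primitive_submod[OF L] dilate_form_image[OF L] submod_dilate dilate_uniformizer_subset
  by (intro flag_insert[OF _ L]) (auto simp: flag_def)

lemma neighbour_sum_flag:
  assumes L: "primitive_lattice L" and nb: "neighbour L L'"
  shows "flag {dilate \<pi> L, dilate \<pi> (lattice_sum L L')}"
proof -
  have L': "primitive_lattice L'"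
    by (rule neighbour_primitive[OF nb])
  have sub: "submod L" "submod L'"
    using L L' primitive_submod by auto
  have scaled: "\<pi> *s y \<in> L" if "y \<in> L'" for y
    using neighbour_dilate_subset[OF sub(1) nb] that uniformizer_scale_mem_dilate by blast
  have incl: "dilate \<pi> L \<subseteq> dilate \<pi> (lattice_sum L L')"
    by (intro dilate_mono lattice_sum_left sub(2))
  have "form (\<pi> *s (x + y)) (\<pi> *s (x' + y')) \<in> \<pi>\<O>"
    if "x \<in> L" "y \<in> L'" "x' \<in> L" "y' \<in> L'" for x y x' y'
  proof -
    have "form (\<pi> *s (x + y)) (\<pi> *s (x' + y')) =
      \<pi> * (\<pi> * form x x' + form x (\<pi> *s y') + form (\<pi> *s y) x' + \<pi> * form y y')"
      by (simp add: form_linear algebra_simps)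
    moreover have "form x x' \<in> \<O>" "form x (\<pi> *s y') \<in> \<O>" "form (\<pi> *s y) x' \<in> \<O>" "form y y' \<in> \<O>"
      using that scaled primitive_form[OF L] primitive_form[OF L'] by blast+
    ultimately show ?thesis
      by (simp only: uniformizer_mult_max_ideal_iff)
        (intro val_ring_add val_ring_mult val_ring_uniformizer)
  qed
  then have "form_image (dilate \<pi> (lattice_sum L L')) \<subseteq> \<pi>\<O>"
    by (auto simp: form_image_subset_iff mem_dilate_uniformizer lattice_sum_def)
  moreover have "dilate \<pi> (lattice_sum L L') \<subseteq> L"
  proof -
    have "\<pi> *s (x + y) \<in> L" if "x \<in> L" "y \<in> L'" for x y
      using that scaled submod_add[OF sub(1)] submod_scale[OF sub(1) val_ring_uniformizer]
      by (simp add: scale_right_distrib)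
    then show ?thesis
      by (auto simp: mem_dilate_uniformizer lattice_sum_def)
  qed
  ultimately have "flag (insert (dilate \<pi> (lattice_sum L L')) {dilate \<pi> L})"
    using incl submod_dilate[OF submod_lattice_sum[OF sub]] dilate_uniformizer_subset[OF sub(1)]
    by (intro flag_insert[OF flag_singleton_primitive[OF L] L]) auto
  then show ?thesis
    by (simp add: insert_commute)
qed

lemma primitive_compatible_eq:
  assumes "primitive_lattice L" "primitive_lattice L'" "compatible (dilate \<pi> L) (dilate \<pi> L')"
  shows "L = L'"
proof -
  have "dilate \<pi> L \<subseteq> dilate \<pi> L' \<or> dilate \<pi> L' \<subseteq> dilate \<pi> L"
    using assms(3) unfolding compatible_def by blast
  then have "L \<subseteq> L' \<or> L' \<subseteq> L"
    using dilate_uniformizer_monoD by blast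
  then show ?thesis
    using primitive_subset_eq assms(1,2) by blast
qed

text \<open>
  For the forward direction take \<open>x\<close> in \<open>L' - L\<close>. The lattice \<open>\<pi>L + \<O>\<pi>x\<close> fits into the first flag below
  all members of the common face, so it is in that face and therefore contains \<open>\<pi>L'\<close>.
\<close>

lemma flag_neighbours_primitive:
  assumes L: "primitive_lattice L"
  shows "flag_neighbours (dilate \<pi> L) N' \<longleftrightarrow> (\<exists>L'. neighbour L L' \<and> N' = dilate \<pi> L')"
proof
  assume "flag_neighbours (dilate \<pi> L) N'"
  then obtain F where F: "dilate \<pi> L \<notin> F" "N' \<notin> F" "dilate \<pi> L \<noteq> N'"
      "maximal_flag (insert (dilate \<pi> L) F)" "maximal_flag (insert N' F)"
    by (auto simp: flag_neighbours_def)
  have fl: "flag (insert (dilate \<pi> L) F)" "flag (insert N' F)"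
    using F by (auto simp: maximal_flag_def)
  obtain L' where L': "primitive_lattice L'" "dilate \<pi> L' \<in> insert N' F"
    using maximal_flag_has_primitive[OF F(5)] by blast
  have "dilate \<pi> L' \<notin> F"
    using flag_primitive_unique[OF fl(1) L _ L'(1)] F(1) by blast
  then have N': "N' = dilate \<pi> L'"
    using L'(2) by blast
  have b: "dilate \<pi> L \<subseteq> N \<and> N \<subseteq> L" "dilate \<pi> L' \<subseteq> N" if "N \<in> F" for N
    using flag_primitive_bounds[OF fl(1) L, of N] flag_primitive_bounds[OF fl(2) L'(1), of N]
      that L'(2) by auto
  have "\<not> L' \<subseteq> L"
    using primitive_subset_eq[OF L'(1) L] F(3) N' by blast
  then obtain x where x: "x \<in> L'" "x \<notin> L"
    by blast
  \<comment> \<open>The lattice \<open>\<pi>L + \<O>y\<close> will be inserted into the first flag. For this \<open>y\<close> has to lie in all members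
    of \<open>F\<close>, as \<open>\<pi>x\<close> does. If \<open>F\<close> is empty any \<open>y\<close> will do, and the insertion refutes maximality.\<close>
  have "\<exists>y. y \<in> L \<and> y \<notin> dilate \<pi> L \<and> (F \<noteq> {} \<longrightarrow> y = \<pi> *s x)"
  proof (cases "F = {}")
    case True
    then show ?thesis
      using lattice_not_in_dilate[OF primitive_is_lattice[OF L]] by auto
  next
    case False
    then obtain N where "N \<in> F" by blast
    then have "\<pi> *s x \<in> L"
      using b x(1) uniformizer_scale_mem_dilate by blast
    then show ?thesis
      using x(2) by (auto simp: uniformizer_scale_mem_dilate)
  qed
  then obtain y where y: "y \<in> L" "y \<notin> dilate \<pi> L" "F \<noteq> {} \<Longrightarrow> y = \<pi> *s x"
    by blast
  define M where "M = adjoin (dilate \<pi> L) y"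
  have sub: "submod L" "submod (dilate \<pi> L)"
    using primitive_submod[OF L] submod_dilate by auto
  have yM: "y \<in> M"
    using adjoin_self[OF sub(2)] by (simp add: M_def)
  have "M \<in> insert (dilate \<pi> L) F"
  proof (rule maximal_flag_mem[OF F(4) L])
    show "dilate \<pi> L \<subseteq> N \<and> N \<subseteq> L" if "N \<in> insert (dilate \<pi> L) F" for N
      using that b dilate_uniformizer_subset[OF sub(1)] by blast
    show "submod M"
      unfolding M_def by (rule submod_adjoin[OF sub(2)])
    show "dilate \<pi> L \<subseteq> M" "M \<subseteq> L"
      unfolding M_def using adjoin_superset adjoin_subset[OF sub(1) dilate_uniformizer_subset[OF sub(1)] y(1)]
      by auto
    show "form_image M \<subseteq> \<pi>\<O>"
      unfolding M_def
    proof (rule form_image_adjoin)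
      show "form u v \<in> \<pi>\<O>" if "u \<in> dilate \<pi> L" "v \<in> dilate \<pi> L" for u v
        using dilate_form_image[OF L] that by (simp add: form_image_subset_iff)
      show "form y v \<in> \<pi>\<O>" if "v \<in> dilate \<pi> L" for v
        using that primitive_form[OF L y(1)]
        by (auto simp: mem_dilate_uniformizer form_scale_right uniformizer_mult_max_ideal_iff)
    qed
    show "N \<subseteq> M \<or> M \<subseteq> N" if N: "N \<in> insert (dilate \<pi> L) F" for N
    proof (cases "N = dilate \<pi> L")
      case True
      then show ?thesis
        using adjoin_superset by (simp add: M_def)
    next
      case False
      then have NF: "N \<in> F"
        using N by blast
      then have "y \<in> N"
        using b(2)[OF NF] x(1) y(3) uniformizer_scale_mem_dilate by blast
      moreover have "submod N"
        using fl(1) N submod_lattice by (auto simp: flag_def admissible_def)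
      ultimately show ?thesis
        using adjoin_subset[of N "dilate \<pi> L" y] b(1)[OF NF] by (simp add: M_def)
    qed
  qed
  then have "M \<in> F"
    using yM y(2) by blast
  then have yx: "y = \<pi> *s x" and "dilate \<pi> L' \<subseteq> M"
    using y(3) b by auto
  have "z \<in> adjoin L x" if "z \<in> L'" for z
  proof -
    have "\<pi> *s z \<in> M"
      using \<open>dilate \<pi> L' \<subseteq> M\<close> that uniformizer_scale_mem_dilate by blast
    then obtain l c where l: "l \<in> L" "c \<in> \<O>" "\<pi> *s z = \<pi> *s l + c *s \<pi> *s x"
      by (auto simp: M_def adjoin_def mem_dilate_uniformizer yx)
    then have "\<pi> *s z = \<pi> *s (l + c *s x)"
      by (simp add: scale_right_distrib mult.commute)
    then have "z = l + c *s x"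
      using uniformizer_nonzero by simp
    then show ?thesis
      using l by (auto simp: adjoin_def)
  qed
  then have "neighbour L L'"
    using L'(1) x y(1) yx by (auto simp: neighbour_def)
  then show "\<exists>L'. neighbour L L' \<and> N' = dilate \<pi> L'"
    using N' by blast
next
  assume "\<exists>L'. neighbour L L' \<and> N' = dilate \<pi> L'"
  then obtain L' where nb: "neighbour L L'" and N': "N' = dilate \<pi> L'" by blast
  have L': "primitive_lattice L'"
    by (rule neighbour_primitive[OF nb])
  have nb': "neighbour L' L"
    by (rule neighbour_sym[OF L nb])
  have ne: "\<not> L' \<subseteq> L" "\<not> L \<subseteq> L'"
    using neighbour_not_subset nb nb' by auto
  have "L \<subseteq> lattice_sum L L'" "L' \<subseteq> lattice_sum L L'"
    using lattice_sum_left lattice_sum_right primitive_submod L L' by auto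
  then have "\<not> lattice_sum L L' \<subseteq> L" "\<not> lattice_sum L L' \<subseteq> L'"
    using ne by auto
  then have "dilate \<pi> L \<noteq> dilate \<pi> (lattice_sum L L')" "dilate \<pi> L' \<noteq> dilate \<pi> (lattice_sum L L')"
    using dilate_uniformizer_monoD by blast+
  then show "flag_neighbours (dilate \<pi> L) N'"
    unfolding N'
  proof (intro flag_neighbours_exchange[where G = "{dilate \<pi> (lattice_sum L L')}", OF _ L])
    show "\<not> compatible (dilate \<pi> L) (dilate \<pi> L')"
      using primitive_compatible_eq[OF L L'] ne by blast
    show "flag (insert (dilate \<pi> L') (A - {dilate \<pi> L}))"
      if "flag A" "{dilate \<pi> L, dilate \<pi> (lattice_sum L L')} \<subseteq> A" for A
      using primitive_exchange[OF L nb that(1)] that(2) by blast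
    show "flag (insert (dilate \<pi> L) (A - {dilate \<pi> L'}))"
      if "flag A" "{dilate \<pi> L', dilate \<pi> (lattice_sum L L')} \<subseteq> A" for A
      using primitive_exchange[OF L' nb' that(1)] that(2) lattice_sum_commute[of L L'] by simp
  qed (use neighbour_sum_flag[OF L nb] in auto)
qed

lemma lagrangian_is_lattice: "lagrangian L \<Longrightarrow> is_lattice L"
  and lagrangian_form_image: "lagrangian L \<Longrightarrow> form_image L \<subseteq> \<pi>\<O>"
  and lagrangian_form: "lagrangian L \<Longrightarrow> x \<in> L \<Longrightarrow> y \<in> L \<Longrightarrow> form x y \<in> \<pi>\<O>"
  by (auto simp: lagrangian_def form_image_subset_iff)

text \<open>
  Lagrangian lattices are the primitive lattices of the form divided by \<open>\<pi>\<close>. Through this scaled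
  space everything proved about primitive lattices and their neighbours applies to them.
\<close>

lemma scaled_space:
  assumes "a \<noteq> 0"
  shows "pos_symplectic_space ord \<pi> scale (\<lambda>x y. form x y / a) n"
proof (unfold_locales, goal_cases)
  case 1
  show ?case
    by (rule dim_space)
next
  case (10 x)
  then show ?case
    by (simp add: form_alternating)
next
  case (11 x)
  then show ?case
    using form_nondegenerate[of x] assms by simp
next
  case 12
  then show ?case
    by (rule rank_pos)
qed (simp_all add: form_linear add_divide_distrib ring_distribs)

interpretation S: pos_symplectic_space ord \<pi> scale "\<lambda>x y. form x y / \<pi>" n
  by (rule scaled_space[OF uniformizer_nonzero])

lemma scaled_primitive_iff: "S.primitive_lattice L \<longleftrightarrow> lagrangian L"
proof
  assume L: "S.primitive_lattice L"
  have "v \<in> L" if "\<forall>y\<in>L. form v y \<in> \<pi>\<O>" for v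
    using that by (intro S.primitive_self_dual[OF L]) (simp add: max_ideal_iff_divide)
  then show "lagrangian L"
    using S.primitive_is_lattice[OF L] S.primitive_form[OF L]
    by (simp add: lagrangian_def form_image_subset_iff max_ideal_iff_divide)
next
  assume L: "lagrangian L"
  have "x \<in> dilate \<pi> L" if x: "x \<in> L" "\<forall>y\<in>L. form x y / \<pi> \<in> \<pi>\<O>" for x
  proof -
    have "\<forall>y\<in>L. form (inverse \<pi> *s x) y \<in> \<pi>\<O>"
      using x(2) by (simp add: form_scale_left divide_inverse mult.commute)
    then have "inverse \<pi> *s x \<in> L"
      using L by (simp add: lagrangian_def)
    then show ?thesis
      by (simp add: mem_dilate_iff uniformizer_nonzero)
  qed
  moreover have "form x y / \<pi> \<in> \<O>" if "x \<in> L" "y \<in> L" for x y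
    using L that unfolding lagrangian_def form_image_subset_iff max_ideal_iff_divide by blast
  then have "S.form_image L \<subseteq> \<O>"
    unfolding S.form_image_subset_iff by blast
  moreover have "is_lattice L"
    using L by (simp add: lagrangian_def)
  ultimately show "S.primitive_lattice L"
    unfolding S.primitive_lattice_def by blast
qed

lemma lagrangian_subset:
  assumes "lagrangian L" "form_image N \<subseteq> \<pi>\<O>" "L \<subseteq> N"
  shows "N \<subseteq> L"
  using assms unfolding lagrangian_def form_image_subset_iff by blast

text \<open>
  A Lagrangian of the scaled space between \<open>\<pi>(L + L')\<close> and \<open>L \<inter> L'\<close> is \<open>\<pi>L\<^sub>0\<close> for a primitive \<open>L\<^sub>0\<close>
  of the original one; it is found as the top of a maximal flag of the scaled space.
\<close>

lemma scaled_neighbour_common_primitive: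
  assumes L: "lagrangian L" and nb: "S.neighbour L L'"
  shows "\<exists>L0. primitive_lattice L0 \<and> dilate \<pi> L0 \<subseteq> L \<inter> L' \<and> L \<subseteq> L0 \<and> L' \<subseteq> L0"
proof -
  have SL: "S.primitive_lattice L" "S.primitive_lattice L'"
    using L nb S.neighbour_primitive by (auto simp: scaled_primitive_iff)
  have sub: "submod L" "submod L'"
    using SL S.primitive_submod by auto
  define M where "M = dilate \<pi> (lattice_sum L L')"
  have "S.flag {dilate \<pi> L, M}"
    unfolding M_def by (rule S.neighbour_sum_flag[OF SL(1) nb])
  then obtain B where B: "{dilate \<pi> L, M} \<subseteq> B" "S.maximal_flag B"
    using S.flag_extends[OF _ SL(1)] by blast
  then have fB: "S.flag B"
    by (simp add: S.maximal_flag_def)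
  obtain m where m: "m \<in> B" "S.lagrangian m" "\<forall>N\<in>B. N \<subseteq> m"
    using S.maximal_flag_has_lagrangian[OF B(2)] B(1) by blast
  have "dilate \<pi> L' \<subseteq> M"
    unfolding M_def by (intro dilate_mono lattice_sum_right sub(1))
  then have "\<not> M \<subseteq> dilate \<pi> L"
    using S.neighbour_not_subset[OF nb] dilate_uniformizer_monoD by blast
  then have m': "m \<in> B - {dilate \<pi> L}"
    using m B(1) by blast
  have "S.flag (insert (dilate \<pi> L') (B - {dilate \<pi> L}))"
    using S.primitive_exchange[OF SL(1) nb fB] B(1) by (simp add: M_def)
  then have b': "dilate \<pi> L' \<subseteq> m \<and> m \<subseteq> L'"
    using S.flag_primitive_bounds[OF _ SL(2)] m' by blast
  have b: "dilate \<pi> L \<subseteq> m \<and> m \<subseteq> L"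
    using S.flag_primitive_bounds[OF fB SL(1)] m(1) B(1) by blast
  define L0 where "L0 = dilate (inverse \<pi>) m"
  have m_eq: "m = dilate \<pi> L0"
    by (simp add: L0_def dilate_dilate dilate_1 uniformizer_nonzero)
  have "primitive_lattice L0"
    unfolding primitive_lattice_def
  proof (intro conjI ballI impI)
    show "is_lattice L0"
      unfolding L0_def using m(2) is_lattice_dilate uniformizer_nonzero by (simp add: S.lagrangian_def)
    have "form x y \<in> \<O>" if "x \<in> L0" "y \<in> L0" for x y
    proof -
      have "form (\<pi> *s x) (\<pi> *s y) / \<pi> \<in> \<pi>\<O>"
        using m(2) that unfolding S.lagrangian_def S.form_image_subset_iff m_eq
        by (simp add: uniformizer_scale_mem_dilate)
      then show ?thesis
        by (simp add: form_linear uniformizer_nonzero uniformizer_mult_max_ideal_iff)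
    qed
    then show "form_image L0 \<subseteq> \<O>"
      by (simp add: form_image_subset_iff)
    fix x assume x: "x \<in> L0" "\<forall>y\<in>L0. form x y \<in> \<pi>\<O>"
    have "form x y / \<pi> \<in> \<pi>\<O>" if "y \<in> m" for y
      using that x(2) by (auto simp: m_eq mem_dilate_uniformizer form_scale_right uniformizer_nonzero)
    then show "x \<in> dilate \<pi> L0"
      using m(2) by (simp add: S.lagrangian_def m_eq[symmetric])
  qed
  moreover have "L \<subseteq> L0" "L' \<subseteq> L0"
    using b b' dilate_uniformizer_monoD unfolding m_eq by auto
  ultimately show ?thesis
    using b b' m_eq by blast
qed

text \<open>
  Since \<open>L/(L \<inter> L')\<close> has length one, a member comparable with \<open>L \<inter> L'\<close> and \<open>L\<close> is contained in
  \<open>L \<inter> L'\<close> unless it contains \<open>L\<close>; and an isotropic lattice containing the Lagrangian \<open>L\<close> is \<open>L\<close>.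
\<close>

lemma lagrangian_exchange:
  assumes L: "lagrangian L" and nb: "S.neighbour L L'"
    and L0: "primitive_lattice L0" "L' \<subseteq> L0" "dilate \<pi> L0 \<subseteq> L'"
    and A: "flag A" "L \<in> A" "L \<inter> L' \<in> A" "dilate \<pi> L0 \<in> A"
  shows "flag (insert L' (A - {L}))"
proof -
  have SL: "S.primitive_lattice L" "S.primitive_lattice L'"
    using L nb S.neighbour_primitive by (auto simp: scaled_primitive_iff)
  have sub: "submod L" "submod L'"
    using SL S.primitive_submod by auto
  have L': "lagrangian L'"
    using SL by (simp add: scaled_primitive_iff)
  have NL': "N \<subseteq> L'" if N: "N \<in> A - {L}" for N
  proof (cases "N \<subseteq> L \<inter> L'")
    case False
    then have LN: "L \<inter> L' \<subseteq> N"
      using flag_chain[OF A(1), of N "L \<inter> L'"] N A(3) by blast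
    have "submod N" "form_image N \<subseteq> \<pi>\<O>"
      using A(1) N submod_lattice by (auto simp: flag_def admissible_def)
    then have "\<not> L \<subseteq> N"
      using lagrangian_subset[OF L] N by blast
    then have "N \<subseteq> L"
      using flag_chain[OF A(1), of N L] N A(2) by blast
    show ?thesis
    proof (rule ccontr)
      assume "\<not> N \<subseteq> L'"
      then obtain z where z: "z \<in> N" "z \<in> L" "z \<notin> L'"
        using \<open>N \<subseteq> L\<close> by blast
      have "L \<subseteq> adjoin L' z"
        by (rule S.neighbour_subset_adjoin[OF sub(2) S.neighbour_sym[OF SL(1) nb] z(2,3)])
      have "l \<in> N" if l: "l \<in> L" for l
      proof -
        obtain l' c where l': "l' \<in> L'" "c \<in> \<O>" "l = l' + c *s z"
          using \<open>L \<subseteq> adjoin L' z\<close> l by (auto simp: adjoin_def)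
        then have "l' = l - c *s z"
          by simp
        then have "l' \<in> L"
          using submod_diff submod_scale sub(1) l l'(2) z(2) by simp
        then show ?thesis
          using LN l' \<open>submod N\<close> submod_add submod_scale z(1) by blast
      qed
      then show False
        using \<open>\<not> L \<subseteq> N\<close> by blast
    qed
  qed blast
  show ?thesis
  proof (rule flag_insert[OF _ L0(1)])
    show "flag (A - {L})"
      using flag_subset[OF A(1)] by blast
    show "form_image L' \<subseteq> \<pi>\<O>"
      using L' by (simp add: lagrangian_def)
    show "dilate \<pi> L0 \<subseteq> M \<and> M \<subseteq> L0" if "M \<in> A - {L}" for M
      using flag_primitive_bounds[OF A(1) L0(1) A(4)] that by blast
  qed (use NL' sub L0 in auto)
qed

lemma lagrangian_not_dilate_primitive:
  assumes "lagrangian L" "primitive_lattice L0"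
  shows "L \<noteq> dilate \<pi> L0"
proof
  assume eq: "L = dilate \<pi> L0"
  obtain x y where xy: "x \<in> L" "y \<in> L" "form x y / \<pi> \<notin> \<pi>\<O>"
    using S.primitive_unit_value assms(1) scaled_primitive_iff by blast
  then obtain x' y' where "x' \<in> L0" "y' \<in> L0" "x = \<pi> *s x'" "y = \<pi> *s y'"
    using eq by (auto simp: mem_dilate_uniformizer)
  then show False
    using xy(3) primitive_form[OF assms(2)]
    by (simp add: form_linear uniformizer_nonzero uniformizer_mult_max_ideal_iff)
qed

text \<open>
  For the forward direction take \<open>x\<close> in \<open>N' - L\<close>. The lattice \<open>(L \<inter> N') + \<O>x\<close> fits into the second flag
  above all members of the common face, so it is \<open>N'\<close>.
\<close>

lemma flag_neighbours_lagrangian: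
  assumes L: "lagrangian L"
  shows "flag_neighbours L N' \<longleftrightarrow> S.neighbour L N'"
proof
  assume "flag_neighbours L N'"
  then obtain F where F: "L \<notin> F" "N' \<notin> F" "L \<noteq> N'"
      "maximal_flag (insert L F)" "maximal_flag (insert N' F)"
    by (auto simp: flag_neighbours_def)
  have fl: "flag (insert L F)" "flag (insert N' F)"
    using F by (auto simp: maximal_flag_def)
  obtain L' where L': "L' \<in> insert N' F" "lagrangian L'" "\<forall>N\<in>insert N' F. N \<subseteq> L'"
    using maximal_flag_has_lagrangian[OF F(5)] by blast
  have eq: "M = L" if M: "lagrangian M" "M \<in> insert L F" for M
  proof -
    have "M \<subseteq> L \<or> L \<subseteq> M"
      using flag_chain[OF fl(1) M(2)] by blast
    then show ?thesis
      using lagrangian_subset[OF M(1) lagrangian_form_image[OF L]]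
        lagrangian_subset[OF L lagrangian_form_image[OF M(1)]] by blast
  qed
  have N': "N' = L'"
  proof (rule ccontr)
    assume "N' \<noteq> L'"
    then have "L' \<in> F"
      using L'(1) by blast
    then show False
      using eq[OF L'(2)] F(1) by blast
  qed
  have FL: "N \<subseteq> L" if "N \<in> F" for N
  proof -
    obtain m where m: "m \<in> insert L F" "lagrangian m" "\<forall>N\<in>insert L F. N \<subseteq> m"
      using maximal_flag_has_lagrangian[OF F(4)] by blast
    then show ?thesis
      using eq[OF m(2,1)] that by blast
  qed
  obtain L0 where L0: "primitive_lattice L0" "dilate \<pi> L0 \<in> insert L F"
    using maximal_flag_has_primitive[OF F(4)] by blast
  then have L0F: "dilate \<pi> L0 \<in> insert N' F"
    using lagrangian_not_dilate_primitive[OF L] by blast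
  have bL: "dilate \<pi> L0 \<subseteq> L \<and> L \<subseteq> L0"
    using flag_primitive_bounds[OF fl(1) L0] by blast
  have bN: "dilate \<pi> L0 \<subseteq> N \<and> N \<subseteq> L0" if "N \<in> insert N' F" for N
    using flag_primitive_bounds[OF fl(2) L0(1) L0F that] .
  have sub: "submod L" "submod L'"
    using L L' submod_lattice lagrangian_is_lattice by auto
  have bL': "dilate \<pi> L0 \<subseteq> L' \<and> L' \<subseteq> L0"
    using bN[OF L'(1)] .
  obtain x where x: "x \<in> L'" "x \<notin> L"
    using lagrangian_subset[OF L'(2) lagrangian_form_image[OF L]] F(3) N' by blast
  define M where "M = adjoin (L \<inter> L') x"
  have subM: "submod M" and xM: "x \<in> M" and inter_sub: "L \<inter> L' \<subseteq> M" and M_sub: "M \<subseteq> L'"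
    unfolding M_def using submod_inter[OF sub] submod_adjoin adjoin_self adjoin_superset
      adjoin_subset[OF sub(2), of "L \<inter> L'" x] x(1) by auto
  have "M \<in> insert N' F"
  proof (rule maximal_flag_mem[OF F(5) L0(1) bN subM])
    show "dilate \<pi> L0 \<subseteq> M" "M \<subseteq> L0"
      using bL bL' inter_sub M_sub by auto
    show "form_image M \<subseteq> \<pi>\<O>"
      using lagrangian_form[OF L'(2)] M_sub by (auto simp: form_image_subset_iff)
    show "N \<subseteq> M \<or> M \<subseteq> N" if "N \<in> insert N' F" for N
      using that FL L'(3) inter_sub M_sub N' by blast
  qed
  then have "M = L'"
    using FL xM x(2) N' by blast
  moreover have "M \<subseteq> adjoin L x"
    unfolding M_def adjoin_def by blast
  ultimately have "L' \<subseteq> adjoin L x"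
    by simp
  moreover have "\<pi> *s x \<in> L"
    using x(1) bL bL' uniformizer_scale_mem_dilate by blast
  moreover have "S.primitive_lattice L'"
    using L'(2) by (simp add: scaled_primitive_iff)
  ultimately show "S.neighbour L N'"
    using x by (auto simp: S.neighbour_def N')
next
  assume nb: "S.neighbour L N'"
  have SL: "S.primitive_lattice L" "S.primitive_lattice N'"
    using L nb S.neighbour_primitive by (auto simp: scaled_primitive_iff)
  have sub: "submod L" "submod N'"
    using SL S.primitive_submod by auto
  have L': "lagrangian N'"
    using SL by (simp add: scaled_primitive_iff)
  have nb': "S.neighbour N' L"
    by (rule S.neighbour_sym[OF SL(1) nb])
  have ne: "\<not> N' \<subseteq> L" "\<not> L \<subseteq> N'"
    using S.neighbour_not_subset nb nb' by auto
  obtain L0 where L0: "primitive_lattice L0" "dilate \<pi> L0 \<subseteq> L \<inter> N'" "L \<subseteq> L0" "N' \<subseteq> L0"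
    using scaled_neighbour_common_primitive[OF L nb] by blast
  have fi: "form_image L \<subseteq> \<pi>\<O>" "form_image (L \<inter> N') \<subseteq> \<pi>\<O>"
    using lagrangian_form[OF L] by (simp_all add: form_image_subset_iff)
  have fl: "flag {L \<inter> N', dilate \<pi> L0}"
    using L0 fi submod_inter[OF sub] dilate_uniformizer_subset[OF primitive_submod[OF L0(1)]]
    by (intro flag_insert[OF flag_singleton_primitive[OF L0(1)] L0(1)]) auto
  have fl': "flag {L, L \<inter> N', dilate \<pi> L0}"
    using L0 fi sub dilate_uniformizer_subset[OF primitive_submod[OF L0(1)]]
    by (intro flag_insert[OF fl L0(1)]) auto
  show "flag_neighbours L N'"
  proof (rule flag_neighbours_exchange[OF fl' L0(1)])
    show "L \<notin> {L \<inter> N', dilate \<pi> L0}" "N' \<notin> {L \<inter> N', dilate \<pi> L0}"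
      using ne lagrangian_not_dilate_primitive[OF L L0(1)] lagrangian_not_dilate_primitive[OF L' L0(1)]
      by auto
    show "\<not> compatible L N'"
      using ne by (auto simp: compatible_def)
    show "flag (insert N' (A - {L}))" if "flag A" "{L, L \<inter> N', dilate \<pi> L0} \<subseteq> A" for A
      using lagrangian_exchange[OF L nb L0(1) _ _ that(1)] L0 that(2) by blast
    show "flag (insert L (A - {N'}))" if "flag A" "{N', L \<inter> N', dilate \<pi> L0} \<subseteq> A" for A
      using lagrangian_exchange[OF L' nb' L0(1) _ _ that(1)] L0 that(2) by (simp add: Int_commute)
  qed simp
qed

text \<open>
  That the class of \<open>L\<close> is a vertex only says that some multiple of \<open>L\<close> is admissible. On a larger
  multiple the form leaves \<open>\<pi>\<O>\<close>; a smaller one would force a primitive lattice into \<open>L\<close>, where the form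
  has no unit values.
\<close>

lemma lagrangian_admissible_multiple:
  assumes L: "lagrangian L" and N: "admissible (dilate a L)" and a: "a \<noteq> 0"
  shows "dilate a L = L"
proof -
  obtain x y where xy: "x \<in> L" "y \<in> L" "form x y / \<pi> \<notin> \<pi>\<O>"
    using S.primitive_unit_value L scaled_primitive_iff by blast
  moreover have "form x y / \<pi> \<in> \<O>"
    using lagrangian_form[OF L xy(1,2)] by (simp add: max_ideal_iff_divide)
  ultimately have u: "form x y / \<pi> \<noteq> 0" "ord (form x y / \<pi>) = 0"
    using unit_iff[of "form x y / \<pi>"] by blast+
  have "a *s x \<in> dilate a L" "a *s y \<in> dilate a L"
    using xy by (auto simp: dilate_def)
  then have "form (a *s x) (a *s y) / \<pi> \<in> \<O>"
    using N unfolding admissible_def form_image_subset_iff max_ideal_iff_divide by blast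
  moreover have "form (a *s x) (a *s y) / \<pi> = a * (a * (form x y / \<pi>))"
    by (simp add: form_linear)
  moreover have "ord (a * (a * (form x y / \<pi>))) = ord a + (ord a + ord (form x y / \<pi>))"
    using a u(1) by (simp only: ord_mult mult_eq_0_iff simp_thms)
  ultimately have "0 \<le> ord a"
    using a u by (simp add: val_ring_def)
  moreover have "\<not> 1 \<le> ord a"
  proof
    assume "1 \<le> ord a"
    then have "a / \<pi> \<in> \<O>"
      using a by (simp add: val_ring_def ord_divide uniformizer_nonzero ord_uniformizer)
    then have "dilate (a / \<pi>) L \<subseteq> L"
      using L submod_lattice by (intro dilate_subset) (auto simp: lagrangian_is_lattice)
    then have sub: "dilate a L \<subseteq> dilate \<pi> L"
      using dilate_mono_iff[of \<pi> "dilate (a / \<pi>) L" L]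
      by (simp add: dilate_dilate uniformizer_nonzero)
    obtain L0 where L0: "primitive_lattice L0" "dilate \<pi> L0 \<subseteq> dilate a L"
      using N by (auto simp: admissible_def)
    then have "L0 \<subseteq> L"
      using sub dilate_uniformizer_monoD by blast
    then show False
      using primitive_unit_value[OF L0(1)] lagrangian_form[OF L] by blast
  qed
  ultimately show ?thesis
    by (intro dilate_unit submod_lattice lagrangian_is_lattice L a) simp
qed

lemma close_to_primitive:
  assumes L: "primitive_lattice L"
  shows "{t'. close_vertices (homothety_class L) t'} = homothety_class ` {L'. neighbour L L'}"
proof -
  have hc: "homothety_class (dilate \<pi> M) = homothety_class M" for M
    by (rule homothety_class_dilate[OF uniformizer_nonzero])
  have "{t'. close_vertices (homothety_class L) t'}
      = homothety_class ` {N'. flag_neighbours (dilate \<pi> L) N'}"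
    using close_vertices_iff[OF admissible_dilate[OF L], unfolded hc] by blast
  also have "{N'. flag_neighbours (dilate \<pi> L) N'} = dilate \<pi> ` {L'. neighbour L L'}"
    using flag_neighbours_primitive[OF L] by blast
  finally show ?thesis
    by (simp add: image_image hc)
qed

lemma close_to_lagrangian:
  assumes L: "lagrangian L" and v: "is_vertex (homothety_class L)"
  shows "{t'. close_vertices (homothety_class L) t'} = homothety_class ` {L'. S.neighbour L L'}"
proof -
  obtain N where N: "admissible N" "homothety_class L = homothety_class N"
    using v unfolding is_vertex_iff by blast
  then obtain a where a: "a \<noteq> 0" "N = dilate a L"
    using homothety_class_eqD by blast
  have "admissible L"
    using lagrangian_admissible_multiple[OF L _ a(1)] N(1) a(2) by simp
  from close_vertices_iff[OF this] show ?thesis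
    unfolding flag_neighbours_lagrangian[OF L] by blast
qed

end


section \<open>Neighbours as left cosets\<close>

lemma J_mat_carrier: "J_mat n \<in> carrier_mat (2 * n) (2 * n)"
  unfolding J_mat_def mult_2 by (rule four_block_carrier_mat) auto

lemma J_mat_index:
  assumes "i < 2 * n" "j < 2 * n"
  shows "J_mat n $$ (i, j) = (if j = i + n then 1 else if i = j + n then - 1 else 0)"
  using assms unfolding J_mat_def by (auto simp: mult_2)

lemma mult_mat_index:
  assumes "A \<in> carrier_mat m m" "B \<in> carrier_mat m m" "i < m" "j < m"
  shows "(A * B) $$ (i, j) = (\<Sum>k<m. A $$ (i, k) * B $$ (k, j))"
  using assms by (auto simp: scalar_prod_def atLeast0LessThan)

lemma bij_betw_images_same_fibres:
  assumes "\<And>x y. x \<in> A \<Longrightarrow> y \<in> A \<Longrightarrow> f x = f y \<longleftrightarrow> g x = g y"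
  shows "\<exists>h. bij_betw h (f ` A) (g ` A)"
proof -
  define h where "h X = g (SOME x. x \<in> A \<and> f x = X)" for X
  have h: "h (f x) = g x" if x: "x \<in> A" for x
  proof -
    have "(SOME y. y \<in> A \<and> f y = f x) \<in> A \<and> f (SOME y. y \<in> A \<and> f y = f x) = f x"
      by (rule someI[where x = x]) (use x in simp)
    then show ?thesis
      unfolding h_def using assms[OF _ x] by blast
  qed
  have "inj_on h (f ` A)"
  proof (rule inj_onI, clarify)
    fix x y assume "x \<in> A" "y \<in> A" "h (f x) = h (f y)"
    then show "f x = f y"
      using h assms[of x y] by simp
  qed
  moreover have "h ` f ` A = g ` A"
    unfolding image_image by (rule image_cong) (simp_all add: h)
  ultimately show ?thesis
    unfolding bij_betw_def by blast
qed

context discrete_valuation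
begin

lemma mats_over_O_iff:
  "A \<in> mats_over_O m \<longleftrightarrow> A \<in> carrier_mat m m \<and> (\<forall>i<m. \<forall>j<m. A $$ (i, j) \<in> \<O>)"
proof -
  have "elements_mat A = {A $$ (i, j) |i j. i < m \<and> j < m}" if "A \<in> carrier_mat m m"
    using that unfolding elements_mat_def by auto blast
  moreover have "{A $$ (i, j) |i j. i < m \<and> j < m} \<subseteq> \<O> \<longleftrightarrow> (\<forall>i<m. \<forall>j<m. A $$ (i, j) \<in> \<O>)"
    by auto
  ultimately show ?thesis
    by (auto simp: mats_over_O_def)
qed

lemma Sp_O_mats: "\<gamma> \<in> Sp_O n \<Longrightarrow> \<gamma> \<in> mats_over_O (2 * n)"
  by (simp add: Sp_O_def GL_O_def)

lemma Sp_O_carrier: "\<gamma> \<in> Sp_O n \<Longrightarrow> \<gamma> \<in> carrier_mat (2 * n) (2 * n)"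
  by (auto dest: Sp_O_mats simp: mats_over_O_iff)

lemma one_in_Sp_O: "1\<^sub>m (2 * n) \<in> Sp_O n"
proof -
  have "1\<^sub>m (2 * n) \<in> mats_over_O (2 * n)"
    by (auto simp: mats_over_O_iff val_ring_0 val_ring_1)
  then have "1\<^sub>m (2 * n) \<in> GL_O (2 * n)"
    unfolding GL_O_def by (intro CollectI conjI bexI[where x = "1\<^sub>m (2 * n)"]) simp_all
  then show ?thesis
    using J_mat_carrier[of n, where 'a = 'k] by (simp add: Sp_O_def)
qed

definition diag_entry :: "nat \<Rightarrow> nat \<Rightarrow> 'k" where
  "diag_entry n i = (if i = 0 then 1 else if i = n then \<pi>\<^sup>2 else \<pi>)"

lemma diag_elt_carrier: "diag_elt n \<in> carrier_mat (2 * n) (2 * n)"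
  by (simp add: diag_elt_def)

lemma diag_elt_index:
  assumes "i < 2 * n" "j < 2 * n"
  shows "diag_elt n $$ (i, j) = (if i = j then diag_entry n j else 0)"
proof -
  have "([1] @ replicate (n - 1) \<pi> @ [\<pi>\<^sup>2] @ replicate (n - 1) \<pi>) ! j = diag_entry n j"
    using assms by (auto simp: nth_append diag_entry_def nth_Cons')
  then show ?thesis
    using assms by (simp add: diag_elt_def mat_diag_def)
qed

lemma double_coset_eq: "double_coset n = {\<gamma>1 * (diag_elt n * \<gamma>2) |\<gamma>1 \<gamma>2. \<gamma>1 \<in> Sp_O n \<and> \<gamma>2 \<in> Sp_O n}"
  unfolding double_coset_def set_mult_def l_coset_def by (auto simp: ring_mat_simps)

lemma left_coset_eq: "g <#\<^bsub>mat_monoid n\<^esub> Sp_O n = {g * \<gamma> |\<gamma>. \<gamma> \<in> Sp_O n}"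
  unfolding l_coset_def by (auto simp: ring_mat_simps)

end

context pos_symplectic_space
begin

text \<open>
  A matrix acts on families of vectors from the right, by recombining them with its columns.
\<close>

definition recombine :: "(nat \<Rightarrow> 'v) \<Rightarrow> 'k mat \<Rightarrow> nat \<Rightarrow> 'v" where
  "recombine b g j = (\<Sum>i<2*n. g $$ (i, j) *s b i)"

text \<open>
  The Gram matrix is \<open>c J\<close>. For \<open>c = 1\<close> this is a symplectic basis in which \<open>b\<^sub>i\<close> is dual to \<open>b\<^sub>i\<^sub>+\<^sub>n\<close>; for
  \<open>c = \<pi>\<^sup>2\<close> these are its recombinations by elements of the double coset.
\<close>

definition similitude_family :: "'k \<Rightarrow> (nat \<Rightarrow> 'v) \<Rightarrow> bool" where
  "similitude_family c b \<longleftrightarrow> (\<forall>i<2*n. \<forall>j<2*n. form (b i) (b j) = c * J_mat n $$ (i, j))"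

lemma recombine_mult:
  assumes "g \<in> carrier_mat (2 * n) (2 * n)" "h \<in> carrier_mat (2 * n) (2 * n)" "j < 2 * n"
  shows "recombine b (g * h) j = recombine (recombine b g) h j"
proof -
  have "recombine b (g * h) j = (\<Sum>i<2*n. \<Sum>k<2*n. (g $$ (i, k) * h $$ (k, j)) *s b i)"
    unfolding recombine_def
    by (intro sum.cong refl)
      (simp add: mult_mat_index[OF assms(1,2) _ assms(3)] scale_sum_left del: index_mult_mat)
  also have "\<dots> = (\<Sum>k<2*n. \<Sum>i<2*n. (g $$ (i, k) * h $$ (k, j)) *s b i)"
    by (rule sum.swap)
  also have "\<dots> = recombine (recombine b g) h j"
    by (simp add: recombine_def scale_sum_right mult.commute)
  finally show ?thesis .
qed

lemma recombine_cong: "(\<And>i. i < 2 * n \<Longrightarrow> b i = b' i) \<Longrightarrow> recombine b g j = recombine b' g j"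
  unfolding recombine_def by (intro sum.cong) auto

lemma recombine_one: "j < 2 * n \<Longrightarrow> recombine b (1\<^sub>m (2 * n)) j = b j"
proof -
  assume j: "j < 2 * n"
  have "recombine b (1\<^sub>m (2 * n)) j = (\<Sum>i<2*n. if i = j then b i else 0)"
    unfolding recombine_def using j by (intro sum.cong) auto
  then show ?thesis
    using j by simp
qed

lemma recombine_diag: "j < 2 * n \<Longrightarrow> recombine b (diag_elt n) j = diag_entry n j *s b j"
proof -
  assume j: "j < 2 * n"
  have "recombine b (diag_elt n) j = (\<Sum>i<2*n. if i = j then diag_entry n i *s b i else 0)"
    unfolding recombine_def using j by (intro sum.cong) (auto simp: diag_elt_index)
  then show ?thesis
    using j by simp
qed

lemma recombine_inject:
  assumes b: "indep_family b" and g: "g \<in> carrier_mat (2 * n) (2 * n)" "h \<in> carrier_mat (2 * n) (2 * n)"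
    and eq: "\<And>j. j < 2 * n \<Longrightarrow> recombine b g j = recombine b h j"
  shows "g = h"
proof (rule eq_matI)
  fix i j assume "i < dim_row h" "j < dim_col h"
  then have ij: "i < 2 * n" "j < 2 * n"
    using g by auto
  have "(\<Sum>i<2*n. (g $$ (i, j) - h $$ (i, j)) *s b i) = 0"
    using eq[OF ij(2)] by (simp add: recombine_def scale_left_diff_distrib sum_subtractf)
  from indep_familyD[OF b this ij(1)] show "g $$ (i, j) = h $$ (i, j)"
    by simp
qed (use g in auto)

lemma ospan_cong: "(\<And>i. i < 2 * n \<Longrightarrow> b i = b' i) \<Longrightarrow> ospan b = ospan b'"
proof -
  assume "\<And>i. i < 2 * n \<Longrightarrow> b i = b' i"
  then have "(\<Sum>i<2*n. c i *s b i) = (\<Sum>i<2*n. c i *s b' i)" for c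
    by (intro sum.cong) auto
  then show ?thesis
    by (simp add: ospan_def)
qed

lemma recombine_in_ospan: "g \<in> mats_over_O (2 * n) \<Longrightarrow> j < 2 * n \<Longrightarrow> recombine b g j \<in> ospan b"
  unfolding recombine_def by (rule ospanI) (simp add: mats_over_O_iff)

lemma ospan_recombine:
  assumes "\<gamma> \<in> GL_O (2 * n)"
  shows "ospan (recombine b \<gamma>) = ospan b"
proof
  obtain h where h: "\<gamma> \<in> mats_over_O (2 * n)" "h \<in> mats_over_O (2 * n)" "\<gamma> * h = 1\<^sub>m (2 * n)"
    using assms by (auto simp: GL_O_def)
  show "ospan (recombine b \<gamma>) \<subseteq> ospan b"
    using recombine_in_ospan h(1) by (intro ospan_subset submod_ospan)
  have "b j \<in> ospan (recombine b \<gamma>)" if j: "j < 2 * n" for j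
  proof -
    have "b j = recombine b (\<gamma> * h) j"
      by (simp add: h(3) recombine_one j)
    also have "\<dots> = recombine (recombine b \<gamma>) h j"
      using h j by (intro recombine_mult) (auto simp: mats_over_O_iff)
    finally show ?thesis
      using recombine_in_ospan[OF h(2) j] by simp
  qed
  then show "ospan b \<subseteq> ospan (recombine b \<gamma>)"
    by (intro ospan_subset submod_ospan)
qed

lemma recombine_form:
  assumes b: "similitude_family c b" and g: "g \<in> carrier_mat (2 * n) (2 * n)" and ij: "i < 2 * n" "j < 2 * n"
  shows "form (recombine b g i) (recombine b g j) = c * (transpose_mat g * J_mat n * g) $$ (i, j)"
proof -
  have carr: "transpose_mat g \<in> carrier_mat (2 * n) (2 * n)" "J_mat n \<in> carrier_mat (2 * n) (2 * n)"
    using g J_mat_carrier by auto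
  have row: "(transpose_mat g * J_mat n) $$ (i, l) = (\<Sum>k<2*n. transpose_mat g $$ (i, k) * J_mat n $$ (k, l))"
    if "l < 2 * n" for l
    by (rule mult_mat_index[OF carr ij(1) that])
  have "form (recombine b g i) (recombine b g j)
      = (\<Sum>l<2*n. \<Sum>k<2*n. g $$ (k, i) * (g $$ (l, j) * form (b k) (b l)))"
    unfolding recombine_def form_sum_right form_sum_left form_linear
    by (simp add: sum_distrib_left mult_ac)
  also have "\<dots> = (\<Sum>l<2*n. \<Sum>k<2*n. c * (transpose_mat g $$ (i, k) * J_mat n $$ (k, l) * g $$ (l, j)))"
    using b g ij by (intro sum.cong refl) (auto simp: similitude_family_def)
  also have "\<dots> = c * (\<Sum>l<2*n. (transpose_mat g * J_mat n) $$ (i, l) * g $$ (l, j))"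
    unfolding sum_distrib_left
    by (intro sum.cong refl) (simp add: row sum_distrib_left sum_distrib_right del: index_mult_mat)
  also have "(\<Sum>l<2*n. (transpose_mat g * J_mat n) $$ (i, l) * g $$ (l, j))
      = (transpose_mat g * J_mat n * g) $$ (i, j)"
    by (rule mult_mat_index[OF mult_carrier_mat[OF carr] g ij, symmetric])
  finally show ?thesis .
qed

lemma similitude_coordinate:
  assumes b: "similitude_family c b" and i: "i < n"
  shows "form (\<Sum>k<2*n. a k *s b k) (b (i + n)) = c * a i"
    and "form (\<Sum>k<2*n. a k *s b k) (b i) = - (c * a (i + n))"
proof -
  have "form (\<Sum>k<2*n. a k *s b k) (b (i + n)) = (\<Sum>k<2*n. if k = i then c * a k else 0)"
    unfolding form_sum_left form_scale_left using b i
    by (intro sum.cong refl) (auto simp: similitude_family_def J_mat_index)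
  then show "form (\<Sum>k<2*n. a k *s b k) (b (i + n)) = c * a i"
    using i by simp
  have "form (\<Sum>k<2*n. a k *s b k) (b i) = (\<Sum>k<2*n. if k = i + n then - (c * a k) else 0)"
    unfolding form_sum_left form_scale_left using b i
    by (intro sum.cong refl) (auto simp: similitude_family_def J_mat_index)
  then show "form (\<Sum>k<2*n. a k *s b k) (b i) = - (c * a (i + n))"
    using i by simp
qed

lemma similitude_indep:
  assumes b: "similitude_family c b" and c: "c \<noteq> 0"
  shows "indep_family b"
  unfolding indep_family_def
proof (intro allI impI)
  fix a i assume a: "(\<Sum>i<2*n. a i *s b i) = 0" and i: "i < 2 * n"
  show "a i = 0"
  proof (cases "i < n")
    case True
    then show ?thesis
      using similitude_coordinate(1)[OF b True, of a] c by (simp add: a form_0_left)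
  next
    case False
    then have "i - n < n" "i - n + n = i"
      using i by auto
    then show ?thesis
      using similitude_coordinate(2)[OF b, of "i - n" a] c by (simp add: a form_0_left)
  qed
qed

lemma similitude_primitive:
  assumes b: "similitude_family 1 b"
  shows "primitive_lattice (ospan b)"
  unfolding primitive_lattice_def
proof (intro conjI ballI impI)
  show "is_lattice (ospan b)"
    using similitude_indep[OF b] is_lattice_iff by auto
  have "form x y \<in> \<O>" if x: "x \<in> ospan b" and y: "y \<in> ospan b" for x y
  proof -
    obtain c where c: "\<forall>i<2*n. c i \<in> \<O>" "x = (\<Sum>i<2*n. c i *s b i)"
      using x unfolding ospan_def by blast
    obtain d where d: "\<forall>i<2*n. d i \<in> \<O>" "y = (\<Sum>i<2*n. d i *s b i)"
      using y unfolding ospan_def by blast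
    have "form (b i) (b j) \<in> \<O>" if "i < 2 * n" "j < 2 * n" for i j
      using b that val_ring_0 val_ring_1 val_ring_minus[OF val_ring_1]
      by (simp add: similitude_family_def J_mat_index)
    then show ?thesis
      unfolding c(2) d(2) form_sum_left form_sum_right form_linear using c(1) d(1)
      by (intro val_ring_sum val_ring_mult) auto
  qed
  then show "form_image (ospan b) \<subseteq> \<O>"
    by (auto simp: form_image_subset_iff)
  fix x assume x: "x \<in> ospan b" "\<forall>y\<in>ospan b. form x y \<in> \<pi>\<O>"
  obtain c where c: "x = (\<Sum>i<2*n. c i *s b i)"
    using x unfolding ospan_def by blast
  have "c i \<in> \<pi>\<O>" if i: "i < 2 * n" for i
  proof (cases "i < n")
    case True
    then have "form x (b (i + n)) \<in> \<pi>\<O>"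
      using x(2) ospan_generator[of "i + n" b] by simp
    then show ?thesis
      using similitude_coordinate(1)[OF b True, of c] by (simp add: c)
  next
    case False
    then have *: "i - n < n" "i - n + n = i" "i - n < 2 * n"
      using i by auto
    then have "form x (b (i - n)) \<in> \<pi>\<O>"
      using x(2) ospan_generator[OF *(3), of b] by simp
    then show ?thesis
      using similitude_coordinate(2)[OF b *(1), of c] max_ideal_minus[of "- c i"] *(2) by (simp add: c)
  qed
  then have "(\<Sum>i<2*n. (c i / \<pi>) *s \<pi> *s b i) \<in> ospan (\<lambda>i. \<pi> *s b i)"
    by (intro ospanI) (simp add: max_ideal_iff_divide)
  then show "x \<in> dilate \<pi> (ospan b)"
    by (simp add: ospan_dilate c uniformizer_nonzero)
qed

text \<open>
  Two families with the same Gram matrix and the same \<open>\<O>\<close>-span differ by an element of the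
  integral symplectic group; conversely, that group preserves both.
\<close>

lemma similitude_change:
  assumes b: "similitude_family c b" and b': "similitude_family c b'" and c: "c \<noteq> 0"
    and eq: "ospan b' = ospan b"
  shows "\<exists>\<gamma>\<in>Sp_O n. \<forall>j<2*n. b' j = recombine b \<gamma> j"
proof -
  have mats: "\<exists>\<gamma>\<in>mats_over_O (2 * n). \<forall>j<2*n. q j = recombine p \<gamma> j" if pq: "ospan q = ospan p" for p q
  proof -
    have "\<exists>a. (\<forall>i<2*n. a i \<in> \<O>) \<and> q j = (\<Sum>i<2*n. a i *s p i)" if j: "j < 2 * n" for j
    proof -
      have "q j \<in> ospan p"
        using ospan_generator[OF j, of q] pq by simp
      then show ?thesis
        unfolding ospan_def by blast
    qed
    then obtain a where a: "\<And>j. j < 2 * n \<Longrightarrow> (\<forall>i<2*n. a j i \<in> \<O>) \<and> q j = (\<Sum>i<2*n. a j i *s p i)"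
      by metis
    define \<gamma> where "\<gamma> = mat (2 * n) (2 * n) (\<lambda>(i, j). a j i)"
    have "\<gamma> \<in> mats_over_O (2 * n)"
      using a by (simp add: \<gamma>_def mats_over_O_iff)
    moreover have "q j = recombine p \<gamma> j" if "j < 2 * n" for j
      using a[OF that] that by (simp add: \<gamma>_def recombine_def)
    ultimately show ?thesis
      by blast
  qed
  obtain \<gamma> where \<gamma>: "\<gamma> \<in> mats_over_O (2 * n)" "\<And>j. j < 2 * n \<Longrightarrow> b' j = recombine b \<gamma> j"
    using mats[OF eq] by blast
  obtain \<delta> where \<delta>: "\<delta> \<in> mats_over_O (2 * n)" "\<And>j. j < 2 * n \<Longrightarrow> b j = recombine b' \<delta> j"
    using mats[OF eq[symmetric]] by blast
  have carr: "\<gamma> \<in> carrier_mat (2 * n) (2 * n)" "\<delta> \<in> carrier_mat (2 * n) (2 * n)"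
    using \<gamma> \<delta> by (auto simp: mats_over_O_iff)
  have "\<gamma> * \<delta> = 1\<^sub>m (2 * n)"
  proof (rule recombine_inject[OF similitude_indep[OF b c]])
    fix j assume j: "j < 2 * n"
    have "recombine b (\<gamma> * \<delta>) j = recombine b' \<delta> j"
      using recombine_mult[OF carr j] recombine_cong[of b' "recombine b \<gamma>"] \<gamma>(2) by simp
    then show "recombine b (\<gamma> * \<delta>) j = recombine b (1\<^sub>m (2 * n)) j"
      using \<delta>(2)[OF j] recombine_one[OF j] by simp
  qed (use carr in auto)
  moreover have "\<delta> * \<gamma> = 1\<^sub>m (2 * n)"
  proof (rule recombine_inject[OF similitude_indep[OF b' c]])
    fix j assume j: "j < 2 * n"
    have "recombine b' (\<delta> * \<gamma>) j = recombine b \<gamma> j"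
      using recombine_mult[OF carr(2,1) j] recombine_cong[of b "recombine b' \<delta>"] \<delta>(2) by simp
    then show "recombine b' (\<delta> * \<gamma>) j = recombine b' (1\<^sub>m (2 * n)) j"
      using \<gamma>(2)[OF j] recombine_one[OF j] by simp
  qed (use carr in auto)
  moreover have "transpose_mat \<gamma> * J_mat n * \<gamma> = J_mat n"
  proof (rule eq_matI)
    fix i j assume "i < dim_row (J_mat n :: 'k mat)" "j < dim_col (J_mat n :: 'k mat)"
    then have ij: "i < 2 * n" "j < 2 * n"
      using J_mat_carrier[of n, where 'a = 'k] by auto
    have "c * (transpose_mat \<gamma> * J_mat n * \<gamma>) $$ (i, j) = form (b' i) (b' j)"
      using recombine_form[OF b carr(1) ij] \<gamma>(2) ij by simp
    then show "(transpose_mat \<gamma> * J_mat n * \<gamma>) $$ (i, j) = J_mat n $$ (i, j)"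
      using b' ij c by (simp add: similitude_family_def)
  qed (use carr J_mat_carrier[of n, where 'a = 'k] in auto)
  ultimately have "\<gamma> \<in> Sp_O n"
    using \<gamma>(1) \<delta>(1) by (auto simp: Sp_O_def GL_O_def)
  then show ?thesis
    using \<gamma>(2) by blast
qed

lemma similitude_recombine:
  assumes b: "similitude_family c b" and \<gamma>: "\<gamma> \<in> Sp_O n"
  shows "similitude_family c (recombine b \<gamma>)" "ospan (recombine b \<gamma>) = ospan b"
  using recombine_form[OF b Sp_O_carrier[OF \<gamma>]] \<gamma> ospan_recombine
  by (auto simp: similitude_family_def Sp_O_def)

lemma similitude_cong:
  "(\<And>i. i < 2 * n \<Longrightarrow> b i = b' i) \<Longrightarrow> similitude_family c b \<Longrightarrow> similitude_family c b'"
  by (simp add: similitude_family_def)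

text \<open>
  Composing two changes of families gives a change of families with the same Gram matrix and span.
\<close>

lemma Sp_O_mult:
  assumes b: "similitude_family c b" and c: "c \<noteq> 0" and \<gamma>: "\<gamma> \<in> Sp_O n" "\<delta> \<in> Sp_O n"
  shows "\<gamma> * \<delta> \<in> Sp_O n"
proof -
  have carr: "\<gamma> \<in> carrier_mat (2 * n) (2 * n)" "\<delta> \<in> carrier_mat (2 * n) (2 * n)"
    using \<gamma> Sp_O_carrier by auto
  define b' where "b' = recombine (recombine b \<gamma>) \<delta>"
  have "similitude_family c b'" "ospan b' = ospan b"
    using similitude_recombine[OF b \<gamma>(1)] similitude_recombine[OF _ \<gamma>(2), of c "recombine b \<gamma>"]
    by (auto simp: b'_def)
  then obtain \<epsilon> where \<epsilon>: "\<epsilon> \<in> Sp_O n" "\<forall>j<2*n. b' j = recombine b \<epsilon> j"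
    using similitude_change[OF b _ c] by blast
  have "\<gamma> * \<delta> = \<epsilon>"
  proof (rule recombine_inject[OF similitude_indep[OF b c]])
    show "\<epsilon> \<in> carrier_mat (2 * n) (2 * n)"
      using \<epsilon>(1) by (rule Sp_O_carrier)
    show "recombine b (\<gamma> * \<delta>) j = recombine b \<epsilon> j" if "j < 2 * n" for j
      using recombine_mult[OF carr that] \<epsilon>(2) that by (simp add: b'_def)
  qed (use carr in auto)
  then show ?thesis
    using \<epsilon>(1) by simp
qed

text \<open>The elementary move from a symplectic basis of \<open>L\<close> to one of a neighbour of \<open>L\<close>.\<close>

definition shift_family :: "(nat \<Rightarrow> 'v) \<Rightarrow> nat \<Rightarrow> 'v" where
  "shift_family b j = (if j = 0 then inverse \<pi> *s b j else if j = n then \<pi> *s b j else b j)"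

lemma similitude_shift: "similitude_family 1 b \<Longrightarrow> similitude_family 1 (shift_family b)"
  using rank_pos uniformizer_nonzero
  by (auto simp: similitude_family_def shift_family_def form_linear J_mat_index)

lemma shift_neighbour:
  assumes b: "similitude_family 1 b"
  shows "neighbour (ospan b) (ospan (shift_family b))"
proof -
  define x where "x = shift_family b 0"
  have L: "primitive_lattice (ospan b)" and L': "primitive_lattice (ospan (shift_family b))"
    using similitude_primitive similitude_shift b by auto
  have sub: "submod (ospan b)"
    by (rule submod_ospan)
  have x: "x = inverse \<pi> *s b 0"
    by (simp add: x_def shift_family_def)
  have "x \<in> ospan (shift_family b)"
    unfolding x_def using rank_pos by (intro ospan_generator) simp
  moreover have "x \<notin> ospan b"
  proof
    assume "x \<in> ospan b"
    then have "form x (b n) \<in> \<O>"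
      using ospan_generator[of n b] rank_pos primitive_form[OF L] by simp
    moreover have "form x (b n) = 1 / \<pi>"
      using b rank_pos by (simp add: x form_linear similitude_family_def J_mat_index inverse_eq_divide)
    ultimately show False
      using max_ideal_iff_divide one_notin_max_ideal by simp
  qed
  moreover have "\<pi> *s x \<in> ospan b"
    using ospan_generator[of 0 b] rank_pos by (simp add: x uniformizer_nonzero)
  moreover have "ospan (shift_family b) \<subseteq> adjoin (ospan b) x"
  proof (rule ospan_subset[OF submod_adjoin[OF sub]])
    fix i assume i: "i < 2 * n"
    show "shift_family b i \<in> adjoin (ospan b) x"
    proof (cases "i = 0")
      case True
      then show ?thesis
        using adjoin_self[OF sub] by (simp add: x_def)
    next
      case False
      then have "shift_family b i \<in> ospan b"
        using ospan_generator[OF i, of b] submod_scale[OF sub val_ring_uniformizer]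
        by (auto simp: shift_family_def)
      then show ?thesis
        using adjoin_superset by blast
    qed
  qed
  ultimately show ?thesis
    using L' unfolding neighbour_def by blast
qed

text \<open>
  The transvection along \<open>w = v - b\<^sub>0\<close> that maps \<open>b\<^sub>0\<close> to \<open>v\<close>; it is integral since \<open>form b\<^sub>0 v\<close>
  is a unit.
\<close>

lemma similitude_transvection:
  assumes b: "similitude_family 1 b" and v: "v \<in> ospan b" "form (b 0) v \<notin> \<pi>\<O>"
  shows "\<exists>b'. similitude_family 1 b' \<and> ospan b' = ospan b \<and> b' 0 = v"
proof -
  have L: "primitive_lattice (ospan b)"
    by (rule similitude_primitive[OF b])
  have sub: "submod (ospan b)"
    by (rule submod_ospan)
  have b0: "b 0 \<in> ospan b"
    using rank_pos by (intro ospan_generator) simp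
  define w where "w = v - b 0"
  define a where "a = inverse (form (b 0) v)"
  have ne: "form (b 0) v \<noteq> 0"
    using v(2) max_ideal_0 by auto
  have a: "a \<in> \<O>"
    unfolding a_def using primitive_form[OF L b0 v(1)] v(2) by (rule inverse_unit)
  have w: "w \<in> ospan b"
    unfolding w_def using submod_diff[OF sub v(1) b0] .
  define b' where "b' i = b i + (a * form (b i) w) *s w" for i
  have "form (b' i) (b' j) = form (b i) (b j)" for i j
  proof -
    have "form (b' i) (b' j) = form (b i) (b j) + a * form (b j) w * form (b i) w
        + a * form (b i) w * form w (b j)"
      by (simp add: b'_def form_linear form_alternating algebra_simps)
    also have "form w (b j) = - form (b j) w"
      by (rule form_swap)
    finally show ?thesis
      by simp
  qed
  then have b': "similitude_family 1 b'"
    using b by (simp add: similitude_family_def)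
  have "b' i \<in> ospan b" if "i < 2 * n" for i
    unfolding b'_def using ospan_generator[OF that, of b] a w primitive_form[OF L]
    by (intro submod_add[OF sub] submod_scale[OF sub] val_ring_mult) auto
  then have "ospan b' \<subseteq> ospan b"
    by (intro ospan_subset sub)
  then have "ospan b' = ospan b"
    by (rule primitive_subset_eq[OF similitude_primitive[OF b'] L])
  moreover have "b' 0 = v"
    using ne by (simp add: b'_def a_def w_def form_linear form_alternating)
  ultimately show ?thesis
    using b' by blast
qed

text \<open>
  Two transvections suffice: a vector pairing to units with both \<open>b\<^sub>0\<close> and \<open>e\<close> exists because
  \<open>L/\<pi>L\<close> is not the union of two proper subspaces.
\<close>

lemma similitude_extend:
  assumes b: "similitude_family 1 b" and e: "e \<in> ospan b" "e \<notin> dilate \<pi> (ospan b)"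
  shows "\<exists>b'. similitude_family 1 b' \<and> ospan b' = ospan b \<and> b' 0 = e"
proof -
  have L: "primitive_lattice (ospan b)"
    by (rule similitude_primitive[OF b])
  have b0: "b 0 \<in> ospan b"
    using rank_pos by (intro ospan_generator) simp
  have bn: "b n \<in> ospan b" "form (b 0) (b n) = 1"
    using rank_pos b ospan_generator[of n b] by (auto simp: similitude_family_def J_mat_index)
  obtain y where y: "y \<in> ospan b" "form e y \<notin> \<pi>\<O>"
    using primitive_pairing[OF L e] by blast
  have "\<exists>w\<in>ospan b. form (b 0) w \<notin> \<pi>\<O> \<and> form e w \<notin> \<pi>\<O>"
  proof (cases "form e (b n) \<in> \<pi>\<O> \<and> form (b 0) y \<in> \<pi>\<O>")
    case True
    have "form (b 0) (b n + y) \<notin> \<pi>\<O>"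
      using True max_ideal_add[of "form (b 0) (b n + y)" "- form (b 0) y"] max_ideal_minus
        one_notin_max_ideal by (auto simp: form_linear bn(2))
    moreover have "form e (b n + y) \<notin> \<pi>\<O>"
      using True max_ideal_add[of "form e (b n + y)" "- form e (b n)"] max_ideal_minus y(2)
      by (auto simp: form_linear)
    ultimately show ?thesis
      using submod_add[OF submod_ospan bn(1) y(1)] by blast
  next
    case False
    then show ?thesis
      using bn y one_notin_max_ideal by metis
  qed
  then obtain w where w: "w \<in> ospan b" "form (b 0) w \<notin> \<pi>\<O>" "form e w \<notin> \<pi>\<O>"
    by blast
  obtain b1 where b1: "similitude_family 1 b1" "ospan b1 = ospan b" "b1 0 = w"
    using similitude_transvection[OF b w(1,2)] by blast
  have "form (b1 0) e \<notin> \<pi>\<O>"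
    using w(3) form_swap_max_ideal b1(3) by blast
  then show ?thesis
    using similitude_transvection[OF b1(1), of e] b1(2) e(1) by simp
qed

lemma neighbour_is_shift:
  assumes b: "similitude_family 1 b" and nb: "neighbour (ospan b) L'"
  shows "\<exists>b'. similitude_family 1 b' \<and> ospan b' = ospan b \<and> L' = ospan (shift_family b')"
proof -
  have L: "primitive_lattice (ospan b)"
    by (rule similitude_primitive[OF b])
  have L': "primitive_lattice L'"
    by (rule neighbour_primitive[OF nb])
  obtain x where x: "x \<in> L'" "x \<notin> ospan b" "\<pi> *s x \<in> ospan b"
    using nb by (auto simp: neighbour_def)
  have "\<pi> *s x \<notin> dilate \<pi> (ospan b)"
    using x(2) by (simp add: uniformizer_scale_mem_dilate)
  then obtain b' where b': "similitude_family 1 b'" "ospan b' = ospan b" "b' 0 = \<pi> *s x"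
    using similitude_extend[OF b x(3)] by blast
  have xb: "x = inverse \<pi> *s b' 0"
    by (simp add: b'(3) uniformizer_nonzero)
  have "shift_family b' i \<in> L'" if i: "i < 2 * n" for i
  proof (cases "i = 0")
    case True
    then show ?thesis
      using x(1) xb by (simp add: shift_family_def)
  next
    case False
    have "shift_family b' i \<in> ospan b"
      using ospan_generator[OF i, of b'] submod_scale[OF submod_ospan val_ring_uniformizer] False
      by (auto simp: shift_family_def b'(2))
    moreover have "form x (shift_family b' i) \<in> \<O>"
      using b'(1) i False rank_pos val_ring_0 val_ring_1
      by (auto simp: xb shift_family_def form_linear similitude_family_def J_mat_index uniformizer_nonzero)
    ultimately show ?thesis
      by (rule neighbour_mem[OF L nb x(1,2)])
  qed
  then have "ospan (shift_family b') \<subseteq> L'"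
    by (intro ospan_subset primitive_submod[OF L'])
  then have "ospan (shift_family b') = L'"
    by (rule primitive_subset_eq[OF similitude_primitive[OF similitude_shift[OF b'(1)]] L'])
  then show ?thesis
    using b' by blast
qed

definition coset_lattice :: "(nat \<Rightarrow> 'v) \<Rightarrow> 'k mat \<Rightarrow> 'v set" where
  "coset_lattice b g = dilate (inverse \<pi>) (ospan (recombine b g))"

lemma recombine_double_coset:
  assumes b: "similitude_family 1 b" and \<gamma>: "\<gamma>1 \<in> Sp_O n" "\<gamma>2 \<in> Sp_O n"
    and g: "g = \<gamma>1 * (diag_elt n * \<gamma>2)"
  shows "similitude_family (\<pi>\<^sup>2) (recombine b g)"
    and "coset_lattice b g = ospan (shift_family (recombine b \<gamma>1))"
proof -
  define b1 where "b1 = recombine b \<gamma>1"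
  define b2 where "b2 = recombine b1 (diag_elt n)"
  have b1: "similitude_family 1 b1"
    unfolding b1_def using similitude_recombine(1)[OF b \<gamma>(1)] .
  have b2_eq: "b2 j = diag_entry n j *s b1 j" if "j < 2 * n" for j
    unfolding b2_def using recombine_diag[OF that] .
  have b2_shift: "b2 j = \<pi> *s shift_family b1 j" if "j < 2 * n" for j
    using b2_eq[OF that] rank_pos uniformizer_nonzero
    by (auto simp: diag_entry_def shift_family_def power2_eq_square)
  have "similitude_family (\<pi>\<^sup>2) b2"
    using similitude_shift[OF b1] b2_shift
    by (simp add: similitude_family_def form_linear power2_eq_square)
  then have b3: "similitude_family (\<pi>\<^sup>2) (recombine b2 \<gamma>2)" "ospan (recombine b2 \<gamma>2) = ospan b2"
    using similitude_recombine[OF _ \<gamma>(2)] by auto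
  have eq: "recombine b g j = recombine b2 \<gamma>2 j" if j: "j < 2 * n" for j
  proof -
    have carr: "\<gamma>1 \<in> carrier_mat (2 * n) (2 * n)" "\<gamma>2 \<in> carrier_mat (2 * n) (2 * n)"
      "diag_elt n * \<gamma>2 \<in> carrier_mat (2 * n) (2 * n)"
      using \<gamma> Sp_O_carrier mult_carrier_mat[OF diag_elt_carrier Sp_O_carrier[OF \<gamma>(2)]] by auto
    show ?thesis
      unfolding g b2_def b1_def using recombine_mult[OF carr(1,3) j] recombine_mult[OF diag_elt_carrier carr(2) j]
      by simp
  qed
  show "similitude_family (\<pi>\<^sup>2) (recombine b g)"
    by (rule similitude_cong[OF _ b3(1)]) (simp add: eq)
  have "ospan (recombine b g) = ospan b2"
    using ospan_cong[OF eq] b3(2) by simp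
  also have "\<dots> = dilate \<pi> (ospan (shift_family b1))"
    unfolding ospan_dilate by (rule ospan_cong) (rule b2_shift)
  finally show "coset_lattice b g = ospan (shift_family (recombine b \<gamma>1))"
    by (simp add: coset_lattice_def dilate_dilate dilate_1 uniformizer_nonzero b1_def)
qed

lemma coset_lattice_image:
  assumes b: "similitude_family 1 b"
  shows "coset_lattice b ` double_coset n = {L'. neighbour (ospan b) L'}"
proof (intro equalityI subsetI)
  fix L' assume "L' \<in> coset_lattice b ` double_coset n"
  then obtain \<gamma>1 \<gamma>2 where \<gamma>: "\<gamma>1 \<in> Sp_O n" "\<gamma>2 \<in> Sp_O n" "L' = coset_lattice b (\<gamma>1 * (diag_elt n * \<gamma>2))"
    unfolding double_coset_eq by blast
  then have "L' = ospan (shift_family (recombine b \<gamma>1))"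
    using recombine_double_coset(2)[OF b \<gamma>(1,2)] by simp
  then show "L' \<in> {L'. neighbour (ospan b) L'}"
    using shift_neighbour[OF similitude_recombine(1)[OF b \<gamma>(1)]] similitude_recombine(2)[OF b \<gamma>(1)] by simp
next
  fix L' assume "L' \<in> {L'. neighbour (ospan b) L'}"
  then obtain b' where b': "similitude_family 1 b'" "ospan b' = ospan b" "L' = ospan (shift_family b')"
    using neighbour_is_shift[OF b] by blast
  obtain \<gamma>1 where \<gamma>1: "\<gamma>1 \<in> Sp_O n" "\<forall>j<2*n. b' j = recombine b \<gamma>1 j"
    using similitude_change[OF b b'(1) _ b'(2)] by auto
  have "coset_lattice b (\<gamma>1 * (diag_elt n * 1\<^sub>m (2 * n))) = ospan (shift_family (recombine b \<gamma>1))"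
    using recombine_double_coset(2)[OF b \<gamma>1(1) one_in_Sp_O refl] .
  also have "\<dots> = L'"
    unfolding b'(3) using \<gamma>1(2) by (intro ospan_cong) (simp add: shift_family_def)
  finally show "L' \<in> coset_lattice b ` double_coset n"
    unfolding double_coset_eq using \<gamma>1(1) one_in_Sp_O by blast
qed

lemma coset_lattice_eq_iff:
  assumes b: "similitude_family 1 b" and g: "g \<in> double_coset n" and h: "h \<in> double_coset n"
  shows "coset_lattice b g = coset_lattice b h
    \<longleftrightarrow> g <#\<^bsub>mat_monoid n\<^esub> Sp_O n = h <#\<^bsub>mat_monoid n\<^esub> Sp_O n"
proof
  have \<pi>2: "\<pi>\<^sup>2 \<noteq> 0"
    using uniformizer_nonzero by simp
  have carr: "g \<in> carrier_mat (2 * n) (2 * n)" if g: "g \<in> double_coset n" for g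
  proof -
    obtain \<gamma>1 \<gamma>2 where "\<gamma>1 \<in> Sp_O n" "\<gamma>2 \<in> Sp_O n" "g = \<gamma>1 * (diag_elt n * \<gamma>2)"
      using g unfolding double_coset_eq by blast
    then show ?thesis
      using mult_carrier_mat[OF Sp_O_carrier mult_carrier_mat[OF diag_elt_carrier Sp_O_carrier]] by simp
  qed
  have sim: "similitude_family (\<pi>\<^sup>2) (recombine b g)" if g: "g \<in> double_coset n" for g
  proof -
    obtain \<gamma>1 \<gamma>2 where "\<gamma>1 \<in> Sp_O n" "\<gamma>2 \<in> Sp_O n" "g = \<gamma>1 * (diag_elt n * \<gamma>2)"
      using g unfolding double_coset_eq by blast
    then show ?thesis
      by (rule recombine_double_coset(1)[OF b])
  qed
  show "g <#\<^bsub>mat_monoid n\<^esub> Sp_O n = h <#\<^bsub>mat_monoid n\<^esub> Sp_O n"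
    if eq: "coset_lattice b g = coset_lattice b h"
  proof -
    have sub: "g <#\<^bsub>mat_monoid n\<^esub> Sp_O n \<subseteq> h <#\<^bsub>mat_monoid n\<^esub> Sp_O n"
      if g: "g \<in> double_coset n" and h: "h \<in> double_coset n" and eq: "coset_lattice b g = coset_lattice b h"
      for g h
    proof -
      have "dilate \<pi> (coset_lattice b g) = dilate \<pi> (coset_lattice b h)"
        using eq by simp
      then have "ospan (recombine b g) = ospan (recombine b h)"
        by (simp add: coset_lattice_def dilate_dilate dilate_1 uniformizer_nonzero)
      then obtain \<gamma> where \<gamma>: "\<gamma> \<in> Sp_O n" "\<forall>j<2*n. recombine b g j = recombine (recombine b h) \<gamma> j"
        using similitude_change[OF sim[OF h] sim[OF g] \<pi>2] by blast
      have "g = h * \<gamma>"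
      proof (rule recombine_inject[OF similitude_indep[OF b]])
        show "recombine b g j = recombine b (h * \<gamma>) j" if "j < 2 * n" for j
          using \<gamma>(2) that recombine_mult[OF carr[OF h] Sp_O_carrier[OF \<gamma>(1)] that] by simp
      qed (use carr[OF g] carr[OF h] Sp_O_carrier[OF \<gamma>(1)] in auto)
      then have gh: "g * \<delta> = h * (\<gamma> * \<delta>)" if "\<delta> \<in> Sp_O n" for \<delta>
        using assoc_mult_mat[OF carr[OF h] Sp_O_carrier[OF \<gamma>(1)] Sp_O_carrier[OF that]] by simp
      show ?thesis
        unfolding left_coset_eq
      proof clarify
        fix \<delta> assume \<delta>: "\<delta> \<in> Sp_O n"
        then have "\<gamma> * \<delta> \<in> Sp_O n"
          using Sp_O_mult[OF b _ \<gamma>(1)] by simp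
        then show "\<exists>\<gamma>'. g * \<delta> = h * \<gamma>' \<and> \<gamma>' \<in> Sp_O n"
          using gh[OF \<delta>] by blast
      qed
    qed
    show ?thesis
      using sub[OF g h eq] sub[OF h g eq[symmetric]] by (rule subset_antisym)
  qed
  show "coset_lattice b g = coset_lattice b h"
    if eq: "g <#\<^bsub>mat_monoid n\<^esub> Sp_O n = h <#\<^bsub>mat_monoid n\<^esub> Sp_O n"
  proof -
    have "g * 1\<^sub>m (2 * n) \<in> g <#\<^bsub>mat_monoid n\<^esub> Sp_O n"
      unfolding left_coset_eq using one_in_Sp_O by blast
    then have "g \<in> h <#\<^bsub>mat_monoid n\<^esub> Sp_O n"
      using right_mult_one_mat[OF carr[OF g]] by (simp add: eq)
    then obtain \<gamma> where \<gamma>: "\<gamma> \<in> Sp_O n" "g = h * \<gamma>"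
      unfolding left_coset_eq by blast
    have "ospan (recombine b g) = ospan (recombine (recombine b h) \<gamma>)"
      unfolding \<gamma>(2) by (rule ospan_cong) (rule recombine_mult[OF carr[OF h] Sp_O_carrier[OF \<gamma>(1)]])
    also have "\<dots> = ospan (recombine b h)"
      using \<gamma>(1) by (intro ospan_recombine) (simp add: Sp_O_def)
    finally show ?thesis
      by (simp add: coset_lattice_def)
  qed
qed

lemma left_cosets_neighbours:
  assumes b: "similitude_family 1 b"
  shows "finite (left_cosets n) \<and> card {L'. neighbour (ospan b) L'} = card (left_cosets n)"
proof -
  have "\<exists>h. bij_betw h (coset_lattice b ` double_coset n) (left_cosets n)"
    unfolding left_cosets_def by (rule bij_betw_images_same_fibres) (rule coset_lattice_eq_iff[OF b])
  then obtain h where h: "bij_betw h {L'. neighbour (ospan b) L'} (left_cosets n)"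
    unfolding coset_lattice_image[OF b] ..
  have "finite {L'. neighbour (ospan b) L'}"
    by (rule finite_neighbours[OF similitude_primitive[OF b]])
  then show ?thesis
    using bij_betw_finite[OF h] bij_betw_same_card[OF h] by simp
qed


section \<open>Special vertices\<close>

text \<open>
  Dividing the given lattice by the power \<open>\<mu> div 2\<close> of \<open>\<pi>\<close> reduces \<open>\<mu>\<close> to 0 or 1. The exponents
  \<open>a i\<close> are absorbed into the basis.
\<close>

lemma special_vertex_family:
  assumes "special_vertex t"
  shows "\<exists>b c. similitude_family c b \<and> (c = 1 \<or> c = \<pi>) \<and> t = homothety_class (ospan b)"
proof -
  obtain u w and a :: "nat \<Rightarrow> int" and \<mu> :: int where uw: "symplectic_basis u w"
    and t: "t = homothety_class
      {(\<Sum>i=1..n. (c i * \<pi> powi a i) *s u i) + (\<Sum>i=1..n. (d i * \<pi> powi (\<mu> - a i)) *s w i)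
        |c d. \<forall>i\<in>{1..n}. c i \<in> \<O> \<and> d i \<in> \<O>}"
    using assms unfolding special_vertex_def by blast
  define k where "k = \<mu> div 2"
  have k: "\<mu> - 2 * k = 0 \<or> \<mu> - 2 * k = 1"
    unfolding k_def by presburger
  define b where "b i = (if i < n then \<pi> powi (a (Suc i) - k) *s u (Suc i)
    else \<pi> powi (\<mu> - a (Suc (i - n)) - k) *s w (Suc (i - n)))" for i
  define c where "c = \<pi> powi (\<mu> - 2 * k)"
  have powi: "\<pi> powi i * \<pi> powi j = \<pi> powi (i + j)" for i j
    by (simp add: power_int_add uniformizer_nonzero)
  have uu: "form (u (Suc i)) (u (Suc j)) = 0" "form (w (Suc i)) (w (Suc j)) = 0"
      "form (u (Suc i)) (w (Suc j)) = (if i = j then 1 else 0)"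
      "form (w (Suc i)) (u (Suc j)) = (if i = j then - 1 else 0)" if "i < n" "j < n" for i j
    using uw that form_swap[of "w (Suc i)" "u (Suc j)"] unfolding symplectic_basis_def by auto
  have "similitude_family c b"
    unfolding similitude_family_def
  proof (intro allI impI)
    fix i j assume ij: "i < 2 * n" "j < 2 * n"
    have cc: "\<pi> powi (a m - k) * \<pi> powi (\<mu> - a m - k) = c" "\<pi> powi (\<mu> - a m - k) * \<pi> powi (a m - k) = c" for m
      by (simp_all add: powi c_def algebra_simps)
    show "form (b i) (b j) = c * J_mat n $$ (i, j)"
    proof (cases "i < n"; cases "j < n")
      assume "i < n" "j < n"
      then show ?thesis
        using ij by (simp add: b_def form_linear uu J_mat_index)
    next
      assume *: "i < n" "\<not> j < n"
      then have "j - n < n" "i = j - n \<longleftrightarrow> j = i + n"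
        using ij by auto
      then show ?thesis
        using ij * cc by (auto simp: b_def form_linear uu J_mat_index)
    next
      assume *: "\<not> i < n" "j < n"
      then have "i - n < n" "i - n = j \<longleftrightarrow> i = j + n"
        using ij by auto
      then show ?thesis
        using ij * cc by (auto simp: b_def form_linear uu J_mat_index)
    next
      assume *: "\<not> i < n" "\<not> j < n"
      then have "i - n < n" "j - n < n"
        using ij by auto
      then show ?thesis
        using ij * by (simp add: b_def form_linear uu J_mat_index)
    qed
  qed
  moreover have "c = 1 \<or> c = \<pi>"
    using k by (auto simp: c_def)
  moreover have "t = homothety_class (ospan b)"
  proof -
    define e where "e = (\<lambda>i. \<pi> powi k *s b i)"
    have e: "e i = \<pi> powi a (Suc i) *s u (Suc i)" "e (i + n) = \<pi> powi (\<mu> - a (Suc i)) *s w (Suc i)"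
      if "i < n" for i
      using that by (simp_all add: e_def b_def powi)
    have sum: "(\<Sum>i<2*n. f i *s e i) = (\<Sum>i=1..n. (f (i - 1) * \<pi> powi a i) *s u i)
        + (\<Sum>i=1..n. (f (i - 1 + n) * \<pi> powi (\<mu> - a i)) *s w i)" for f
    proof -
      have "(\<Sum>i<2*n. f i *s e i) = (\<Sum>i<n. f i *s e i) + (\<Sum>i=n..<n+n. f i *s e i)"
        unfolding mult_2 lessThan_atLeast0 by (rule sum.atLeastLessThan_concat[symmetric]) auto
      also have "(\<Sum>i=n..<n+n. f i *s e i) = (\<Sum>i<n. f (i + n) *s e (i + n))"
        using sum.shift_bounds_nat_ivl[of "\<lambda>i. f i *s e i" 0 n n] by (simp add: lessThan_atLeast0)
      finally show ?thesis
        by (simp add: e sum.atLeast1_atMost_eq)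
    qed
    have "{(\<Sum>i=1..n. (c i * \<pi> powi a i) *s u i) + (\<Sum>i=1..n. (d i * \<pi> powi (\<mu> - a i)) *s w i)
        |c d. \<forall>i\<in>{1..n}. c i \<in> \<O> \<and> d i \<in> \<O>} = ospan e"
    proof (intro equalityI subsetI)
      fix x assume "x \<in> {(\<Sum>i=1..n. (c i * \<pi> powi a i) *s u i) + (\<Sum>i=1..n. (d i * \<pi> powi (\<mu> - a i)) *s w i)
        |c d. \<forall>i\<in>{1..n}. c i \<in> \<O> \<and> d i \<in> \<O>}"
      then obtain c d where cd: "\<forall>i\<in>{1..n}. c i \<in> \<O> \<and> d i \<in> \<O>"
        and x: "x = (\<Sum>i=1..n. (c i * \<pi> powi a i) *s u i) + (\<Sum>i=1..n. (d i * \<pi> powi (\<mu> - a i)) *s w i)"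
        by blast
      define f where "f i = (if i < n then c (Suc i) else d (Suc (i - n)))" for i
      have "(\<Sum>i<2*n. f i *s e i) = x"
        unfolding sum x by (intro arg_cong2[of _ _ _ _ "(+)"] sum.cong) (auto simp: f_def)
      moreover have "f i \<in> \<O>" if "i < 2 * n" for i
        using cd that by (auto simp: f_def)
      ultimately show "x \<in> ospan e"
        using ospanI[of f e] by simp
    next
      fix x assume "x \<in> ospan e"
      then obtain f where f: "\<forall>i<2*n. f i \<in> \<O>" "x = (\<Sum>i<2*n. f i *s e i)"
        unfolding ospan_def by blast
      then have "\<forall>i\<in>{1..n}. f (i - 1) \<in> \<O> \<and> f (i - 1 + n) \<in> \<O>"
        by auto
      then show "x \<in> {(\<Sum>i=1..n. (c i * \<pi> powi a i) *s u i) + (\<Sum>i=1..n. (d i * \<pi> powi (\<mu> - a i)) *s w i)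
        |c d. \<forall>i\<in>{1..n}. c i \<in> \<O> \<and> d i \<in> \<O>}"
        unfolding f(2) sum by (intro CollectI exI[of _ "\<lambda>i. f (i - 1)"] exI[of _ "\<lambda>i. f (i - 1 + n)"]) simp
    qed
    also have "ospan e = dilate (\<pi> powi k) (ospan b)"
      by (simp add: e_def ospan_dilate)
    finally show ?thesis
      unfolding t using homothety_class_dilate uniformizer_nonzero by simp
  qed
  ultimately show ?thesis
    by blast
qed

interpretation S: pos_symplectic_space ord \<pi> scale "\<lambda>x y. form x y / \<pi>" n
  by (rule scaled_space[OF uniformizer_nonzero])

lemma card_close_to_special:
  assumes t: "special_vertex t"
  shows "finite {t'. close_vertices t t'} \<and> finite (left_cosets n)
    \<and> card {t'. close_vertices t t'} = card (left_cosets n)"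
proof -
  obtain b c where bc: "similitude_family c b" "c = 1 \<or> c = \<pi>" and tb: "t = homothety_class (ospan b)"
    using special_vertex_family[OF t] by blast
  have count: ?thesis if L: "{t'. close_vertices t t'} = homothety_class ` N" "finite N"
    "inj_on homothety_class N" "finite (left_cosets n) \<and> card N = card (left_cosets n)" for N
    using L by (simp add: card_image)
  from bc(2) show ?thesis
  proof
    assume "c = 1"
    then have b: "similitude_family 1 b"
      using bc(1) by simp
    have L: "primitive_lattice (ospan b)"
      by (rule similitude_primitive[OF b])
    show ?thesis
    proof (rule count)
      show "{t'. close_vertices t t'} = homothety_class ` {L'. neighbour (ospan b) L'}"
        unfolding tb by (rule close_to_primitive[OF L])
      show "inj_on homothety_class {L'. neighbour (ospan b) L'}"
        by (rule inj_on_subset[OF inj_on_homothety_class_primitive]) (auto dest: neighbour_primitive)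
    qed (use finite_neighbours[OF L] left_cosets_neighbours[OF b] in auto)
  next
    assume "c = \<pi>"
    then have b: "S.similitude_family 1 b"
      using bc(1) uniformizer_nonzero by (simp add: similitude_family_def S.similitude_family_def)
    have L: "S.primitive_lattice (ospan b)"
      by (rule S.similitude_primitive[OF b])
    have v: "is_vertex (homothety_class (ospan b))"
      using t by (simp add: special_vertex_def tb)
    show ?thesis
    proof (rule count)
      show "{t'. close_vertices t t'} = homothety_class ` {L'. S.neighbour (ospan b) L'}"
        unfolding tb by (rule close_to_lagrangian[OF _ v]) (use L scaled_primitive_iff in blast)
      show "inj_on homothety_class {L'. S.neighbour (ospan b) L'}"
        by (rule inj_on_subset[OF S.inj_on_homothety_class_primitive]) (auto dest: S.neighbour_primitive)
    qed (use S.finite_neighbours[OF L] S.left_cosets_neighbours[OF b] in auto)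
  qed
qed

end

theorem theorem2p1:
  fixes ord :: "'k::field \<Rightarrow> int" and \<pi> :: 'k
    and scale :: "'k \<Rightarrow> 'v::ab_group_add \<Rightarrow> 'v"
    and form :: "'v \<Rightarrow> 'v \<Rightarrow> 'k" and n :: nat and t :: "'v set set"
  assumes "symplectic_space ord \<pi> scale form n"
    and "n \<ge> 2"
    and "symplectic_space.special_vertex ord \<pi> scale form n t"
  shows "finite {t'. symplectic_space.close_vertices ord \<pi> scale form n t t'}
    \<and> finite (discrete_valuation.left_cosets ord \<pi> n)
    \<and> card {t'. symplectic_space.close_vertices ord \<pi> scale form n t t'}
        = card (discrete_valuation.left_cosets ord \<pi> n)"
proof -
  have "pos_symplectic_space ord \<pi> scale form n"
    using assms by (simp add: pos_symplectic_space_def pos_symplectic_space_axioms_def)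
  then show ?thesis
    using assms(3) by (rule pos_symplectic_space.card_close_to_special)
qed

end
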